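(* Let $\mathfrak k$ be a field, $n\ge 1$ an integer, and let $q\in\mathfrak k^*$ be generic (not a root of unity). Let $L_{\mathrm{sh}_{1,n-1}}:H_n(q)\to H_n(q)$, $x\mapsto \mathrm{sh}_{1,n-1}\,x$, be the operator of left multiplication by the additive 1-shuffle. Then the eigenvalues of $L_{\mathrm{sh}_{1,n-1}}$ are among $q^{j-1}[j]_q$ ($=1+q^2+\cdots+q^{2j-2}$ for $j\ge1$, and $0$ for $j=0$), $j=0,1,\dots,n$, and for every $j\in\{0,1,\dots,n\}$ the multiplicity of the eigenvalue $q^{j-1}[j]_q$ is $$d_{n,j}=\frac{n!}{j!}\sum_{i=0}^{n-j}\frac{(-1)^i}{i!},$$ the number of permutations in the symmetric group $\mathbb S_n$ with exactly $j$ fixed points (multiplicity $0$, for $j=n-1$, $n\geq 2$, or for $n=1,j=0$, means that the number is not an eigenvalue).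
   Context: Notation: $[j]_q=(q^j-q^{-j})/(q-q^{-1})$. $H_n(q)$ is the quotient of the group algebra over $\mathfrak k$ of the braid group $B_n$ (generators $\sigma_1,\dots,\sigma_{n-1}$; relations $\sigma_i\sigma_j\sigma_i=\sigma_j\sigma_i\sigma_j$ for $|i-j|=1$, $\sigma_i\sigma_j=\sigma_j\sigma_i$ for $|i-j|>1$) by $\sigma_i^2=(q-q^{-1})\sigma_i+1$; it has dimension $n!$. The additive 1-shuffle is $$\mathrm{sh}_{1,n-1}=1+q\sigma_{n-1}+q^2\sigma_{n-2}\sigma_{n-1}+\cdots+q^{n-1}\sigma_1\sigma_2\cdots\sigma_{n-1}$$ (and $\mathrm{sh}_{1,0}=1$). Multiplicity of an eigenvalue means its multiplicity as a root of the characteristic polynomial. *)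

theory Defs
  imports
    "Jordan_Normal_Form.VS_Connect"
    "Jordan_Normal_Form.Char_Poly"
    "HOL-Algebra.QuotRing"
    "HOL-Combinatorics.Permutations"
begin

hide_const (open) Multiset.mult
hide_const (open) Polynomial.smult
hide_const (open) Modules.module

section \<open>Groups given by generators and relations\<close>

text \<open>The letter \<open>(x, True)\<close> stands for the generator \<open>x\<close> and \<open>(x, False)\<close> for its inverse.\<close>

type_synonym 'g gword = "('g \<times> bool) list"

definition gwords :: "'g set \<Rightarrow> 'g gword set" where
  "gwords X = lists (X \<times> UNIV)"

inductive_set pres_cong :: "'g set \<Rightarrow> ('g gword \<times> 'g gword) set \<Rightarrow> ('g gword \<times> 'g gword) set"
  for X :: "'g set" and R :: "('g gword \<times> 'g gword) set" where
  pres_refl: "u \<in> gwords X \<Longrightarrow> (u, u) \<in> pres_cong X R"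
| pres_sym: "(u, v) \<in> pres_cong X R \<Longrightarrow> (v, u) \<in> pres_cong X R"
| pres_trans: "(u, v) \<in> pres_cong X R \<Longrightarrow> (v, w) \<in> pres_cong X R \<Longrightarrow> (u, w) \<in> pres_cong X R"
| pres_context: "(u, v) \<in> pres_cong X R \<Longrightarrow> a \<in> gwords X \<Longrightarrow> b \<in> gwords X
    \<Longrightarrow> (a @ u @ b, a @ v @ b) \<in> pres_cong X R"
| pres_cancel: "x \<in> X \<Longrightarrow> ([(x, s), (x, \<not> s)], []) \<in> pres_cong X R"
| pres_rel: "(u, v) \<in> R \<Longrightarrow> u \<in> gwords X \<Longrightarrow> v \<in> gwords X \<Longrightarrow> (u, v) \<in> pres_cong X R"

definition presented_group :: "'g set \<Rightarrow> ('g gword \<times> 'g gword) set \<Rightarrow> 'g gword set monoid" where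
  "presented_group X R =
    \<lparr>carrier = gwords X // pres_cong X R,
     mult = (\<lambda>A B. \<Union>u\<in>A. \<Union>v\<in>B. pres_cong X R `` {u @ v}),
     one = pres_cong X R `` {[]}\<rparr>"

section \<open>Group algebras and quotient algebras\<close>

text \<open>A \<open>module\<close> record carries a multiplication besides the scalar multiplication, so it can
  hold an algebra over a field.  Elements of the group algebra are the finitely supported
  functions on the group, with convolution as product.\<close>

definition group_algebra :: "('g, 'b) monoid_scheme \<Rightarrow> ('k::field, 'g \<Rightarrow> 'k) module" where
  "group_algebra G =
    \<lparr>carrier = {f. finite {g. f g \<noteq> 0} \<and> {g. f g \<noteq> 0} \<subseteq> carrier G},
     mult = (\<lambda>f f' g. \<Sum>(h, h') | f h \<noteq> 0 \<and> f' h' \<noteq> 0 \<and> h \<otimes>\<^bsub>G\<^esub> h' = g. f h * f' h'),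
     one = (\<lambda>g. if g = \<one>\<^bsub>G\<^esub> then 1 else 0),
     zero = (\<lambda>g. 0),
     add = (\<lambda>f f' g. f g + f' g),
     smult = (\<lambda>c f g. c * f g)\<rparr>"

definition group_algebra_elem :: "'g \<Rightarrow> 'g \<Rightarrow> 'k::field" where
  "group_algebra_elem g = (\<lambda>h. if h = g then 1 else 0)"

definition quot_algebra :: "('k, 'v, 'm) module_scheme \<Rightarrow> 'v set \<Rightarrow> ('k, 'v set) module" where
  "quot_algebra A I =
    \<lparr>carrier = carrier (A Quot I), mult = mult (A Quot I), one = one (A Quot I),
     zero = zero (A Quot I), add = add (A Quot I),
     smult = (\<lambda>c S. \<Union>x\<in>S. I +>\<^bsub>A\<^esub> (c \<odot>\<^bsub>A\<^esub> x))\<rparr>"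

section \<open>Braid groups and Hecke algebras\<close>

definition braid_relations :: "nat \<Rightarrow> (nat gword \<times> nat gword) set" where
  "braid_relations n =
    {([(i, True), (j, True), (i, True)], [(j, True), (i, True), (j, True)]) | i j.
       i \<in> {1..<n} \<and> j \<in> {1..<n} \<and> \<bar>int i - int j\<bar> = 1}
    \<union> {([(i, True), (j, True)], [(j, True), (i, True)]) | i j.
       i \<in> {1..<n} \<and> j \<in> {1..<n} \<and> \<bar>int i - int j\<bar> > 1}"

definition braid_group :: "nat \<Rightarrow> nat gword set monoid" where
  "braid_group n = presented_group {1..<n} (braid_relations n)"

definition braid_gen :: "nat \<Rightarrow> nat \<Rightarrow> nat gword set" where
  "braid_gen n i = pres_cong {1..<n} (braid_relations n) `` {[(i, True)]}"

definition braid_algebra :: "nat \<Rightarrow> ('k::field, nat gword set \<Rightarrow> 'k) module" where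
  "braid_algebra n = group_algebra (braid_group n)"

definition hecke_ideal :: "nat \<Rightarrow> 'k::field \<Rightarrow> (nat gword set \<Rightarrow> 'k) set" where
  "hecke_ideal n q = Idl\<^bsub>braid_algebra n\<^esub>
    ((\<lambda>i. let s = group_algebra_elem (braid_gen n i) in
        (s \<otimes>\<^bsub>braid_algebra n\<^esub> s) \<ominus>\<^bsub>braid_algebra n\<^esub>
        (((q - inverse q) \<odot>\<^bsub>braid_algebra n\<^esub> s) \<oplus>\<^bsub>braid_algebra n\<^esub> \<one>\<^bsub>braid_algebra n\<^esub>))
      ` {1..<n})"

definition hecke_algebra :: "nat \<Rightarrow> 'k::field \<Rightarrow> ('k, (nat gword set \<Rightarrow> 'k) set) module" where
  "hecke_algebra n q = quot_algebra (braid_algebra n) (hecke_ideal n q)"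

definition hecke_gen :: "nat \<Rightarrow> 'k::field \<Rightarrow> nat \<Rightarrow> (nat gword set \<Rightarrow> 'k) set" where
  "hecke_gen n q i = hecke_ideal n q +>\<^bsub>braid_algebra n\<^esub> group_algebra_elem (braid_gen n i)"

text \<open>The summand with index \<open>k\<close> is \<open>q\<^sup>k \<sigma>\<^bsub>n-k\<^esub> \<sigma>\<^bsub>n-k+1\<^esub> \<dots> \<sigma>\<^bsub>n-1\<^esub>\<close>.\<close>

definition additive_shuffle :: "nat \<Rightarrow> 'k::field \<Rightarrow> (nat gword set \<Rightarrow> 'k) set" where
  "additive_shuffle n q =
    (\<Oplus>\<^bsub>hecke_algebra n q\<^esub>k\<in>{..<n}. q ^ k \<odot>\<^bsub>hecke_algebra n q\<^esub>
       foldr (\<lambda>i x. hecke_gen n q i \<otimes>\<^bsub>hecke_algebra n q\<^esub> x) [n - k..<n] \<one>\<^bsub>hecke_algebra n q\<^esub>)"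

definition shuffle_operator ::
    "nat \<Rightarrow> 'k::field \<Rightarrow> (nat gword set \<Rightarrow> 'k) set \<Rightarrow> (nat gword set \<Rightarrow> 'k) set" where
  "shuffle_operator n q = (\<lambda>x. additive_shuffle n q \<otimes>\<^bsub>hecke_algebra n q\<^esub> x)"

section \<open>Eigenvalues and characteristic polynomials of linear operators\<close>

definition operator_eigenvalue :: "('k::field, 'v, 'm) module_scheme \<Rightarrow> ('v \<Rightarrow> 'v) \<Rightarrow> 'k \<Rightarrow> bool" where
  "operator_eigenvalue V T c \<longleftrightarrow> (\<exists>x\<in>carrier V. x \<noteq> \<zero>\<^bsub>V\<^esub> \<and> T x = c \<odot>\<^bsub>V\<^esub> x)"

definition operator_matrix ::
    "('k::field, 'v, 'm) module_scheme \<Rightarrow> ('v \<Rightarrow> 'v) \<Rightarrow> 'v list \<Rightarrow> 'k mat \<Rightarrow> bool" where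
  "operator_matrix V T bs M \<longleftrightarrow>
     distinct bs \<and> vectorspace.basis class_ring V (set bs) \<and>
     M \<in> carrier_mat (length bs) (length bs) \<and>
     (\<forall>j<length bs. T (bs ! j) = (\<Oplus>\<^bsub>V\<^esub>i\<in>{..<length bs}. M $$ (i, j) \<odot>\<^bsub>V\<^esub> bs ! i))"

text \<open>Meaningful for linear operators on finite-dimensional spaces, where matrices with respect
  to different bases are similar and hence have the same characteristic polynomial.\<close>

definition operator_char_poly :: "('k::field, 'v, 'm) module_scheme \<Rightarrow> ('v \<Rightarrow> 'v) \<Rightarrow> 'k poly" where
  "operator_char_poly V T = (THE p. \<exists>bs M. operator_matrix V T bs M \<and> p = char_poly M)"

definition eigenvalue_multiplicity ::
    "('k::field, 'v, 'm) module_scheme \<Rightarrow> ('v \<Rightarrow> 'v) \<Rightarrow> 'k \<Rightarrow> nat" where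
  "eigenvalue_multiplicity V T c = Polynomial.order c (operator_char_poly V T)"

section \<open>Quantum integers\<close>

definition q_int :: "'k::field \<Rightarrow> nat \<Rightarrow> 'k" where
  "q_int q j = (q powi int j - q powi (- int j)) / (q - inverse q)"

definition shuffle_eigenvalue :: "'k::field \<Rightarrow> nat \<Rightarrow> 'k" where
  "shuffle_eigenvalue q j = q powi (int j - 1) * q_int q j"

end

theory Submission
  imports Defs "HOL-Library.Function_Algebras" "HOL-Combinatorics.Multiset_Permutations"
begin

text \<open>
  \<open>H\<^sub>n(q)\<close> acts on words with distinct letters \<open>1, \<dots>, n\<close>, the generator \<open>\<sigma>\<^sub>i\<close> permuting the letters
  in positions \<open>i\<close> and \<open>i + 1\<close>. Applying elements to the decreasing word identifies \<open>H\<^sub>n(q)\<close> with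
  the space of all such words, and the shuffle becomes the operator \<open>S\<^sub>n\<close> that inserts the last
  letter everywhere. From \<open>S\<^sub>n\<^sub>+\<^sub>1 = 1 + q S\<^sub>n \<sigma>\<^sub>n\<close> one gets \<open>S\<^sub>n\<^sub>+\<^sub>1 S\<^sub>n (\<sigma>\<^sub>n - q) = 0\<close>, so that
  \<open>S\<^sub>n B\<^sub>j = [j] B\<^sub>j + q\<^bsup>2j\<^esup> B\<^sub>j\<^sub>+\<^sub>1\<close> for \<open>B\<^sub>j = S\<^sub>n S\<^sub>n\<^sub>-\<^sub>1 \<cdots> S\<^sub>n\<^sub>-\<^sub>j\<^sub>+\<^sub>1\<close>, where \<open>[j]\<close> is the asserted
  eigenvalue; the images of the \<open>B\<^sub>j\<close> form a filtration on whose \<open>j\<close>-th layer \<open>S\<^sub>n\<close> acts as \<open>[j]\<close>.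

  To count dimensions, call a letter of a word single if it is smaller than all preceding letters
  and larger than the next letter, if there is one. The lexicographically largest word in the
  shuffle of a word \<open>u\<close> without single letters with the letters of a set \<open>v\<close> has exactly the
  elements of \<open>v\<close> as single letters, and every word arises once in this way. Hence the vectors
  \<open>B\<^sub>j(u v)\<close> with \<open>|v| = j\<close> are a basis, with respect to which \<open>S\<^sub>n\<close> is triangular. Words with single
  letters \<open>V\<close> correspond to words on the other letters without single letters, just as permutations
  with fixed points \<open>V\<close> correspond to derangements of the other points, so single letters are
  distributed like fixed points.
\<close>

section \<open>Characteristic polynomials of operators\<close>

lemma (in vector_space) independent_family_if_spans:
  assumes "finite I" "inj_on e I" "independent (e ` I)" "e ` I \<subseteq> span (f ` I)"
  shows "inj_on f I" "independent (f ` I)"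
proof -
  have minimal: "card I \<le> card T" if "finite T" "e ` I \<subseteq> span T" for T
    using independent_span_bound[OF that(1) assms(3) that(2)] card_image[OF assms(2)] by simp
  have card: "card (f ` I) = card I"
    using minimal[OF _ assms(4)] assms(1) card_image_le[of I f] by simp
  then show "inj_on f I" using assms(1) eq_card_imp_inj_on by blast
  show "independent (f ` I)"
  proof
    assume "dependent (f ` I)"
    then obtain b where b: "b \<in> f ` I" "b \<in> span (f ` I - {b})" unfolding dependent_def by blast
    then have "span (f ` I) = span (f ` I - {b})" by (metis span_redundant insert_Diff)
    then have "card I \<le> card (f ` I - {b})" using assms(1,4) by (intro minimal) auto
    moreover have "card (f ` I - {b}) < card (f ` I)"
      using b assms(1) by (intro psubset_card_mono) auto
    ultimately show False using card by simp
  qed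
qed

lemma carrier_vec_induct [consumes 1, case_names zero add_unit]:
  fixes v :: "'k::field vec"
  assumes v: "v \<in> carrier_vec n"
    and zero: "P (0\<^sub>v n)"
    and add_unit: "\<And>v c j. v \<in> carrier_vec n \<Longrightarrow> j < n \<Longrightarrow> P v \<Longrightarrow> P (v + c \<cdot>\<^sub>v unit_vec n j)"
  shows "P v"
proof -
  have "P (vec n (\<lambda>i. if i < k then v $ i else 0))" if "k \<le> n" for k
    using that
  proof (induction k)
    case 0
    have "vec n (\<lambda>i. if i < 0 then v $ i else 0) = 0\<^sub>v n" by auto
    then show ?case using zero by simp
  next
    case (Suc k)
    have "vec n (\<lambda>i. if i < Suc k then v $ i else 0)
        = vec n (\<lambda>i. if i < k then v $ i else 0) + v $ k \<cdot>\<^sub>v unit_vec n k"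
      using Suc.prems by (intro eq_vecI) (auto simp: less_Suc_eq)
    then show ?case using Suc add_unit[of _ k] by simp
  qed
  moreover have "vec n (\<lambda>i. if i < n then v $ i else 0) = v" using v by (intro eq_vecI) auto
  ultimately show ?thesis by (metis order_refl)
qed

lemma eq_mat_mult_vecI:
  fixes A B :: "'k::field mat"
  assumes "A \<in> carrier_mat m n" "B \<in> carrier_mat m n" "\<And>v. v \<in> carrier_vec n \<Longrightarrow> A *\<^sub>v v = B *\<^sub>v v"
  shows "A = B"
proof (rule eq_matI)
  fix i j assume ij: "i < dim_row B" "j < dim_col B"
  have "(A *\<^sub>v unit_vec n j) $ i = (B *\<^sub>v unit_vec n j) $ i" using assms(3) by simp
  then show "A $$ (i, j) = B $$ (i, j)" using ij assms(1,2) by simp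
qed (use assms in auto)

lemma bij_betw_vec_of_function:
  assumes "distinct bs"
  shows "bij_betw (\<lambda>a. vec (length bs) (\<lambda>i. a (bs ! i)) :: 'k vec)
    (set bs \<rightarrow>\<^sub>E UNIV) (carrier_vec (length bs))"
    (is "bij_betw ?vec ?F _")
proof -
  let ?index = "the_inv_into {..<length bs} ((!) bs)"
  have index: "?index (bs ! i) = i" if "i < length bs" for i
    using assms that by (intro the_inv_into_f_f) (auto simp: inj_on_def nth_eq_iff_index_eq)
  show ?thesis
  proof (rule bij_betw_byWitness[where f' = "\<lambda>v. restrict (\<lambda>b. v $ ?index b) (set bs)"])
    show "\<forall>a\<in>?F. restrict (\<lambda>b. ?vec a $ ?index b) (set bs) = a"
    proof (intro ballI ext)
      fix a b assume a: "a \<in> ?F"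
      show "restrict (\<lambda>b. ?vec a $ ?index b) (set bs) b = a b"
      proof (cases "b \<in> set bs")
        case True
        then obtain i where "i < length bs" "b = bs ! i" by (auto simp: in_set_conv_nth)
        then show ?thesis by (simp add: index)
      qed (simp add: PiE_arb[OF a])
    qed
    show "\<forall>v\<in>carrier_vec (length bs). ?vec (restrict (\<lambda>b. v $ ?index b) (set bs)) = v"
      by (intro ballI eq_vecI) (simp_all add: index)
    show "?vec ` ?F \<subseteq> carrier_vec (length bs)" by (intro image_subsetI vec_carrier)
    show "(\<lambda>v. restrict (\<lambda>b. v $ ?index b) (set bs)) ` carrier_vec (length bs) \<subseteq> ?F"
      by (intro image_subsetI restrict_PiE_iff[THEN iffD2]) simp
  qed
qed

definition list_comb :: "('k::field, 'v, 'm) module_scheme \<Rightarrow> 'v list \<Rightarrow> 'k vec \<Rightarrow> 'v" where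
  "list_comb V bs v = (\<Oplus>\<^bsub>V\<^esub>i\<in>{..<length bs}. v $ i \<odot>\<^bsub>V\<^esub> bs ! i)"

locale class_vectorspace = vectorspace "class_ring :: 'k::field ring" V
  for V :: "('k::field, 'v, 'm) module_scheme" (structure)
begin

abbreviation endomorphisms :: "('v \<Rightarrow> 'v) set" where
  "endomorphisms \<equiv> LinearCombinations.module_hom class_ring V V"

lemma endomorphism_simps:
  assumes "T \<in> endomorphisms"
  shows "x \<in> carrier V \<Longrightarrow> y \<in> carrier V \<Longrightarrow> T (x \<oplus> y) = T x \<oplus> T y"
    and "x \<in> carrier V \<Longrightarrow> T (c \<odot> x) = c \<odot> T x"
    and "x \<in> carrier V \<Longrightarrow> T x \<in> carrier V"
  using assms by (auto simp: LinearCombinations.module_hom_def)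

lemma uminus_smult:
  assumes "x \<in> carrier V"
  shows "\<ominus> (c \<odot> x) = (- c) \<odot> x"
proof (rule minus_equality)
  show "(- c) \<odot> x \<oplus> c \<odot> x = \<zero>"
    using smult_l_distr[of "- c" c x] lmult_0[OF assms] assms by simp
qed (use assms in simp_all)

lemma endomorphism_in_span:
  assumes T: "T \<in> endomorphisms" and A: "A \<subseteq> carrier V" "\<And>a. a \<in> A \<Longrightarrow> T a \<in> span B"
    and B: "B \<subseteq> carrier V" and "x \<in> span A"
  shows "T x \<in> span B"
proof -
  interpret span_B: submodule class_ring "span B" V by (rule span_is_submodule[OF B])
  have "T \<zero> = \<zero>"
    using endomorphism_simps(2)[OF T, of \<zero> 0] endomorphism_simps(3)[OF T, of \<zero>] lmult_0 by simp
  then have "submodule class_ring {x \<in> carrier V. T x \<in> span B} V"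
    using endomorphism_simps[OF T] by unfold_locales auto
  then have "span A \<subseteq> {x \<in> carrier V. T x \<in> span B}"
    using A by (intro span_is_subset) auto
  then show ?thesis using assms(5) by blast
qed

lemma list_comb_closed: "set bs \<subseteq> carrier V \<Longrightarrow> list_comb V bs v \<in> carrier V"
  unfolding list_comb_def by (intro finsum_closed) (auto simp: subset_iff)

lemma list_comb_add:
  assumes "set bs \<subseteq> carrier V" "v \<in> carrier_vec (length bs)" "w \<in> carrier_vec (length bs)"
  shows "list_comb V bs (v + w) = list_comb V bs v \<oplus> list_comb V bs w"
proof -
  have bs: "bs ! i \<in> carrier V" if "i < length bs" for i using assms(1) that by auto
  have "list_comb V bs (v + w) = (\<Oplus>i\<in>{..<length bs}. v $ i \<odot> bs ! i \<oplus> w $ i \<odot> bs ! i)"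
    unfolding list_comb_def by (intro finsum_cong') (use assms bs smult_l_distr in auto)
  also have "\<dots> = list_comb V bs v \<oplus> list_comb V bs w"
    unfolding list_comb_def by (intro finsum_addf) (use bs in auto)
  finally show ?thesis .
qed

lemma list_comb_smult:
  assumes "set bs \<subseteq> carrier V" "v \<in> carrier_vec (length bs)"
  shows "list_comb V bs (c \<cdot>\<^sub>v v) = c \<odot> list_comb V bs v"
proof -
  have bs: "bs ! i \<in> carrier V" if "i < length bs" for i using assms(1) that by auto
  have "list_comb V bs (c \<cdot>\<^sub>v v) = (\<Oplus>i\<in>{..<length bs}. c \<odot> (v $ i \<odot> bs ! i))"
    unfolding list_comb_def by (intro finsum_cong') (use assms bs smult_assoc1 in auto)
  also have "\<dots> = c \<odot> list_comb V bs v"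
    unfolding list_comb_def by (intro finsum_smult[symmetric]) (use bs in auto)
  finally show ?thesis .
qed

lemma list_comb_unit_vec:
  assumes "set bs \<subseteq> carrier V" "j < length bs"
  shows "list_comb V bs (unit_vec (length bs) j) = bs ! j"
proof -
  have bs: "bs ! i \<in> carrier V" if "i < length bs" for i using assms(1) that by auto
  have "list_comb V bs (unit_vec (length bs) j) = (\<Oplus>i\<in>{..<length bs}. if j = i then bs ! i else \<zero>)"
    unfolding list_comb_def
    by (intro finsum_cong') (use assms bs smult_one lmult_0 in \<open>auto simp: unit_vec_def\<close>)
  also have "\<dots> = bs ! j" using assms bs by (intro finsum_singleton) auto
  finally show ?thesis .
qed

lemma list_comb_zero_vec:
  assumes "set bs \<subseteq> carrier V"
  shows "list_comb V bs (0\<^sub>v (length bs)) = \<zero>"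
proof -
  have "(0::'k) \<cdot>\<^sub>v 0\<^sub>v (length bs) = 0\<^sub>v (length bs)" by auto
  then show ?thesis
    using list_comb_smult[OF assms, of "0\<^sub>v (length bs)" 0] lmult_0[OF list_comb_closed[OF assms]] by simp
qed

lemma linear_eq_list_comb_mult_mat_vec:
  assumes bs: "set bs \<subseteq> carrier V" and M: "M \<in> carrier_mat (length bs) n"
    and F_add: "\<And>v w. v \<in> carrier_vec n \<Longrightarrow> w \<in> carrier_vec n \<Longrightarrow> F (v + w) = F v \<oplus> F w"
    and F_smult: "\<And>c v. v \<in> carrier_vec n \<Longrightarrow> F (c \<cdot>\<^sub>v v) = c \<odot> F v"
    and F_closed: "\<And>v. v \<in> carrier_vec n \<Longrightarrow> F v \<in> carrier V"
    and F_unit: "\<And>j. j < n \<Longrightarrow> F (unit_vec n j) = list_comb V bs (col M j)"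
    and v: "v \<in> carrier_vec n"
  shows "F v = list_comb V bs (M *\<^sub>v v)"
  using v
proof (induction rule: carrier_vec_induct)
  case zero
  have "(0::'k) \<cdot>\<^sub>v 0\<^sub>v n = 0\<^sub>v n" by auto
  then have "F (0\<^sub>v n) = \<zero>" using F_smult[of "0\<^sub>v n" 0] F_closed[of "0\<^sub>v n"] lmult_0 by simp
  moreover have "M *\<^sub>v 0\<^sub>v n = 0\<^sub>v (length bs)" using M by (intro eq_vecI) auto
  ultimately show ?case by (simp add: list_comb_zero_vec[OF bs])
next
  case (add_unit v c j)
  have "M *\<^sub>v unit_vec n j = col M j" using M add_unit(2) by (intro eq_vecI) auto
  then have "M *\<^sub>v (v + c \<cdot>\<^sub>v unit_vec n j) = M *\<^sub>v v + c \<cdot>\<^sub>v col M j"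
    using M add_unit(1) by (simp add: mult_add_distrib_mat_vec[OF M] mult_mat_vec[OF M])
  moreover have "col M j \<in> carrier_vec (length bs)" "M *\<^sub>v v \<in> carrier_vec (length bs)"
    using M by (auto intro!: carrier_vecI)
  ultimately show ?case using add_unit
    by (simp add: F_add F_smult F_unit list_comb_add[OF bs] list_comb_smult[OF bs])
qed

lemma lincomb_eq_list_comb:
  assumes "set bs \<subseteq> carrier V" "distinct bs"
  shows "lincomb a (set bs) = list_comb V bs (vec (length bs) (\<lambda>i. a (bs ! i)))"
proof -
  have "lincomb a (set bs) = (\<Oplus>x\<in>(!) bs ` {..<length bs}. a x \<odot> x)"
    by (simp add: lincomb_def set_conv_nth lessThan_def image_def setcompr_eq_image)
  also have "\<dots> = (\<Oplus>i\<in>{..<length bs}. a (bs ! i) \<odot> bs ! i)"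
    using assms by (intro finsum_reindex) (auto simp: subset_iff nth_eq_iff_index_eq inj_on_def)
  also have "\<dots> = list_comb V bs (vec (length bs) (\<lambda>i. a (bs ! i)))"
    unfolding list_comb_def using assms by (intro finsum_cong') (auto simp: subset_iff)
  finally show ?thesis .
qed

lemma bij_betw_lincomb_basis:
  assumes "finite A" "basis A"
  shows "bij_betw (\<lambda>a. lincomb a A) (A \<rightarrow>\<^sub>E UNIV) (carrier V)"
proof (rule bij_betwI')
  have A: "A \<subseteq> carrier V" using assms(2) by (simp add: basis_def)
  have unique: "\<exists>!a. a \<in> A \<rightarrow>\<^sub>E UNIV \<and> lincomb a A = x" if "x \<in> carrier V" for x
    using basis_criterion[OF assms(1) A] assms(2) that by simp
  show closed: "lincomb a A \<in> carrier V" for a using A by (intro lincomb_closed) auto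
  show "lincomb a A = lincomb a' A \<longleftrightarrow> a = a'" if "a \<in> A \<rightarrow>\<^sub>E UNIV" "a' \<in> A \<rightarrow>\<^sub>E UNIV" for a a'
    using unique[OF closed[of a']] that by blast
  show "\<exists>a\<in>A \<rightarrow>\<^sub>E UNIV. x = lincomb a A" if "x \<in> carrier V" for x
    using unique[OF that] by blast
qed

lemma bij_betw_list_comb:
  assumes "distinct bs" "basis (set bs)"
  shows "bij_betw (list_comb V bs) (carrier_vec (length bs)) (carrier V)"
proof -
  have bs: "set bs \<subseteq> carrier V" using assms by (simp add: basis_def)
  have "bij_betw (list_comb V bs \<circ> (\<lambda>a. vec (length bs) (\<lambda>i. a (bs ! i)))) (set bs \<rightarrow>\<^sub>E UNIV) (carrier V)"
    using bij_betw_lincomb_basis[OF _ assms(2)] by (simp add: lincomb_eq_list_comb[OF bs assms(1)] o_def)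
  then show ?thesis by (simp only: bij_betw_comp_iff[OF bij_betw_vec_of_function[OF assms(1)]])
qed

lemma operator_matrix_iff:
  "operator_matrix V T bs M \<longleftrightarrow> distinct bs \<and> basis (set bs) \<and> M \<in> carrier_mat (length bs) (length bs)
    \<and> (\<forall>j<length bs. T (bs ! j) = list_comb V bs (col M j))"
proof -
  have "(\<Oplus>i\<in>{..<length bs}. M $$ (i, j) \<odot> bs ! i) = list_comb V bs (col M j)"
    if "basis (set bs)" "M \<in> carrier_mat (length bs) (length bs)" "j < length bs" for j
  proof -
    have "bs ! i \<in> carrier V" if "i < length bs" for i
      using \<open>basis (set bs)\<close> that by (auto simp: basis_def)
    then show ?thesis unfolding list_comb_def using that by (intro finsum_cong') auto
  qed
  then show ?thesis unfolding operator_matrix_def by fastforce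
qed

lemma operator_matrix_mult_vec:
  assumes T: "T \<in> endomorphisms" and M: "operator_matrix V T bs M"
    and v: "v \<in> carrier_vec (length bs)"
  shows "T (list_comb V bs v) = list_comb V bs (M *\<^sub>v v)"
proof -
  have bs: "set bs \<subseteq> carrier V" and carrier_M: "M \<in> carrier_mat (length bs) (length bs)"
    and cols: "\<And>j. j < length bs \<Longrightarrow> T (bs ! j) = list_comb V bs (col M j)"
    using M by (auto simp: operator_matrix_iff basis_def)
  note T_simps = endomorphism_simps[OF T]
  show ?thesis
    by (rule linear_eq_list_comb_mult_mat_vec[OF bs carrier_M _ _ _ _ v])
      (simp_all add: T_simps list_comb_add[OF bs] list_comb_smult[OF bs] list_comb_unit_vec[OF bs]
        list_comb_closed[OF bs] cols)
qed

lemma basis_change_mat: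
  assumes "distinct bs" "basis (set bs)" "set bs' \<subseteq> carrier V"
  obtains P where "P \<in> carrier_mat (length bs) (length bs')"
    "\<And>v. v \<in> carrier_vec (length bs') \<Longrightarrow> list_comb V bs' v = list_comb V bs (P *\<^sub>v v)"
proof -
  have bs: "set bs \<subseteq> carrier V" using assms by (simp add: basis_def)
  have "\<exists>v\<in>carrier_vec (length bs). bs' ! j = list_comb V bs v" if "j < length bs'" for j
    using bij_betw_imp_surj_on[OF bij_betw_list_comb[OF assms(1,2)]] assms(3) nth_mem[OF that] by blast
  then obtain c where c:
      "\<And>j. j < length bs' \<Longrightarrow> c j \<in> carrier_vec (length bs) \<and> bs' ! j = list_comb V bs (c j)"
    by metis
  define P where "P = mat (length bs) (length bs') (\<lambda>(i, j). c j $ i)"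
  have P: "P \<in> carrier_mat (length bs) (length bs')" by (simp add: P_def)
  have "col P j = c j" if "j < length bs'" for j
    using c[OF that] that by (intro eq_vecI) (auto simp: P_def)
  then have "list_comb V bs' v = list_comb V bs (P *\<^sub>v v)" if "v \<in> carrier_vec (length bs')" for v
    using c by (intro linear_eq_list_comb_mult_mat_vec[OF bs P _ _ _ _ that])
      (simp_all add: assms(3) list_comb_add list_comb_smult list_comb_unit_vec list_comb_closed)
  then show ?thesis using that P by blast
qed

lemma basis_change_mats:
  assumes bs: "distinct bs" "basis (set bs)" and bs': "distinct bs'" "basis (set bs')"
  obtains P Q where "length bs' = length bs"
    "P \<in> carrier_mat (length bs) (length bs)" "Q \<in> carrier_mat (length bs) (length bs)"
    "P * Q = 1\<^sub>m (length bs)" "Q * P = 1\<^sub>m (length bs)"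
    "\<And>v. v \<in> carrier_vec (length bs) \<Longrightarrow> list_comb V bs' v = list_comb V bs (P *\<^sub>v v)"
proof -
  let ?n = "length bs"
  have carrier: "set bs \<subseteq> carrier V" "set bs' \<subseteq> carrier V" using bs bs' by (auto simp: basis_def)
  have len: "length bs' = ?n"
    using dim_basis[of "set bs"] dim_basis[of "set bs'"] bs bs' by (simp add: distinct_card)
  obtain P where P: "P \<in> carrier_mat ?n ?n"
    and P_vec: "\<And>v. v \<in> carrier_vec ?n \<Longrightarrow> list_comb V bs' v = list_comb V bs (P *\<^sub>v v)"
    using basis_change_mat[OF bs carrier(2)] len by auto
  obtain Q where Q: "Q \<in> carrier_mat ?n ?n"
    and Q_vec: "\<And>v. v \<in> carrier_vec ?n \<Longrightarrow> list_comb V bs v = list_comb V bs' (Q *\<^sub>v v)"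
    using basis_change_mat[OF bs' carrier(1)] len by auto
  have PQ: "P * Q = 1\<^sub>m ?n"
  proof (rule eq_mat_mult_vecI)
    fix v :: "'k vec" assume v: "v \<in> carrier_vec ?n"
    have "list_comb V bs (P *\<^sub>v (Q *\<^sub>v v)) = list_comb V bs v"
      using P_vec[of "Q *\<^sub>v v"] Q_vec[OF v] Q v by simp
    then have "P *\<^sub>v (Q *\<^sub>v v) = v"
      using P Q v by (intro bij_betw_imp_inj_on[OF bij_betw_list_comb[OF bs], THEN inj_onD]) auto
    then show "(P * Q) *\<^sub>v v = 1\<^sub>m ?n *\<^sub>v v" using P Q v by (simp add: assoc_mult_mat_vec)
  qed (use P Q in auto)
  show ?thesis by (rule that[OF len P Q PQ mat_mult_left_right_inverse[OF P Q PQ] P_vec])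
qed

lemma similar_mat_operator_matrices:
  assumes T: "T \<in> endomorphisms" and M: "operator_matrix V T bs M" and M': "operator_matrix V T bs' M'"
  shows "similar_mat M M'"
proof -
  let ?n = "length bs"
  have bs: "distinct bs" "basis (set bs)" "M \<in> carrier_mat ?n ?n"
    using M by (auto simp: operator_matrix_iff)
  have bs': "distinct bs'" "basis (set bs')" "M' \<in> carrier_mat (length bs') (length bs')"
    using M' by (auto simp: operator_matrix_iff)
  obtain P Q where len: "length bs' = ?n" and P: "P \<in> carrier_mat ?n ?n" and Q: "Q \<in> carrier_mat ?n ?n"
    and PQ: "P * Q = 1\<^sub>m ?n" "Q * P = 1\<^sub>m ?n"
    and P_vec: "\<And>v. v \<in> carrier_vec ?n \<Longrightarrow> list_comb V bs' v = list_comb V bs (P *\<^sub>v v)"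
    using basis_change_mats[OF bs(1,2) bs'(1,2)] by metis
  have MP: "M * P = P * M'"
  proof (rule eq_mat_mult_vecI)
    fix v :: "'k vec" assume v: "v \<in> carrier_vec ?n"
    have "list_comb V bs (M *\<^sub>v (P *\<^sub>v v)) = T (list_comb V bs (P *\<^sub>v v))"
      using operator_matrix_mult_vec[OF T M, of "P *\<^sub>v v"] P v by simp
    also have "\<dots> = T (list_comb V bs' v)" using P_vec[OF v] by simp
    also have "\<dots> = list_comb V bs' (M' *\<^sub>v v)" using operator_matrix_mult_vec[OF T M'] len v by simp
    also have "\<dots> = list_comb V bs (P *\<^sub>v (M' *\<^sub>v v))" using P_vec bs'(3) len v by simp
    finally have "M *\<^sub>v (P *\<^sub>v v) = P *\<^sub>v (M' *\<^sub>v v)"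
      using bs(3) bs'(3) P v len
      by (intro bij_betw_imp_inj_on[OF bij_betw_list_comb[OF bs(1,2)], THEN inj_onD]) auto
    then show "(M * P) *\<^sub>v v = (P * M') *\<^sub>v v"
      using bs(3) bs'(3) P v len by (simp add: assoc_mult_mat_vec)
  qed (use bs(3) bs'(3) P len in auto)
  have "M = M * (P * Q)" using PQ bs(3) by simp
  also have "\<dots> = P * M' * Q" using MP P Q bs(3) by (simp flip: assoc_mult_mat)
  finally show ?thesis
    using P Q PQ bs(3) bs'(3) len by (intro similar_matI[of _ _ P Q ?n]) auto
qed

lemma operator_char_poly_eq:
  assumes "T \<in> endomorphisms" "operator_matrix V T bs M"
  shows "operator_char_poly V T = char_poly M"
  unfolding operator_char_poly_def
  using assms char_poly_similar[OF similar_mat_operator_matrices[OF assms]]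
  by (intro the_equality) (blast, metis)

lemma operator_eigenvalue_root:
  assumes T: "T \<in> endomorphisms" and M: "operator_matrix V T bs M"
    and "operator_eigenvalue V T c"
  shows "poly (operator_char_poly V T) c = 0"
proof -
  have bs: "distinct bs" "basis (set bs)" "set bs \<subseteq> carrier V" "M \<in> carrier_mat (length bs) (length bs)"
    using M by (auto simp: operator_matrix_iff basis_def)
  note bij = bij_betw_list_comb[OF bs(1,2)]
  obtain x where x: "x \<in> carrier V" "x \<noteq> \<zero>" "T x = c \<odot> x"
    using assms(3) by (auto simp: operator_eigenvalue_def)
  then obtain v where v: "v \<in> carrier_vec (length bs)" "x = list_comb V bs v"
    using bij_betw_imp_surj_on[OF bij] by blast
  have "list_comb V bs (M *\<^sub>v v) = list_comb V bs (c \<cdot>\<^sub>v v)"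
    using operator_matrix_mult_vec[OF T M v(1)] x(3) v by (simp add: list_comb_smult[OF bs(3)])
  then have "M *\<^sub>v v = c \<cdot>\<^sub>v v"
    using bs v by (intro bij_betw_imp_inj_on[OF bij, THEN inj_onD]) auto
  moreover have "v \<noteq> 0\<^sub>v (length bs)" using v x list_comb_zero_vec[OF bs(3)] by auto
  ultimately have "eigenvalue M c" using v bs unfolding eigenvalue_def eigenvector_def by auto
  then show ?thesis
    using eigenvalue_root_char_poly[OF bs(4)] operator_char_poly_eq[OF T M] by simp
qed

lemma in_span_take_list_comb:
  assumes "distinct bs" "set bs \<subseteq> carrier V" "x \<in> span (set (take j bs))"
  obtains v where "v \<in> carrier_vec (length bs)" "x = list_comb V bs v"
    "\<And>i. j \<le> i \<Longrightarrow> i < length bs \<Longrightarrow> v $ i = 0"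
proof -
  have bs: "set bs = set (take j bs) \<union> set (drop j bs)" by (metis append_take_drop_id set_append)
  have disj: "set (take j bs) \<inter> set (drop j bs) = {}"
    using assms(1) by (rule set_take_disj_set_drop_if_distinct) simp
  obtain a where a: "lincomb a (set (take j bs)) = x"
    using finite_in_span[OF _ _ assms(3)] assms(2) bs by auto
  define a' where "a' b = (if b \<in> set (take j bs) then a b else 0)" for b
  have "lincomb a' (set bs) = lincomb a' (set (take j bs))"
    unfolding bs using assms(2) bs disj by (intro lincomb_clean) (auto simp: a'_def)
  also have "\<dots> = x" unfolding a[symmetric] using assms(2) bs by (intro lincomb_cong) (auto simp: a'_def)
  finally have "x = list_comb V bs (vec (length bs) (\<lambda>i. a' (bs ! i)))"
    using lincomb_eq_list_comb[OF assms(2,1)] by simp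
  moreover have "a' (bs ! i) = 0" if "j \<le> i" "i < length bs" for i
    using assms(1) that by (auto simp: a'_def in_set_conv_nth nth_eq_iff_index_eq)
  ultimately show ?thesis using that[of "vec (length bs) (\<lambda>i. a' (bs ! i))"] by simp
qed

lemma upper_triangular_operator_matrix:
  assumes T: "T \<in> endomorphisms" and bs: "distinct bs" "basis (set bs)"
    and tri: "\<And>j. j < length bs \<Longrightarrow> T (bs ! j) \<ominus> c j \<odot> bs ! j \<in> span (set (take j bs))"
  obtains M where "operator_matrix V T bs M" "upper_triangular M" "diag_mat M = map c [0..<length bs]"
proof -
  let ?n = "length bs"
  have bs_carrier: "set bs \<subseteq> carrier V" using bs by (simp add: basis_def)
  have "\<exists>v\<in>carrier_vec ?n. T (bs ! j) \<ominus> c j \<odot> bs ! j = list_comb V bs v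
      \<and> (\<forall>i. j \<le> i \<longrightarrow> i < ?n \<longrightarrow> v $ i = 0)"
    if "j < ?n" for j
    using in_span_take_list_comb[OF bs(1) bs_carrier tri[OF that]] by metis
  then obtain v where v: "\<And>j. j < ?n \<Longrightarrow> v j \<in> carrier_vec ?n"
    and T_v: "\<And>j. j < ?n \<Longrightarrow> T (bs ! j) \<ominus> c j \<odot> bs ! j = list_comb V bs (v j)"
    and v_0: "\<And>i j. j \<le> i \<Longrightarrow> i < ?n \<Longrightarrow> v j $ i = 0"
    by (metis order_le_less_trans)
  define M where "M = mat ?n ?n (\<lambda>(i, j). (c j \<cdot>\<^sub>v unit_vec ?n j + v j) $ i)"
  have "T (bs ! j) = list_comb V bs (col M j)" if j: "j < ?n" for j
  proof -
    have "bs ! j \<in> carrier V" using bs_carrier j by auto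
    then have closed: "bs ! j \<in> carrier V" "T (bs ! j) \<in> carrier V"
      using endomorphism_simps(3)[OF T] by auto
    have "col M j = c j \<cdot>\<^sub>v unit_vec ?n j + v j" using j v[OF j] by (intro eq_vecI) (auto simp: M_def)
    then have "list_comb V bs (col M j) = c j \<odot> bs ! j \<oplus> (T (bs ! j) \<ominus> c j \<odot> bs ! j)"
      using j v[OF j] T_v[OF j] by (simp add: list_comb_add[OF bs_carrier] list_comb_smult[OF bs_carrier]
          list_comb_unit_vec[OF bs_carrier])
    also have "\<dots> = T (bs ! j)"
      using closed smult_closed[of "c j" "bs ! j"] by (simp add: a_minus_def a_lcomm r_neg)
    finally show ?thesis by simp
  qed
  then have "operator_matrix V T bs M" using bs by (simp add: operator_matrix_iff M_def)
  moreover have entry: "M $$ (i, j) = (if i = j then c j else 0) + v j $ i" if "i < ?n" "j < ?n" for i j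
    using that carrier_vecD[OF v[OF that(2)]] by (auto simp: M_def)
  then have "upper_triangular M" using v_0 by (auto simp: M_def upper_triangular_def)
  moreover have "diag_mat M = map c [0..<?n]"
    unfolding diag_mat_def using entry v_0 by (intro nth_equalityI) (auto simp: M_def)
  ultimately show ?thesis using that by blast
qed

lemma in_set_take_if_greater:
  fixes r :: "'i \<Rightarrow> 'r::linorder"
  assumes "sorted_wrt (\<lambda>x y. r y \<le> r x) ws" "j < length ws" "w \<in> set ws" "r (ws ! j) < r w"
  shows "w \<in> set (take j ws)"
proof -
  obtain i where i: "i < length ws" "ws ! i = w" using assms(3) by (auto simp: in_set_conv_nth)
  then have "i < j"
    using assms sorted_wrt_nth_less[OF assms(1), of j i]
    by (metis linorder_cases not_less order_less_irrefl)
  then show ?thesis using i by (auto simp: in_set_conv_nth)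
qed

lemma triangular_operator_matrix:
  fixes r :: "'i \<Rightarrow> 'r::linorder"
  assumes T: "T \<in> endomorphisms" and I: "finite I" "inj_on b I" "basis (b ` I)"
    and tri: "\<And>w. w \<in> I \<Longrightarrow> T (b w) \<ominus> \<mu> w \<odot> b w \<in> span (b ` {w' \<in> I. r w < r w'})"
  obtains bs M ws where "operator_matrix V T bs M" "upper_triangular M" "diag_mat M = map \<mu> ws"
    "set ws = I" "distinct ws"
proof -
  obtain l where l: "set l = I" "distinct l" using finite_distinct_list[OF I(1)] by blast
  define ws where "ws = rev (sort_key r l)"
  have ws: "set ws = I" "distinct ws" using l by (auto simp: ws_def)
  have sorted: "sorted_wrt (\<lambda>x y. r y \<le> r x) ws"
    using sorted_sort_key[of r l] by (simp add: ws_def sorted_wrt_rev sorted_map)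
  have bs: "distinct (map b ws)" "basis (set (map b ws))" using ws I by (simp_all add: distinct_map)
  have "T (map b ws ! j) \<ominus> \<mu> (ws ! j) \<odot> map b ws ! j \<in> span (set (take j (map b ws)))"
    if "j < length (map b ws)" for j
  proof -
    have j: "j < length ws" "ws ! j \<in> I" using that ws nth_mem by auto
    have "w' \<in> set (take j ws)" if "w' \<in> I" "r (ws ! j) < r w'" for w'
      using that j(1) ws(1) by (intro in_set_take_if_greater[OF sorted]) auto
    then have "{w' \<in> I. r (ws ! j) < r w'} \<subseteq> set (take j ws)" by blast
    then have "span (b ` {w' \<in> I. r (ws ! j) < r w'}) \<subseteq> span (set (take j (map b ws)))"
      by (intro span_is_monotone) (auto simp: take_map)
    then show ?thesis using tri[OF j(2)] j(1) by auto
  qed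
  then obtain M where "operator_matrix V T (map b ws) M" "upper_triangular M"
    "diag_mat M = map (\<lambda>j. \<mu> (ws ! j)) [0..<length (map b ws)]"
    by (rule upper_triangular_operator_matrix[OF T bs])
  moreover have "map (\<lambda>j. \<mu> (ws ! j)) [0..<length (map b ws)] = map \<mu> ws"
    by (intro nth_equalityI) auto
  ultimately show ?thesis using that ws by metis
qed

lemma
  fixes r :: "'i \<Rightarrow> 'r::linorder"
  assumes "T \<in> endomorphisms" "finite I" "inj_on b I" "basis (b ` I)"
    and "\<And>w. w \<in> I \<Longrightarrow> T (b w) \<ominus> \<mu> w \<odot> b w \<in> span (b ` {w' \<in> I. r w < r w'})"
  shows triangular_operator_char_poly: "operator_char_poly V T = (\<Prod>w\<in>I. [:- \<mu> w, 1:])"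
    and triangular_operator_eigenvalue: "operator_eigenvalue V T c \<Longrightarrow> \<exists>w\<in>I. c = \<mu> w"
proof -
  obtain bs M ws where M: "operator_matrix V T bs M" "upper_triangular M" "diag_mat M = map \<mu> ws"
    and ws: "set ws = I" "distinct ws"
    using triangular_operator_matrix[OF assms] by metis
  have "M \<in> carrier_mat (length bs) (length bs)" using M(1) by (simp add: operator_matrix_iff)
  then have "char_poly M = (\<Prod>x\<leftarrow>map \<mu> ws. [:- x, 1:])"
    using char_poly_upper_triangular[OF _ M(2)] M(3) by simp
  also have "\<dots> = (\<Prod>w\<in>I. [:- \<mu> w, 1:])" 
    by (simp add: o_def prod.distinct_set_conv_list[OF ws(2), unfolded ws(1)])
  finally show char_poly: "operator_char_poly V T = (\<Prod>w\<in>I. [:- \<mu> w, 1:])"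
    using operator_char_poly_eq[OF assms(1) M(1)] by simp
  show "\<exists>w\<in>I. c = \<mu> w" if "operator_eigenvalue V T c"
    using operator_eigenvalue_root[OF assms(1) M(1) that] assms(2) by (auto simp: char_poly poly_prod)
qed

end

lemma order_prod_linear_factors:
  fixes \<mu> :: "'i \<Rightarrow> 'k::field"
  assumes "finite I"
  shows "Polynomial.order c (\<Prod>w\<in>I. [:- \<mu> w, 1:]) = card {w \<in> I. \<mu> w = c}"
  using assms
proof (induction I rule: finite_induct)
  case (insert w I)
  have nonzero: "(\<Prod>w\<in>I. [:- \<mu> w, 1:]) \<noteq> 0" using insert(1) by simp
  have "Polynomial.order c [:- \<mu> w, 1:] = (if \<mu> w = c then 1 else 0)"
    using order_power_n_n[of c 1] by (auto simp: order_0I)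
  moreover have "{v \<in> insert w I. \<mu> v = c}
      = (if \<mu> w = c then insert w {v \<in> I. \<mu> v = c} else {v \<in> I. \<mu> v = c})"
    by auto
  ultimately show ?case
    using insert nonzero by (simp add: order_mult del: mult_pCons_left mult_pCons_right)
qed (simp add: order_0I)

locale linear_map_to_type = class_vectorspace V + target: vector_space scale
  for V :: "('k::field, 'v, 'm) module_scheme" (structure)
    and scale :: "'k \<Rightarrow> 'b::ab_group_add \<Rightarrow> 'b" (infixr \<open>*s\<close> 75) +
  fixes \<phi> :: "'v \<Rightarrow> 'b"
  assumes map_add: "x \<in> carrier V \<Longrightarrow> y \<in> carrier V \<Longrightarrow> \<phi> (x \<oplus> y) = \<phi> x + \<phi> y"
    and map_smult: "x \<in> carrier V \<Longrightarrow> \<phi> (c \<odot> x) = c *s \<phi> x"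
begin

lemma map_zero: "\<phi> \<zero> = 0"
  using map_smult[of \<zero> 0] lmult_0[of \<zero>] by simp

lemma map_minus: "x \<in> carrier V \<Longrightarrow> y \<in> carrier V \<Longrightarrow> \<phi> (x \<ominus> y) = \<phi> x - \<phi> y"
  using map_add[of "x \<ominus> y" y] by (simp add: a_minus_def a_assoc l_neg eq_diff_eq)

lemma map_finsum:
  assumes "finite I" "\<And>i. i \<in> I \<Longrightarrow> f i \<in> carrier V"
  shows "\<phi> (\<Oplus>i\<in>I. f i) = (\<Sum>i\<in>I. \<phi> (f i))"
  using assms
proof (induction I rule: finite_induct)
  case (insert a I)
  then have "(\<Oplus>i\<in>I. f i) \<in> carrier V" "f \<in> I \<rightarrow> carrier V" "f a \<in> carrier V"
    by (auto intro!: finsum_closed)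
  then show ?case using insert by (simp add: finsum_insert map_add)
qed (simp add: map_zero)

lemma map_lincomb:
  assumes "finite A" "A \<subseteq> carrier V"
  shows "\<phi> (lincomb a A) = (\<Sum>x\<in>A. a x *s \<phi> x)"
proof -
  have A: "x \<in> carrier V" if "x \<in> A" for x using assms that by blast
  have "\<phi> (lincomb a A) = (\<Sum>x\<in>A. \<phi> (a x \<odot> x))"
    unfolding lincomb_def using A by (intro map_finsum[OF assms(1)]) simp
  also have "\<dots> = (\<Sum>x\<in>A. a x *s \<phi> x)" using A map_smult by (intro sum.cong) auto
  finally show ?thesis .
qed

lemma map_span:
  assumes "finite A" "A \<subseteq> carrier V"
  shows "\<phi> ` span A = target.span (\<phi> ` A)"
proof
  show "\<phi> ` span A \<subseteq> target.span (\<phi> ` A)"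
  proof (rule image_subsetI)
    fix x assume "x \<in> span A"
    then obtain a where "x = lincomb a A" using finite_in_span[OF assms] by metis
    then show "\<phi> x \<in> target.span (\<phi> ` A)"
      by (auto simp: map_lincomb[OF assms] intro!: target.span_sum target.span_scale
          intro: target.span_base)
  qed
  have "target.subspace (\<phi> ` span A)"
  proof (rule target.subspaceI)
    show "0 \<in> \<phi> ` span A" using map_zero span_zero by (metis imageI)
    show "f + g \<in> \<phi> ` span A" if fg: "f \<in> \<phi> ` span A" "g \<in> \<phi> ` span A" for f g
    proof -
      obtain x y where "x \<in> span A" "f = \<phi> x" "y \<in> span A" "g = \<phi> y" using fg by blast
      then have "f + g = \<phi> (x \<oplus> y)" "x \<oplus> y \<in> span A"
        using assms(2) span_add1[OF assms(2)] by (simp_all add: map_add)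
      then show ?thesis by blast
    qed
    show "c *s f \<in> \<phi> ` span A" if f: "f \<in> \<phi> ` span A" for c f
    proof -
      obtain x where "x \<in> span A" "f = \<phi> x" using f by blast
      then have "c *s f = \<phi> (c \<odot> x)" "c \<odot> x \<in> span A"
        using assms(2) submodule.smult_closed[OF span_is_submodule[OF assms(2)], of c x]
        by (simp_all add: map_smult)
      then show ?thesis by blast
    qed
  qed
  then show "target.span (\<phi> ` A) \<subseteq> \<phi> ` span A"
    using in_own_span[OF assms(2)] by (intro target.span_minimal image_mono)
qed

lemma coefficients_zero:
  assumes "finite A" "A \<subseteq> carrier V" "inj_on \<phi> A" "target.independent (\<phi> ` A)"
    and "\<phi> (lincomb a A) = 0" "x \<in> A"
  shows "a x = 0"
proof -
  have "(\<Sum>f\<in>\<phi> ` A. a (inv_into A \<phi> f) *s f) = \<phi> (lincomb a A)"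
    using assms(3) by (simp add: sum.reindex[OF assms(3)] map_lincomb[OF assms(1,2)])
  then have "a (inv_into A \<phi> (\<phi> x)) = 0"
    using assms by (intro target.independentD[of "\<phi> ` A" "\<phi> ` A" "\<lambda>f. a (inv_into A \<phi> f)"]) auto
  then show ?thesis using assms(3,6) by simp
qed

lemma inj_on_span:
  assumes A: "finite A" "A \<subseteq> carrier V" "inj_on \<phi> A" "target.independent (\<phi> ` A)"
  shows "inj_on \<phi> (span A)"
proof (rule inj_onI)
  fix x y assume xy: "x \<in> span A" "y \<in> span A" "\<phi> x = \<phi> y"
  obtain a b where ab: "x = lincomb a A" "y = lincomb b A"
    using xy finite_in_span[OF A(1,2)] by metis
  have "\<phi> (lincomb (\<lambda>v. a v - b v) A) = \<phi> x - \<phi> y"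
    by (simp add: ab map_lincomb[OF A(1,2)] target.scale_left_diff_distrib sum_subtractf)
  then have "a v = b v" if "v \<in> A" for v
    using coefficients_zero[OF A _ that, of "\<lambda>v. a v - b v"] xy(3) by simp
  then show "x = y" unfolding ab using A(2) by (intro lincomb_cong) auto
qed

lemma in_span_iff:
  assumes "inj_on \<phi> (carrier V)" "finite A" "A \<subseteq> carrier V" "x \<in> carrier V"
  shows "x \<in> span A \<longleftrightarrow> \<phi> x \<in> target.span (\<phi> ` A)"
  unfolding map_span[OF assms(2,3), symmetric]
  using inj_on_image_mem_iff[OF assms(1,4) span_is_subset2[OF assms(3)]] ..

lemma basisI:
  assumes inj: "inj_on \<phi> (carrier V)" and A: "finite A" "A \<subseteq> carrier V"
    and independent: "target.independent (\<phi> ` A)" and spanning: "\<phi> ` carrier V \<subseteq> target.span (\<phi> ` A)"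
  shows "basis A"
proof -
  have "lin_indpt A"
  proof (rule finite_lin_indpt2[OF A])
    fix a assume "lincomb a A = \<zero>"
    then have "a x = 0" if "x \<in> A" for x
      using coefficients_zero[OF A inj_on_subset[OF inj A(2)] independent _ that, of a] map_zero by simp
    then show "\<forall>x\<in>A. a x = \<zero>\<^bsub>class_ring\<^esub>" by simp
  qed
  moreover have "span A = carrier V"
    using in_span_iff[OF inj A] spanning span_is_subset2[OF A(2)] by blast
  ultimately show ?thesis using A(2) by (simp add: basis_def)
qed

end

section \<open>Groups given by generators and relations\<close>

lemma gwords_simps [simp]:
  "[] \<in> gwords X" "l # u \<in> gwords X \<longleftrightarrow> fst l \<in> X \<and> u \<in> gwords X"
  "u @ v \<in> gwords X \<longleftrightarrow> u \<in> gwords X \<and> v \<in> gwords X"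
  by (auto simp: gwords_def mem_Times_iff)

lemma pres_cong_gwords: "(u, v) \<in> pres_cong X R \<Longrightarrow> u \<in> gwords X \<and> v \<in> gwords X"
  by (induction rule: pres_cong.induct) auto

lemma equiv_pres_cong: "equiv (gwords X) (pres_cong X R)"
proof (rule equivI)
  show "pres_cong X R \<subseteq> gwords X \<times> gwords X" by (auto dest: pres_cong_gwords)
  show "refl_on (gwords X) (pres_cong X R)" by (auto intro: refl_onI pres_refl)
  show "sym (pres_cong X R)" by (auto intro: symI pres_sym)
  show "trans (pres_cong X R)" by (auto intro: transI pres_trans)
qed

lemma pres_cong_append:
  assumes "(u, u') \<in> pres_cong X R" "(v, v') \<in> pres_cong X R"
  shows "(u @ v, u' @ v') \<in> pres_cong X R"
proof -
  have "([] @ u @ v, [] @ u' @ v) \<in> pres_cong X R"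
    using pres_cong_gwords[OF assms(2)] by (intro pres_context assms(1)) auto
  moreover have "(u' @ v @ [], u' @ v' @ []) \<in> pres_cong X R"
    using pres_cong_gwords[OF assms(1)] by (intro pres_context assms(2)) auto
  ultimately show ?thesis using pres_trans by fastforce
qed

abbreviation pres_class :: "'g set \<Rightarrow> ('g gword \<times> 'g gword) set \<Rightarrow> 'g gword \<Rightarrow> 'g gword set" where
  "pres_class X R u \<equiv> pres_cong X R `` {u}"

lemma pres_class_self: "u \<in> gwords X \<Longrightarrow> u \<in> pres_class X R u"
  by (simp add: pres_refl)

lemma pres_class_eqI: "(u, v) \<in> pres_cong X R \<Longrightarrow> pres_class X R u = pres_class X R v"
  by (rule equiv_class_eq[OF equiv_pres_cong])

lemma presented_group_carrier: "carrier (presented_group X R) = pres_class X R ` gwords X"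
  by (auto simp: presented_group_def quotient_def)

lemma presented_group_one: "\<one>\<^bsub>presented_group X R\<^esub> = pres_class X R []"
  by (simp add: presented_group_def)

lemma presented_group_mult:
  assumes "u \<in> gwords X" "v \<in> gwords X"
  shows "pres_class X R u \<otimes>\<^bsub>presented_group X R\<^esub> pres_class X R v = pres_class X R (u @ v)"
proof -
  have "pres_class X R (u' @ v') = pres_class X R (u @ v)"
    if "u' \<in> pres_class X R u" "v' \<in> pres_class X R v" for u' v'
    using that by (intro pres_class_eqI pres_cong_append) (auto intro: pres_sym)
  moreover have "u \<in> pres_class X R u" "v \<in> pres_class X R v" using assms by (auto intro: pres_refl)
  ultimately have "(\<Union>u'\<in>pres_class X R u. \<Union>v'\<in>pres_class X R v. pres_class X R (u' @ v'))
     = pres_class X R (u @ v)" by blast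
  then show ?thesis by (simp add: presented_group_def)
qed

lemma monoid_presented_group: "monoid (presented_group X R)"
  by (rule monoidI) (auto simp: presented_group_carrier presented_group_one presented_group_mult)

locale presented_group_action =
  fixes X :: "'g set" and R :: "('g gword \<times> 'g gword) set" and letter_act :: "'g \<times> bool \<Rightarrow> 'b \<Rightarrow> 'b"
  assumes letter_act_cancel: "x \<in> X \<Longrightarrow> letter_act (x, s) (letter_act (x, \<not> s) v) = v"
    and letter_act_relation: "(r, r') \<in> R \<Longrightarrow> r \<in> gwords X \<Longrightarrow> r' \<in> gwords X \<Longrightarrow>
      foldr letter_act r v = foldr letter_act r' v"
begin

lemma foldr_letter_act_cong:
  "(u, u') \<in> pres_cong X R \<Longrightarrow> foldr letter_act u v = foldr letter_act u' v"
  by (induction arbitrary: v rule: pres_cong.induct)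
    (simp_all add: letter_act_cancel letter_act_relation)

definition group_act :: "'g gword set \<Rightarrow> 'b \<Rightarrow> 'b" where
  "group_act g = foldr letter_act (SOME u. u \<in> g)"

lemma group_act_pres_class:
  assumes "u \<in> gwords X"
  shows "group_act (pres_class X R u) v = foldr letter_act u v"
proof -
  have "(SOME u'. u' \<in> pres_class X R u) \<in> pres_class X R u"
    using pres_class_self[OF assms] by (rule someI)
  then show ?thesis using foldr_letter_act_cong by (auto simp: group_act_def)
qed

lemma group_act_mult:
  assumes "g \<in> carrier (presented_group X R)" "h \<in> carrier (presented_group X R)"
  shows "group_act (g \<otimes>\<^bsub>presented_group X R\<^esub> h) v = group_act g (group_act h v)"
  using assms by (auto simp: presented_group_carrier presented_group_mult group_act_pres_class)

end

section \<open>Group algebras and their quotients\<close>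

lemma group_algebra_carrier:
  "f \<in> carrier (group_algebra G) \<longleftrightarrow> finite {g. f g \<noteq> 0} \<and> {g. f g \<noteq> 0} \<subseteq> carrier G"
  by (simp add: group_algebra_def)

lemma group_algebra_simps:
  "\<zero>\<^bsub>group_algebra G\<^esub> = (\<lambda>g. 0)" "f \<oplus>\<^bsub>group_algebra G\<^esub> f' = (\<lambda>g. f g + f' g)"
  "c \<odot>\<^bsub>group_algebra G\<^esub> f = (\<lambda>g. c * f g)" "\<one>\<^bsub>group_algebra G\<^esub> = group_algebra_elem \<one>\<^bsub>G\<^esub>"
  by (simp_all add: group_algebra_def group_algebra_elem_def fun_eq_iff)

lemma group_algebra_elem_closed: "g \<in> carrier G \<Longrightarrow> group_algebra_elem g \<in> carrier (group_algebra G)"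
  by (auto simp: group_algebra_carrier group_algebra_elem_def)

lemma group_algebra_zero_closed: "\<zero>\<^bsub>group_algebra G\<^esub> \<in> carrier (group_algebra G)"
  by (simp add: group_algebra_carrier group_algebra_simps)

lemma group_algebra_add_closed:
  assumes "f \<in> carrier (group_algebra G)" "f' \<in> carrier (group_algebra G)"
  shows "f \<oplus>\<^bsub>group_algebra G\<^esub> f' \<in> carrier (group_algebra G)"
proof -
  have "{g. f g + f' g \<noteq> 0} \<subseteq> {g. f g \<noteq> 0} \<union> {g. f' g \<noteq> 0}" by auto
  then show ?thesis using assms unfolding group_algebra_carrier group_algebra_simps
    by (meson finite_UnI finite_subset le_sup_iff subset_trans)
qed

lemma group_algebra_smult_closed:
  "f \<in> carrier (group_algebra G) \<Longrightarrow> c \<odot>\<^bsub>group_algebra G\<^esub> f \<in> carrier (group_algebra G)"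
  unfolding group_algebra_carrier group_algebra_simps by (auto intro: finite_subset[of _ "{g. f g \<noteq> 0}"])

lemma group_algebra_mult_apply:
  assumes "finite {h. f h \<noteq> 0}" "finite {h. f' h \<noteq> 0}"
  shows "(f \<otimes>\<^bsub>group_algebra G\<^esub> f') g
    = (\<Sum>h | f h \<noteq> 0. \<Sum>h' | f' h' \<noteq> 0. if h \<otimes>\<^bsub>G\<^esub> h' = g then f h * f' h' else 0)"
proof -
  let ?S = "{h. f h \<noteq> 0}" and ?S' = "{h. f' h \<noteq> 0}"
  have "(f \<otimes>\<^bsub>group_algebra G\<^esub> f') g = (\<Sum>x\<in>{x \<in> ?S \<times> ?S'. fst x \<otimes>\<^bsub>G\<^esub> snd x = g}. f (fst x) * f' (snd x))"
    unfolding group_algebra_def by (auto intro!: sum.cong)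
  also have "\<dots> = (\<Sum>x\<in>?S \<times> ?S'. if fst x \<otimes>\<^bsub>G\<^esub> snd x = g then f (fst x) * f' (snd x) else 0)"
    by (rule sum.inter_filter) (use assms in simp)
  finally show ?thesis unfolding sum.cartesian_product by (simp add: case_prod_beta)
qed

lemma group_algebra_mult_support:
  assumes "finite {h. f h \<noteq> 0}" "finite {h. f' h \<noteq> 0}"
  shows "{g. (f \<otimes>\<^bsub>group_algebra G\<^esub> f') g \<noteq> 0} \<subseteq> (\<lambda>(h, h'). h \<otimes>\<^bsub>G\<^esub> h') ` ({h. f h \<noteq> 0} \<times> {h. f' h \<noteq> 0})"
proof (rule subsetI, rule ccontr)
  fix g assume nonzero: "g \<in> {g. (f \<otimes>\<^bsub>group_algebra G\<^esub> f') g \<noteq> 0}"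
    and "g \<notin> (\<lambda>(h, h'). h \<otimes>\<^bsub>G\<^esub> h') ` ({h. f h \<noteq> 0} \<times> {h. f' h \<noteq> 0})"
  then have "h \<otimes>\<^bsub>G\<^esub> h' \<noteq> g" if "f h \<noteq> 0" "f' h' \<noteq> 0" for h h' using that by force
  then have "(f \<otimes>\<^bsub>group_algebra G\<^esub> f') g = 0"
    unfolding group_algebra_mult_apply[OF assms] by (intro sum.neutral ballI) simp
  then show False using nonzero by simp
qed

lemma (in monoid) group_algebra_mult_closed:
  assumes "f \<in> carrier (group_algebra G)" "f' \<in> carrier (group_algebra G)"
  shows "f \<otimes>\<^bsub>group_algebra G\<^esub> f' \<in> carrier (group_algebra G)"
proof -
  have finite: "finite {h. f h \<noteq> 0}" "finite {h. f' h \<noteq> 0}"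
    using assms by (auto simp: group_algebra_carrier)
  let ?T = "(\<lambda>(h, h'). h \<otimes> h') ` ({h. f h \<noteq> 0} \<times> {h. f' h \<noteq> 0})"
  have "finite ?T" "?T \<subseteq> carrier G" using finite assms by (auto simp: group_algebra_carrier subset_iff)
  then show ?thesis using group_algebra_mult_support[OF finite, of G]
    unfolding group_algebra_carrier by (meson finite_subset subset_trans)
qed

locale linear_extensions = vector_space scale
  for scale :: "'k::field \<Rightarrow> 'b::ab_group_add \<Rightarrow> 'b" (infixr \<open>*s\<close> 75)
begin

definition linear_extension :: "('g \<Rightarrow> 'b) \<Rightarrow> ('g \<Rightarrow> 'k) \<Rightarrow> 'b" where
  "linear_extension t f = (\<Sum>g | f g \<noteq> 0. f g *s t g)"

lemma linear_extension_superset: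
  assumes "finite S" "{g. f g \<noteq> 0} \<subseteq> S"
  shows "linear_extension t f = (\<Sum>g\<in>S. f g *s t g)"
  unfolding linear_extension_def using assms by (intro sum.mono_neutral_left) auto

lemma linear_extension_cong:
  assumes "f \<in> carrier (group_algebra G)" "\<And>g. g \<in> carrier G \<Longrightarrow> t g = t' g"
  shows "linear_extension t f = linear_extension t' f"
  unfolding linear_extension_def using assms by (intro sum.cong) (auto simp: group_algebra_carrier)

lemma linear_extension_elem: "linear_extension t (group_algebra_elem g) = t g"
  by (subst linear_extension_superset[of "{g}"]) (auto simp: group_algebra_elem_def)

lemma linear_extension_zero: "linear_extension t \<zero>\<^bsub>group_algebra G\<^esub> = 0"
  by (simp add: linear_extension_def group_algebra_simps)

lemma linear_extension_add:
  assumes "f \<in> carrier (group_algebra G)" "f' \<in> carrier (group_algebra G)"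
  shows "linear_extension t (f \<oplus>\<^bsub>group_algebra G\<^esub> f') = linear_extension t f + linear_extension t f'"
proof -
  let ?S = "{g. f g \<noteq> 0} \<union> {g. f' g \<noteq> 0}"
  have "linear_extension t (\<lambda>g. f g + f' g) = (\<Sum>g\<in>?S. (f g + f' g) *s t g)"
    "linear_extension t f = (\<Sum>g\<in>?S. f g *s t g)" "linear_extension t f' = (\<Sum>g\<in>?S. f' g *s t g)"
    using assms by (intro linear_extension_superset; auto simp: group_algebra_carrier)+
  then show ?thesis by (simp add: group_algebra_simps sum.distrib scale_left_distrib)
qed

lemma linear_extension_smult:
  "linear_extension t (c \<odot>\<^bsub>group_algebra G\<^esub> f) = c *s linear_extension t f"
  by (cases "c = 0") (auto simp: linear_extension_def group_algebra_simps scale_sum_right)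

lemma linear_extension_mult:
  assumes "f \<in> carrier (group_algebra G)" "f' \<in> carrier (group_algebra G)"
  shows "linear_extension t (f \<otimes>\<^bsub>group_algebra G\<^esub> f')
    = linear_extension (\<lambda>h. linear_extension (\<lambda>h'. t (h \<otimes>\<^bsub>G\<^esub> h')) f') f"
proof -
  have finite: "finite {h. f h \<noteq> 0}" "finite {h. f' h \<noteq> 0}"
    using assms by (auto simp: group_algebra_carrier)
  let ?S = "{h. f h \<noteq> 0}" and ?S' = "{h. f' h \<noteq> 0}"
  let ?T = "(\<lambda>(h, h'). h \<otimes>\<^bsub>G\<^esub> h') ` (?S \<times> ?S')"
  let ?term = "\<lambda>h h' g. if h \<otimes>\<^bsub>G\<^esub> h' = g then (f h * f' h') *s t g else 0"
  have "linear_extension t (f \<otimes>\<^bsub>group_algebra G\<^esub> f') = (\<Sum>g\<in>?T. (f \<otimes>\<^bsub>group_algebra G\<^esub> f') g *s t g)"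
    using finite by (intro linear_extension_superset group_algebra_mult_support) auto
  also have "\<dots> = (\<Sum>g\<in>?T. \<Sum>h\<in>?S. \<Sum>h'\<in>?S'. ?term h h' g)"
    unfolding group_algebra_mult_apply[OF finite] scale_sum_left by (intro sum.cong) auto
  also have "\<dots> = (\<Sum>h\<in>?S. \<Sum>h'\<in>?S'. \<Sum>g\<in>?T. ?term h h' g)"
    by (subst sum.swap, rule sum.cong[OF refl], rule sum.swap)
  also have "\<dots> = (\<Sum>h\<in>?S. \<Sum>h'\<in>?S'. (f h * f' h') *s t (h \<otimes>\<^bsub>G\<^esub> h'))"
  proof (intro sum.cong[OF refl])
    fix h h' assume "h \<in> ?S" "h' \<in> ?S'"
    then have "h \<otimes>\<^bsub>G\<^esub> h' \<in> ?T" by force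
    then show "(\<Sum>g\<in>?T. ?term h h' g) = (f h * f' h') *s t (h \<otimes>\<^bsub>G\<^esub> h')" using finite by simp
  qed
  finally show ?thesis by (simp add: linear_extension_def scale_sum_right)
qed

lemma linear_extension_add_function:
  "linear_extension (\<lambda>g. t g + t' g) f = linear_extension t f + linear_extension t' f"
  by (simp add: linear_extension_def scale_right_distrib sum.distrib)

lemma linear_linear_extension:
  assumes "Vector_Spaces.linear scale scale T"
  shows "T (linear_extension t f) = linear_extension (\<lambda>g. T (t g)) f"
proof -
  interpret T: Vector_Spaces.linear scale scale T by fact
  show ?thesis by (simp add: linear_extension_def T.sum T.scale)
qed

end

interpretation field_space: linear_extensions "(*) :: 'k::field \<Rightarrow> 'k \<Rightarrow> 'k"
  by unfold_locales (simp_all add: algebra_simps)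

declare field_space.scale_scale [simp del]

lemma linear_extension_scale_function:
  "field_space.linear_extension (\<lambda>g. c * t g) f = c * field_space.linear_extension t f"
  by (simp add: field_space.linear_extension_def sum_distrib_left mult_ac)

lemma group_algebra_eqI:
  assumes "\<And>t. field_space.linear_extension t f = field_space.linear_extension t f'"
    and "f \<in> carrier (group_algebra G)" "f' \<in> carrier (group_algebra G)"
  shows "f = f'"
proof
  fix g
  have coefficient: "field_space.linear_extension (\<lambda>h. if h = g then 1 else 0) h = h g"
    if "h \<in> carrier (group_algebra G)" for h
    using that by (auto simp: field_space.linear_extension_def group_algebra_carrier
        if_distrib[of "\<lambda>x. _ * x"] cong: if_cong)
  show "f g = f' g" using assms coefficient by metis
qed

context monoid
begin

lemma group_algebra_one_closed: "\<one>\<^bsub>group_algebra G\<^esub> \<in> carrier (group_algebra G)"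
  by (simp add: group_algebra_simps group_algebra_elem_closed)

lemmas group_algebra_closed = group_algebra_zero_closed group_algebra_one_closed group_algebra_add_closed
  group_algebra_smult_closed group_algebra_mult_closed group_algebra_elem_closed

lemmas linear_extension_simps = field_space.linear_extension_add field_space.linear_extension_smult
  field_space.linear_extension_mult field_space.linear_extension_elem
  field_space.linear_extension_add_function linear_extension_scale_function

lemma group_algebra_elem_mult:
  assumes "g \<in> carrier G" "h \<in> carrier G"
  shows "group_algebra_elem g \<otimes>\<^bsub>group_algebra G\<^esub> group_algebra_elem h = group_algebra_elem (g \<otimes> h)"
  using assms by (intro group_algebra_eqI[where G = G])
    (simp_all add: linear_extension_simps group_algebra_closed)

lemma group_algebra_mult_assoc:
  assumes "x \<in> carrier (group_algebra G)" "y \<in> carrier (group_algebra G)" "z \<in> carrier (group_algebra G)"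
  shows "x \<otimes>\<^bsub>group_algebra G\<^esub> y \<otimes>\<^bsub>group_algebra G\<^esub> z
    = x \<otimes>\<^bsub>group_algebra G\<^esub> (y \<otimes>\<^bsub>group_algebra G\<^esub> z)"
proof (rule group_algebra_eqI[where G = G])
  show "field_space.linear_extension t (x \<otimes>\<^bsub>group_algebra G\<^esub> y \<otimes>\<^bsub>group_algebra G\<^esub> z)
    = field_space.linear_extension t (x \<otimes>\<^bsub>group_algebra G\<^esub> (y \<otimes>\<^bsub>group_algebra G\<^esub> z))" for t
    using assms by (simp add: linear_extension_simps group_algebra_closed m_assoc
        cong: field_space.linear_extension_cong)
qed (simp_all add: assms group_algebra_closed)

lemma
  assumes "x \<in> carrier (group_algebra G)"
  shows group_algebra_one_mult: "\<one>\<^bsub>group_algebra G\<^esub> \<otimes>\<^bsub>group_algebra G\<^esub> x = x"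
    and group_algebra_mult_one: "x \<otimes>\<^bsub>group_algebra G\<^esub> \<one>\<^bsub>group_algebra G\<^esub> = x"
  using assms by (auto intro!: group_algebra_eqI[where G = G] field_space.linear_extension_cong
      simp: group_algebra_simps(4) linear_extension_simps group_algebra_closed)

lemma
  assumes "x \<in> carrier (group_algebra G)" "y \<in> carrier (group_algebra G)" "z \<in> carrier (group_algebra G)"
  shows group_algebra_distrib_right: "(x \<oplus>\<^bsub>group_algebra G\<^esub> y) \<otimes>\<^bsub>group_algebra G\<^esub> z
      = x \<otimes>\<^bsub>group_algebra G\<^esub> z \<oplus>\<^bsub>group_algebra G\<^esub> y \<otimes>\<^bsub>group_algebra G\<^esub> z"
    and group_algebra_distrib_left: "z \<otimes>\<^bsub>group_algebra G\<^esub> (x \<oplus>\<^bsub>group_algebra G\<^esub> y)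
      = z \<otimes>\<^bsub>group_algebra G\<^esub> x \<oplus>\<^bsub>group_algebra G\<^esub> z \<otimes>\<^bsub>group_algebra G\<^esub> y"
  using assms
  by (auto intro!: group_algebra_eqI[where G = G] simp: linear_extension_simps group_algebra_closed)

lemma
  assumes "x \<in> carrier (group_algebra G)" "y \<in> carrier (group_algebra G)"
  shows group_algebra_smult_mult: "(c \<odot>\<^bsub>group_algebra G\<^esub> x) \<otimes>\<^bsub>group_algebra G\<^esub> y
      = c \<odot>\<^bsub>group_algebra G\<^esub> (x \<otimes>\<^bsub>group_algebra G\<^esub> y)"
    and group_algebra_mult_smult: "x \<otimes>\<^bsub>group_algebra G\<^esub> (c \<odot>\<^bsub>group_algebra G\<^esub> y)
      = c \<odot>\<^bsub>group_algebra G\<^esub> (x \<otimes>\<^bsub>group_algebra G\<^esub> y)"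
  using assms
  by (auto intro!: group_algebra_eqI[where G = G] simp: linear_extension_simps group_algebra_closed)

lemma abelian_group_group_algebra: "abelian_group (group_algebra G :: ('k::field, _) module)"
proof (rule abelian_groupI)
  let ?A = "group_algebra G :: ('k, _) module"
  fix x assume "x \<in> carrier ?A"
  then show "\<exists>y\<in>carrier ?A. y \<oplus>\<^bsub>?A\<^esub> x = \<zero>\<^bsub>?A\<^esub>"
    by (intro bexI[of _ "(- 1) \<odot>\<^bsub>?A\<^esub> x"] group_algebra_closed) (simp_all add: group_algebra_simps)
qed (auto simp: group_algebra_closed, auto simp: group_algebra_simps add_ac)

lemma ring_group_algebra: "ring (group_algebra G :: ('k::field, _) module)"
proof (rule ringI)
  show "monoid (group_algebra G :: ('k, _) module)"
    by (rule monoidI) (simp_all add: group_algebra_closed group_algebra_mult_assoc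
        group_algebra_one_mult group_algebra_mult_one)
qed (simp_all add: abelian_group_group_algebra group_algebra_distrib_right group_algebra_distrib_left)

lemma module_group_algebra: "Module.module class_ring (group_algebra G :: ('k::field, _) module)"
proof (rule moduleI)
  show "cring (class_ring :: 'k ring)" by (rule fieldE(1)[OF class_field])
qed (auto simp: abelian_group_group_algebra group_algebra_closed,
    auto simp: group_algebra_simps fun_eq_iff algebra_simps)

lemma group_algebra_induct [consumes 1, case_names add elem]:
  fixes f :: "'a \<Rightarrow> 'k::field"
  assumes f: "f \<in> carrier (group_algebra G)"
    and add: "\<And>f f'. f \<in> carrier (group_algebra G) \<Longrightarrow> f' \<in> carrier (group_algebra G) \<Longrightarrow> P f \<Longrightarrow> P f'
       \<Longrightarrow> P (f \<oplus>\<^bsub>group_algebra G\<^esub> f')"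
    and elem: "\<And>c g. g \<in> carrier G \<Longrightarrow> P (c \<odot>\<^bsub>group_algebra G\<^esub> group_algebra_elem g)"
  shows "P f"
proof -
  let ?A = "group_algebra G :: ('k, _) module"
  let ?part = "\<lambda>S g. if g \<in> S then f g else 0"
  have "P (?part S)" if "finite S" "S \<subseteq> {g. f g \<noteq> 0}" for S
    using that
  proof (induction S rule: finite_induct)
    case empty
    show ?case using elem[of \<one> 0] by (simp add: group_algebra_simps)
  next
    case (insert a S)
    have a: "a \<in> carrier G" and part: "?part S \<in> carrier ?A"
      using insert f by (auto simp: group_algebra_carrier)
    have "P ((f a \<odot>\<^bsub>?A\<^esub> group_algebra_elem a) \<oplus>\<^bsub>?A\<^esub> ?part S)"
      using insert elem[OF a] part a by (intro add group_algebra_closed) auto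
    moreover have "(f a \<odot>\<^bsub>?A\<^esub> group_algebra_elem a) \<oplus>\<^bsub>?A\<^esub> ?part S = ?part (insert a S)"
      using insert by (auto simp: group_algebra_simps group_algebra_elem_def fun_eq_iff)
    ultimately show ?case by simp
  qed
  moreover have "?part {g. f g \<noteq> 0} = f" by auto
  ultimately show ?thesis using f by (metis group_algebra_carrier order_refl)
qed

end

locale quotient_algebra =
  fixes A :: "('k::field, 'v, 'm) module_scheme" and I :: "'v set"
  assumes ring_A: "ring A" and module_A: "Module.module class_ring A" and ideal_I: "ideal I A"
    and smult_mult: "x \<in> carrier A \<Longrightarrow> y \<in> carrier A \<Longrightarrow> (c \<odot>\<^bsub>A\<^esub> x) \<otimes>\<^bsub>A\<^esub> y = c \<odot>\<^bsub>A\<^esub> (x \<otimes>\<^bsub>A\<^esub> y)"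
    and mult_smult: "x \<in> carrier A \<Longrightarrow> y \<in> carrier A \<Longrightarrow> x \<otimes>\<^bsub>A\<^esub> (c \<odot>\<^bsub>A\<^esub> y) = c \<odot>\<^bsub>A\<^esub> (x \<otimes>\<^bsub>A\<^esub> y)"
begin

abbreviation "Q \<equiv> quot_algebra A I"
abbreviation "proj x \<equiv> I +>\<^bsub>A\<^esub> x"

interpretation A: ring A by (rule ring_A)
interpretation M: Module.module class_ring A by (rule module_A)
interpretation I: ideal I A by (rule ideal_I)

lemma A_smult_closed: "x \<in> carrier A \<Longrightarrow> c \<odot>\<^bsub>A\<^esub> x \<in> carrier A"
  using M.smult_closed[of c x] by simp

lemma carrier_Q: "carrier Q = proj ` carrier A"
  by (auto simp: quot_algebra_def FactRing_def A_RCOSETS_def')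

lemma proj_closed: "x \<in> carrier A \<Longrightarrow> proj x \<in> carrier Q"
  by (simp add: carrier_Q)

lemma proj_add: "x \<in> carrier A \<Longrightarrow> y \<in> carrier A \<Longrightarrow> proj x \<oplus>\<^bsub>Q\<^esub> proj y = proj (x \<oplus>\<^bsub>A\<^esub> y)"
  by (simp add: quot_algebra_def FactRing_def I.a_rcos_sum)

lemma proj_mult: "x \<in> carrier A \<Longrightarrow> y \<in> carrier A \<Longrightarrow> proj x \<otimes>\<^bsub>Q\<^esub> proj y = proj (x \<otimes>\<^bsub>A\<^esub> y)"
  by (simp add: quot_algebra_def FactRing_def I.rcoset_mult_add)

lemma proj_ideal: "x \<in> I \<Longrightarrow> proj x = \<zero>\<^bsub>Q\<^esub>"
  using A.a_rcos_zero[OF ideal_I] by (simp add: quot_algebra_def FactRing_def)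

lemma proj_zero: "\<zero>\<^bsub>Q\<^esub> = proj \<zero>\<^bsub>A\<^esub>"
  using proj_ideal[of "\<zero>\<^bsub>A\<^esub>"] by simp

lemma proj_one: "\<one>\<^bsub>Q\<^esub> = proj \<one>\<^bsub>A\<^esub>"
  by (simp add: quot_algebra_def FactRing_def)

lemma proj_self: "x \<in> carrier A \<Longrightarrow> x \<in> proj x"
  unfolding a_r_coset_def' using I.zero_closed A.l_zero by force

lemma mem_projE:
  assumes "y \<in> proj x"
  obtains i where "i \<in> I" "y = i \<oplus>\<^bsub>A\<^esub> x"
  using assms unfolding a_r_coset_def' by auto

lemma proj_smult:
  assumes x: "x \<in> carrier A"
  shows "c \<odot>\<^bsub>Q\<^esub> proj x = proj (c \<odot>\<^bsub>A\<^esub> x)"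
proof -
  have "proj (c \<odot>\<^bsub>A\<^esub> y) = proj (c \<odot>\<^bsub>A\<^esub> x)" if y: "y \<in> proj x" for y
  proof -
    obtain i where i: "i \<in> I" "y = i \<oplus>\<^bsub>A\<^esub> x" using mem_projE[OF y] .
    have "c \<odot>\<^bsub>A\<^esub> i \<in> I"
      using I.I_l_closed[of i "c \<odot>\<^bsub>A\<^esub> \<one>\<^bsub>A\<^esub>"] smult_mult[of "\<one>\<^bsub>A\<^esub>" i c] i(1) I.Icarr A_smult_closed by simp
    moreover have "c \<odot>\<^bsub>A\<^esub> y = c \<odot>\<^bsub>A\<^esub> i \<oplus>\<^bsub>A\<^esub> c \<odot>\<^bsub>A\<^esub> x"
      using M.smult_r_distr[of c i x] i x I.Icarr by simp
    ultimately have "proj (c \<odot>\<^bsub>A\<^esub> y) = \<zero>\<^bsub>Q\<^esub> \<oplus>\<^bsub>Q\<^esub> proj (c \<odot>\<^bsub>A\<^esub> x)"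
      using x proj_ideal by (simp add: A_smult_closed I.Icarr flip: proj_add)
    also have "\<dots> = proj (c \<odot>\<^bsub>A\<^esub> x)" using x by (simp add: proj_zero proj_add A_smult_closed)
    finally show ?thesis .
  qed
  then have "(\<Union>y\<in>proj x. proj (c \<odot>\<^bsub>A\<^esub> y)) = proj (c \<odot>\<^bsub>A\<^esub> x)" using proj_self[OF x] by blast
  then show ?thesis by (simp add: quot_algebra_def)
qed

lemmas proj_simps = proj_add proj_mult proj_smult A_smult_closed

lemma ring_Q: "ring Q"
proof (rule ringI)
  show "abelian_group Q"
  proof (rule abelian_groupI)
    fix x assume "x \<in> carrier Q"
    then obtain a where "a \<in> carrier A" "x = proj a" by (auto simp: carrier_Q)
    then show "\<exists>y\<in>carrier Q. y \<oplus>\<^bsub>Q\<^esub> x = \<zero>\<^bsub>Q\<^esub>"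
      by (intro bexI[of _ "proj (\<ominus>\<^bsub>A\<^esub> a)"]) (auto simp: carrier_Q proj_simps proj_zero A.l_neg)
  qed (auto simp: carrier_Q proj_simps proj_zero A.a_ac)
  show "monoid Q"
    by (rule monoidI) (auto simp: carrier_Q proj_simps proj_one A.m_assoc)
qed (auto simp: carrier_Q proj_simps A.l_distr A.r_distr)

lemma module_Q: "Module.module class_ring Q"
proof (rule moduleI)
  show "cring (class_ring :: 'k ring)" by (rule fieldE(1)[OF class_field])
  show "abelian_group Q" using ring_Q by (rule ring.is_abelian_group)
qed (use M.smult_l_distr M.smult_r_distr M.smult_assoc1 M.smult_one in \<open>auto simp: carrier_Q proj_simps\<close>)

lemma
  assumes "x \<in> carrier Q" "y \<in> carrier Q"
  shows Q_smult_mult: "(c \<odot>\<^bsub>Q\<^esub> x) \<otimes>\<^bsub>Q\<^esub> y = c \<odot>\<^bsub>Q\<^esub> (x \<otimes>\<^bsub>Q\<^esub> y)"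
    and Q_mult_smult: "x \<otimes>\<^bsub>Q\<^esub> (c \<odot>\<^bsub>Q\<^esub> y) = c \<odot>\<^bsub>Q\<^esub> (x \<otimes>\<^bsub>Q\<^esub> y)"
  using assms by (auto simp: carrier_Q proj_simps smult_mult mult_smult)

lemma left_mult_module_hom:
  assumes "a \<in> carrier Q"
  shows "(\<lambda>x. a \<otimes>\<^bsub>Q\<^esub> x) \<in> LinearCombinations.module_hom class_ring Q Q"
proof -
  interpret Q: ring Q by (rule ring_Q)
  show ?thesis using assms by (auto simp: LinearCombinations.module_hom_def Q.r_distr Q_mult_smult)
qed

end

section \<open>Shuffles in Hecke actions\<close>

definition q_bracket :: "'k::field \<Rightarrow> nat \<Rightarrow> 'k" where
  "q_bracket q j = (\<Sum>i<j. q ^ (2 * i))"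

lemma q_bracket_Suc: "q_bracket q (Suc j) = 1 + q ^ 2 * q_bracket q j"
  unfolding q_bracket_def
  by (subst sum.lessThan_Suc_shift) (simp add: sum_distrib_left power2_eq_square mult_ac)

locale hecke_action = vector_space scale
  for scale :: "'k::field \<Rightarrow> 'b::ab_group_add \<Rightarrow> 'b" (infixr \<open>*s\<close> 75) +
  fixes q :: 'k and \<sigma> :: "nat \<Rightarrow> 'b \<Rightarrow> 'b"
  assumes q_nonzero: "q \<noteq> 0"
    and linear_gen: "Vector_Spaces.linear scale scale (\<sigma> i)"
    and gen_quadratic: "1 \<le> i \<Longrightarrow> \<sigma> i (\<sigma> i v) = (q - inverse q) *s \<sigma> i v + v"
    and gen_braid: "1 \<le> i \<Longrightarrow> \<sigma> i (\<sigma> (Suc i) (\<sigma> i v)) = \<sigma> (Suc i) (\<sigma> i (\<sigma> (Suc i) v))"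
    and gen_commute: "1 \<le> i \<Longrightarrow> Suc i < j \<Longrightarrow> \<sigma> i (\<sigma> j v) = \<sigma> j (\<sigma> i v)"
begin

lemma gen_add: "\<sigma> i (v + w) = \<sigma> i v + \<sigma> i w"
  and gen_scale: "\<sigma> i (c *s v) = c *s \<sigma> i v"
  using linear_gen by (simp_all add: Vector_Spaces.linear_iff)

lemma gen_zero [simp]: "\<sigma> i 0 = 0"
  using gen_scale[of i 0 0] by simp

primrec shuffle :: "nat \<Rightarrow> 'b \<Rightarrow> 'b" where
  "shuffle 0 v = 0"
| "shuffle (Suc n) v = v + q *s shuffle n (\<sigma> n v)"

lemma shuffle_add: "shuffle n (v + w) = shuffle n v + shuffle n w"
  by (induction n arbitrary: v w) (simp_all add: gen_add scale_right_distrib)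

lemma shuffle_scale: "shuffle n (c *s v) = c *s shuffle n v"
  by (induction n arbitrary: v) (simp_all add: gen_scale scale_right_distrib mult.commute)

lemma shuffle_zero [simp]: "shuffle n 0 = 0"
  using shuffle_scale[of n 0 0] by simp

lemma linear_shuffle: "Vector_Spaces.linear scale scale (shuffle n)"
  by (simp add: Vector_Spaces.linear_iff vector_space_axioms shuffle_add shuffle_scale)

lemma shuffle_eq_sum: "shuffle n v = (\<Sum>k<n. q ^ k *s foldr \<sigma> [n - k..<n] v)"
proof (induction n arbitrary: v)
  case (Suc n)
  have "q *s shuffle n (\<sigma> n v) = (\<Sum>k<n. q ^ Suc k *s foldr \<sigma> [Suc n - Suc k..<Suc n] v)"
    unfolding Suc by (simp add: scale_sum_right)
  then show ?case by (simp add: sum.lessThan_Suc_shift del: upt_Suc sum.lessThan_Suc)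
qed simp

lemma shuffle_gen_commute:
  assumes "n < i"
  shows "shuffle n (\<sigma> i v) = \<sigma> i (shuffle n v)"
  using assms
proof (induction n arbitrary: v)
  case 0
  then show ?case by simp
next
  case (Suc n)
  have "shuffle n (\<sigma> n (\<sigma> i v)) = \<sigma> i (shuffle n (\<sigma> n v))"
    using Suc gen_commute[of n i v] by (cases n) simp_all
  then show ?case by (simp add: gen_add gen_scale)
qed

text \<open>Shuffling in two letters one after the other is symmetric in them, up to the factor \<open>q\<close>.\<close>

lemma shuffle_Suc_shuffle_gen:
  assumes "1 \<le> n"
  shows "shuffle (Suc n) (shuffle n (\<sigma> n v)) = q *s shuffle (Suc n) (shuffle n v)"
  using assms
proof (induction n arbitrary: v)
  case (Suc n)
  let ?\<tau> = "\<sigma> (Suc n)"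
  have expand: "shuffle (Suc (Suc n)) (shuffle (Suc n) w)
     = shuffle (Suc n) (w + q *s ?\<tau> w) + (q * q) *s shuffle (Suc n) (shuffle n (?\<tau> (\<sigma> n w)))" for w
    by (simp add: shuffle_add shuffle_scale gen_add gen_scale scale_right_distrib
        shuffle_gen_commute[symmetric] add_ac)
  have eigen: "?\<tau> v + q *s ?\<tau> (?\<tau> v) = q *s (v + q *s ?\<tau> v)"
  proof -
    have "?\<tau> v + q *s ?\<tau> (?\<tau> v) = (1 + q * (q - inverse q)) *s ?\<tau> v + q *s v"
      by (simp add: gen_quadratic scale_right_distrib scale_left_distrib)
    also have "1 + q * (q - inverse q) = q * q" using q_nonzero by (simp add: algebra_simps)
    finally show ?thesis by (simp add: scale_right_distrib add.commute)
  qed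
  have "shuffle (Suc n) (shuffle n (?\<tau> (\<sigma> n (?\<tau> v)))) = q *s shuffle (Suc n) (shuffle n (?\<tau> (\<sigma> n v)))"
  proof (cases "1 \<le> n")
    case True
    then show ?thesis using Suc.IH[of "?\<tau> (\<sigma> n v)"] gen_braid[of n v] by simp
  next
    case False
    then have "n = 0" by simp
    then show ?thesis by simp
  qed
  then show ?case
    unfolding expand eigen
    by (simp only: shuffle_add shuffle_scale scale_right_distrib scale_scale mult_ac)
qed simp

lemma shuffle_shuffle:
  "shuffle n (shuffle n v) = shuffle n v + q ^ 2 *s shuffle n (shuffle (n - 1) v)"
proof (cases n)
  case (Suc m)
  have "shuffle n (shuffle n v) = shuffle n v + q *s shuffle (Suc m) (shuffle m (\<sigma> m v))"
    unfolding Suc by (subst (2) shuffle.simps) (simp only: shuffle_add shuffle_scale)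
  also have "q *s shuffle (Suc m) (shuffle m (\<sigma> m v)) = q ^ 2 *s shuffle n (shuffle (n - 1) v)"
    using shuffle_Suc_shuffle_gen[of m v]
    by (cases "m = 0") (simp_all add: Suc power2_eq_square)
  finally show ?thesis .
qed simp

primrec multi_shuffle :: "nat \<Rightarrow> nat \<Rightarrow> 'b \<Rightarrow> 'b" where
  "multi_shuffle n 0 v = v"
| "multi_shuffle n (Suc j) v = shuffle n (multi_shuffle (n - 1) j v)"

lemma multi_shuffle_add: "multi_shuffle n j (v + w) = multi_shuffle n j v + multi_shuffle n j w"
  by (induction j arbitrary: n) (simp_all add: shuffle_add)

lemma multi_shuffle_scale: "multi_shuffle n j (c *s v) = c *s multi_shuffle n j v"
  by (induction j arbitrary: n) (simp_all add: shuffle_scale)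

lemma linear_multi_shuffle: "Vector_Spaces.linear scale scale (multi_shuffle n j)"
  by (simp add: Vector_Spaces.linear_iff vector_space_axioms multi_shuffle_add multi_shuffle_scale)

lemma multi_shuffle_eq_0: "n < j \<Longrightarrow> multi_shuffle n j v = 0"
proof (induction j arbitrary: n)
  case (Suc j)
  then show ?case by (cases n) simp_all
qed simp

lemma multi_shuffle_multi_shuffle:
  "multi_shuffle n i (multi_shuffle (n - i) j v) = multi_shuffle n (i + j) v"
proof (induction i arbitrary: n)
  case (Suc i)
  then show ?case using Suc[of "n - 1"] by simp
qed simp

lemma shuffle_multi_shuffle:
  "shuffle n (multi_shuffle n j v)
    = q_bracket q j *s multi_shuffle n j v + q ^ (2 * j) *s multi_shuffle n (Suc j) v"
proof (induction j arbitrary: n)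
  case 0
  then show ?case by (simp add: q_bracket_def)
next
  case (Suc j)
  let ?w = "multi_shuffle (n - 1) j v"
  have "shuffle n (multi_shuffle n (Suc j) v) = shuffle n ?w + q ^ 2 *s shuffle n (shuffle (n - 1) ?w)"
    using shuffle_shuffle[of n ?w] by simp
  also have "\<dots> = shuffle n ?w + q ^ 2 *s (q_bracket q j *s shuffle n ?w
       + q ^ (2 * j) *s shuffle n (multi_shuffle (n - 1) (Suc j) v))"
    by (simp only: Suc.IH shuffle_add shuffle_scale)
  also have "\<dots> = (1 + q ^ 2 * q_bracket q j) *s shuffle n ?w
       + q ^ (2 * Suc j) *s shuffle n (multi_shuffle (n - 1) (Suc j) v)"
    by (simp add: scale_right_distrib scale_left_distrib add.assoc power2_eq_square mult_ac)
  finally show ?case by (simp only: q_bracket_Suc multi_shuffle.simps)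
qed

lemma multi_shuffle_gen_commute: "n < i \<Longrightarrow> multi_shuffle n j (\<sigma> i v) = \<sigma> i (multi_shuffle n j v)"
  by (induction j arbitrary: n) (simp_all add: shuffle_gen_commute)

lemma multi_shuffle_gen:
  assumes "n - j < l" "l < n"
  shows "multi_shuffle n j (\<sigma> l v) = q *s multi_shuffle n j v"
  using assms
proof (induction j arbitrary: n)
  case (Suc j)
  show ?case
  proof (cases "Suc l = n")
    case True
    then obtain i where j: "j = Suc i" using Suc.prems by (cases j) auto
    have "multi_shuffle (l - 1) i (\<sigma> l v) = \<sigma> l (multi_shuffle (l - 1) i v)"
      by (rule multi_shuffle_gen_commute) (use Suc.prems in auto)
    then show ?thesis using shuffle_Suc_shuffle_gen[of l] True Suc.prems by (auto simp: j)
  next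
    case False
    then show ?thesis using Suc.IH[of "n - 1"] Suc.prems by (simp add: shuffle_scale)
  qed
qed simp

end

section \<open>Hecke operators on words\<close>

declare plus_fun_apply [simp del] zero_fun_apply [simp del]

definition scale_fun :: "'k::field \<Rightarrow> ('x \<Rightarrow> 'k) \<Rightarrow> 'x \<Rightarrow> 'k" (infixr \<open>*\<^sub>f\<close> 75) where
  "c *\<^sub>f f = (\<lambda>x. c * f x)"

lemma scale_fun_apply: "(c *\<^sub>f f) x = c * f x"
  by (simp add: scale_fun_def)

lemmas fun_vector_simps = fun_eq_iff scale_fun_apply plus_fun_apply zero_fun_apply

interpretation funs: vector_space "scale_fun :: 'k::field \<Rightarrow> ('x \<Rightarrow> 'k) \<Rightarrow> 'x \<Rightarrow> 'k"
  by unfold_locales (auto simp: fun_vector_simps algebra_simps)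

interpretation funs: vector_space_pair "scale_fun :: 'k::field \<Rightarrow> ('x \<Rightarrow> 'k) \<Rightarrow> 'x \<Rightarrow> 'k"
  "scale_fun :: 'k \<Rightarrow> ('y \<Rightarrow> 'k) \<Rightarrow> 'y \<Rightarrow> 'k"
  by unfold_locales

text \<open>The action of a generator on the tensor square of the space spanned by the letters.
  The scalar \<open>q\<close> for equal letters makes the Hecke relations hold for all words.\<close>

definition swap_letters ::
    "'k::field \<Rightarrow> ('a::linorder \<Rightarrow> 'a \<Rightarrow> 'k) \<Rightarrow> 'a \<Rightarrow> 'a \<Rightarrow> 'k" where
  "swap_letters q F x y = (if x = y then q * F x y
     else F y x + (if x < y then (q - inverse q) * F x y else 0))"

lemma swap_letters_quadratic:
  assumes "q \<noteq> 0"
  shows "swap_letters q (swap_letters q F) x y = (q - inverse q) * swap_letters q F x y + F x y"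
  using assms by (auto simp: swap_letters_def algebra_simps)

lemma swap_letters_braid:
  fixes F :: "'a::linorder \<Rightarrow> 'a \<Rightarrow> 'a \<Rightarrow> 'k::field"
  assumes "q \<noteq> 0"
  defines "L \<equiv> \<lambda>F x y z. swap_letters q (\<lambda>x y. F x y z) x y"
    and "R \<equiv> \<lambda>F x. swap_letters q (F x)"
  shows "L (R (L F)) x y z = R (L (R F)) x y z"
proof -
  have cancel: "inverse q * (q * t) = t" "q * (inverse q * t) = t" for t
    using assms by (auto simp: mult.assoc[symmetric])
  show ?thesis
    using linorder_less_linear[of x y] linorder_less_linear[of y z] linorder_less_linear[of x z]
    by (elim disjE) (auto simp: L_def R_def swap_letters_def algebra_simps cancel)
qed

lemma swap_letters_commute:
  "swap_letters q (\<lambda>x y. swap_letters q (F x y) z w) x y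
    = swap_letters q (\<lambda>z w. swap_letters q (\<lambda>x y. F x y z w) x y) z w"
  by (auto simp: swap_letters_def algebra_simps)

text \<open>Words are infinite, with positions counted from 0, so \<open>\<sigma>\<^sub>i\<close> acts on positions \<open>i - 1\<close> and \<open>i\<close>.\<close>

definition hecke_op ::
    "'k::field \<Rightarrow> nat \<Rightarrow> ((nat \<Rightarrow> 'a::linorder) \<Rightarrow> 'k) \<Rightarrow> (nat \<Rightarrow> 'a) \<Rightarrow> 'k" where
  "hecke_op q i f p = swap_letters q (\<lambda>x y. f (p(i - 1 := x, i := y))) (p (i - 1)) (p i)"

lemma linear_hecke_op: "Vector_Spaces.linear scale_fun scale_fun (hecke_op q i)"
  by (auto simp: Vector_Spaces.linear_iff funs.vector_space_axioms hecke_op_def swap_letters_def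
      fun_vector_simps algebra_simps)

lemma hecke_op_quadratic:
  fixes f :: "(nat \<Rightarrow> 'a::linorder) \<Rightarrow> 'k::field"
  assumes "q \<noteq> 0" "1 \<le> i"
  shows "hecke_op q i (hecke_op q i f) = (q - inverse q) *\<^sub>f hecke_op q i f + f"
proof
  fix p :: "nat \<Rightarrow> 'a"
  obtain a where i: "i = Suc a" using assms by (cases i) auto
  have p: "p = p(a := p a, Suc a := p (Suc a))" by simp
  have upd2: "hecke_op q i g (p(a := x, Suc a := y))
      = swap_letters q (\<lambda>x y. g (p(a := x, Suc a := y))) x y"
    for g :: "(nat \<Rightarrow> 'a) \<Rightarrow> 'k" and x y
    by (simp add: i hecke_op_def fun_upd_twist)
  have "hecke_op q i (hecke_op q i f) (p(a := x, Suc a := y))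
      = ((q - inverse q) *\<^sub>f hecke_op q i f + f) (p(a := x, Suc a := y))" for x y
    unfolding plus_fun_apply scale_fun_apply upd2 by (rule swap_letters_quadratic[OF assms(1)])
  from this[of "p a" "p (Suc a)"]
  show "hecke_op q i (hecke_op q i f) p = ((q - inverse q) *\<^sub>f hecke_op q i f + f) p" by simp
qed

lemma hecke_op_braid:
  fixes f :: "(nat \<Rightarrow> 'a::linorder) \<Rightarrow> 'k::field"
  assumes "q \<noteq> 0" "1 \<le> i"
  shows "hecke_op q i (hecke_op q (Suc i) (hecke_op q i f))
    = hecke_op q (Suc i) (hecke_op q i (hecke_op q (Suc i) f))"
proof
  fix p :: "nat \<Rightarrow> 'a"
  obtain a where i: "i = Suc a" using assms by (cases i) auto
  define upd where "upd x y z = p(a := x, Suc a := y, Suc (Suc a) := z)" for x y z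
  have left: "hecke_op q i g (upd x y z) = swap_letters q (\<lambda>x y. g (upd x y z)) x y"
    and right: "hecke_op q (Suc i) g (upd x y z) = swap_letters q (\<lambda>y z. g (upd x y z)) y z"
    for g :: "(nat \<Rightarrow> 'a) \<Rightarrow> 'k" and x y z
    by (simp_all add: i hecke_op_def upd_def fun_upd_twist)
  have p: "p = upd (p a) (p (Suc a)) (p (Suc (Suc a)))" by (simp add: upd_def)
  show "hecke_op q i (hecke_op q (Suc i) (hecke_op q i f)) p
    = hecke_op q (Suc i) (hecke_op q i (hecke_op q (Suc i) f)) p"
    by (subst (1 2) p, unfold left right, rule swap_letters_braid[OF assms(1)])
qed

lemma hecke_op_commute:
  fixes f :: "(nat \<Rightarrow> 'a::linorder) \<Rightarrow> 'k::field"
  assumes "1 \<le> i" "Suc i < j"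
  shows "hecke_op q i (hecke_op q j f) = hecke_op q j (hecke_op q i f)"
proof
  fix p :: "nat \<Rightarrow> 'a"
  obtain a b where ij: "i = Suc a" "j = Suc b" "Suc a < b" using assms by (cases i; cases j) auto
  define upd where "upd x y z w = p(a := x, Suc a := y, b := z, Suc b := w)" for x y z w
  have left: "hecke_op q i g (upd x y z w) = swap_letters q (\<lambda>x y. g (upd x y z w)) x y"
    and right: "hecke_op q j g (upd x y z w) = swap_letters q (\<lambda>z w. g (upd x y z w)) z w"
    for g :: "(nat \<Rightarrow> 'a) \<Rightarrow> 'k" and x y z w
    using ij by (auto simp: hecke_op_def upd_def fun_upd_twist)
  have p: "p = upd (p a) (p (Suc a)) (p b) (p (Suc b))" by (simp add: upd_def)
  show "hecke_op q i (hecke_op q j f) p = hecke_op q j (hecke_op q i f) p"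
    by (subst (1 2) p, unfold left right, rule swap_letters_commute)
qed

locale word_action =
  fixes q :: "'k::field"
  assumes q_nonzero: "q \<noteq> 0"
begin

sublocale hecke_action "scale_fun :: 'k \<Rightarrow> ((nat \<Rightarrow> nat) \<Rightarrow> 'k) \<Rightarrow> (nat \<Rightarrow> nat) \<Rightarrow> 'k" q "hecke_op q"
  by (intro hecke_action.intro hecke_action_axioms.intro funs.vector_space_axioms q_nonzero
      linear_hecke_op hecke_op_quadratic hecke_op_braid hecke_op_commute)

end

section \<open>Leading words\<close>

definition pad :: "nat list \<Rightarrow> nat \<Rightarrow> nat" where
  "pad xs i = (if i < length xs then xs ! i else 0)"

definition word_vector :: "nat list \<Rightarrow> (nat \<Rightarrow> nat) \<Rightarrow> 'k::field" where
  "word_vector xs = (\<lambda>p. if p = pad xs then 1 else 0)"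

lemma pad_inject: "length xs = length ys \<Longrightarrow> pad xs = pad ys \<longleftrightarrow> xs = ys"
  by (auto simp: pad_def fun_eq_iff intro: nth_equalityI split: if_splits)

lemma eq_pad_Cons_iff: "p = pad (x # xs) \<longleftrightarrow> p 0 = x \<and> (\<lambda>i. p (Suc i)) = pad xs"
proof -
  have split: "p = p' \<longleftrightarrow> p 0 = p' 0 \<and> (\<lambda>i. p (Suc i)) = (\<lambda>i. p' (Suc i))" for p' :: "nat \<Rightarrow> nat"
    by (metis ext not0_implies_Suc)
  show ?thesis unfolding split[of "pad (x # xs)"] by (simp add: pad_def[abs_def] cong: if_cong)
qed

lemma eq_pad_append_iff:
  "p = pad (xs @ ys) \<longleftrightarrow> (\<forall>i<length xs. p i = xs ! i) \<and> (\<lambda>i. p (i + length xs)) = pad ys"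
  by (induction xs arbitrary: p) (auto simp: eq_pad_Cons_iff less_Suc_eq_0_disj)

lemma hecke_op_word_vector:
  assumes "x \<noteq> y"
  shows "hecke_op q (Suc (length as)) (word_vector (as @ x # y # bs)) = word_vector (as @ y # x # bs)
    + (if x < y then (q - inverse q) *\<^sub>f word_vector (as @ x # y # bs) else 0)"
proof
  fix p :: "nat \<Rightarrow> nat"
  let ?a = "length as"
  have upd: "p(?a := u, Suc ?a := v) = pad (as @ s # t # bs) \<longleftrightarrow>
      u = s \<and> v = t \<and> (\<forall>i<?a. p i = as ! i) \<and> (\<lambda>i. p (Suc (Suc (i + ?a)))) = pad bs" for u v s t
    by (auto simp: eq_pad_append_iff eq_pad_Cons_iff)
  have "p = pad (as @ s # t # bs) \<longleftrightarrow>
      p ?a = s \<and> p (Suc ?a) = t \<and> (\<forall>i<?a. p i = as ! i) \<and> (\<lambda>i. p (Suc (Suc (i + ?a)))) = pad bs" for s t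
    using upd[of "p ?a" "p (Suc ?a)"] by simp
  then show "hecke_op q (Suc ?a) (word_vector (as @ x # y # bs)) p = (word_vector (as @ y # x # bs)
    + (if x < y then (q - inverse q) *\<^sub>f word_vector (as @ x # y # bs) else 0)) p"
    using assms by (auto simp: hecke_op_def swap_letters_def word_vector_def upd
        plus_fun_apply zero_fun_apply scale_fun_apply)
qed

text \<open>The lexicographically largest word obtained by inserting \<open>a\<close> into \<open>u\<close>.\<close>

primrec ins :: "nat \<Rightarrow> nat list \<Rightarrow> nat list" where
  "ins a [] = [a]"
| "ins a (y # u) = (if a < y then y # ins a u else a # y # u)"

lemma mset_ins [simp]: "mset (ins a u) = add_mset a (mset u)"
  by (induction u) auto

lemma set_ins [simp]: "set (ins a u) = insert a (set u)"
  by (induction u) auto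

lemma length_ins [simp]: "length (ins a u) = Suc (length u)"
  by (induction u) auto

lemma distinct_ins [simp]: "distinct (ins a u) \<longleftrightarrow> a \<notin> set u \<and> distinct u"
  by (induction u) auto

lemma ins_smallest: "\<forall>y\<in>set u. a < y \<Longrightarrow> ins a u = u @ [a]"
  by (induction u) auto

lemma ins_snoc: "ins a (u @ [x]) = (if \<forall>y\<in>set (u @ [x]). a < y then u @ [x, a] else ins a u @ [x])"
  by (induction u) auto

abbreviation lex_nat :: "(nat list \<times> nat list) set" where
  "lex_nat \<equiv> lex less_than"

lemma lex_nat_trans: "(u, v) \<in> lex_nat \<Longrightarrow> (v, w) \<in> lex_nat \<Longrightarrow> (u, w) \<in> lex_nat"
  using lex_transI[OF trans_less_than] unfolding trans_def by blast

lemma ins_lex_mono: "(u, w) \<in> lex_nat \<Longrightarrow> a \<notin> set u \<Longrightarrow> a \<notin> set w \<Longrightarrow> (ins a u, ins a w) \<in> lex_nat"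
proof (induction u arbitrary: w)
  case (Cons x u)
  then show ?case by (cases w) auto
qed simp

lemma snoc_lex_ins: "a \<notin> set u \<Longrightarrow> \<exists>y\<in>set u. y < a \<Longrightarrow> (u @ [a], ins a u) \<in> lex_nat"
  by (induction u) auto

lemma ins_snoc_lex_ins_snoc: "x < a \<Longrightarrow> a \<notin> set u \<Longrightarrow> (ins x u @ [a], ins a u @ [x]) \<in> lex_nat"
  by (induction u) auto

definition lower_words :: "nat list \<Rightarrow> nat list \<Rightarrow> ((nat \<Rightarrow> nat) \<Rightarrow> 'k::field) set" where
  "lower_words w r = {word_vector (x @ r) | x. (x, w) \<in> lex_nat \<and> mset x = mset w}"

definition leading_word :: "nat list \<Rightarrow> nat list \<Rightarrow> ((nat \<Rightarrow> nat) \<Rightarrow> 'k::field) \<Rightarrow> bool" where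
  "leading_word w r f
    \<longleftrightarrow> (\<exists>c g. c \<noteq> 0 \<and> g \<in> funs.span (lower_words w r) \<and> f = c *\<^sub>f word_vector (w @ r) + g)"

lemma leading_word_word_vector: "leading_word w r (word_vector (w @ r))"
  unfolding leading_word_def by (intro exI[of _ 1] exI[of _ 0]) (simp add: funs.span_zero)

lemma leading_word_scale:
  assumes "leading_word w r f" "c \<noteq> 0"
  shows "leading_word w r (c *\<^sub>f f)"
proof -
  obtain d g where "d \<noteq> 0" "g \<in> funs.span (lower_words w r)" "f = d *\<^sub>f word_vector (w @ r) + g"
    using assms(1) by (auto simp: leading_word_def)
  then show ?thesis unfolding leading_word_def using assms(2)
    by (intro exI[of _ "c * d"] exI[of _ "c *\<^sub>f g"]) (simp add: funs.span_scale funs.scale_right_distrib)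
qed

lemma leading_word_add_lower:
  assumes "leading_word w r f" "h \<in> funs.span (lower_words w r)"
  shows "leading_word w r (f + h)"
proof -
  obtain c g where "c \<noteq> 0" "g \<in> funs.span (lower_words w r)" "f = c *\<^sub>f word_vector (w @ r) + g"
    using assms(1) by (auto simp: leading_word_def)
  then show ?thesis unfolding leading_word_def using assms(2)
    by (intro exI[of _ c] exI[of _ "g + h"]) (simp add: funs.span_add add.assoc)
qed

lemma leading_word_in_span_lower_words:
  assumes "leading_word x r f" "(x, w) \<in> lex_nat" "mset x = mset w"
  shows "f \<in> funs.span (lower_words w r)"
proof -
  obtain c g where f: "g \<in> funs.span (lower_words x r)" "f = c *\<^sub>f word_vector (x @ r) + g"
    using assms(1) by (auto simp: leading_word_def)
  have "lower_words x r \<subseteq> lower_words w r"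
    using assms(2,3) lex_nat_trans by (auto simp: lower_words_def)
  then have "g \<in> funs.span (lower_words w r)" using f(1) funs.span_mono by blast
  moreover have "word_vector (x @ r) \<in> funs.span (lower_words w r)"
    using assms(2,3) by (intro funs.span_base) (auto simp: lower_words_def)
  ultimately show ?thesis unfolding f(2) by (intro funs.span_add funs.span_scale)
qed

lemma leading_word_snoc:
  fixes f :: "(nat \<Rightarrow> nat) \<Rightarrow> 'k::field"
  assumes "leading_word w (x # r) f"
  shows "leading_word (w @ [x]) r f"
proof -
  have "lower_words w (x # r) \<subseteq> (lower_words (w @ [x]) r :: ((nat \<Rightarrow> nat) \<Rightarrow> 'k) set)"
  proof
    fix g :: "(nat \<Rightarrow> nat) \<Rightarrow> 'k" assume "g \<in> lower_words w (x # r)"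
    then obtain y where y: "g = word_vector (y @ x # r)" "(y, w) \<in> lex_nat" "mset y = mset w"
      by (auto simp: lower_words_def)
    then show "g \<in> lower_words (w @ [x]) r" unfolding lower_words_def
      by (intro CollectI exI[of _ "y @ [x]"]) (simp add: lex_append_rightI)
  qed
  then have "funs.span (lower_words w (x # r))
      \<subseteq> funs.span (lower_words (w @ [x]) r :: ((nat \<Rightarrow> nat) \<Rightarrow> 'k) set)"
    by (rule funs.span_mono)
  then show ?thesis using assms by (auto simp: leading_word_def)
qed

lemma span_linear_image:
  assumes "Vector_Spaces.linear scale_fun scale_fun T" "g \<in> funs.span A"
    and "\<And>f. f \<in> A \<Longrightarrow> T f \<in> funs.span B"
  shows "T g \<in> funs.span B"
proof -
  have "T g \<in> funs.span (T ` A)" using assms(2) funs.linear_span_image[OF assms(1)] by blast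
  also have "\<dots> \<subseteq> funs.span B" using assms(3) by (intro funs.span_minimal) auto
  finally show ?thesis .
qed

context word_action
begin

lemma shuffle_word_vector_snoc:
  fixes u :: "nat list"
  assumes "x \<noteq> a"
  defines "S \<equiv> shuffle (Suc (length u))"
  shows "shuffle (Suc (length (u @ [x]))) (word_vector ((u @ [x]) @ a # r))
    = word_vector ((u @ [x, a]) @ r) + q *\<^sub>f S (word_vector (u @ a # x # r))
      + (if x < a then (q * (q - inverse q)) *\<^sub>f S (word_vector (u @ x # a # r)) else 0)"
proof -
  let ?w = "word_vector (u @ x # a # r) :: (nat \<Rightarrow> nat) \<Rightarrow> 'k"
  have "shuffle (Suc (Suc (length u))) ?w = ?w + q *\<^sub>f S (hecke_op q (Suc (length u)) ?w)"
    unfolding S_def by (rule shuffle.simps(2))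
  also have "S (hecke_op q (Suc (length u)) ?w) = S (word_vector (u @ a # x # r))
      + (if x < a then (q - inverse q) *\<^sub>f S ?w else 0)"
    by (simp add: S_def hecke_op_word_vector[OF assms(1)] shuffle_add shuffle_scale del: shuffle.simps)
  finally show ?thesis by (simp add: funs.scale_right_distrib add.assoc del: shuffle.simps)
qed

lemma leading_word_shuffle_word_vector:
  assumes "distinct u" "a \<notin> set u"
  shows "leading_word (ins a u) r (shuffle (Suc (length u)) (word_vector (u @ a # r)))"
  using assms
proof (induction u arbitrary: a r rule: rev_induct)
  case Nil
  show ?case using leading_word_word_vector[of "[a]" r] by simp
next
  case (snoc x u)
  let ?t = "ins a (u @ [x])"
  let ?low = "funs.span (lower_words ?t r) :: ((nat \<Rightarrow> nat) \<Rightarrow> 'k) set"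
  let ?S = "shuffle (Suc (length u))"
  let ?A = "word_vector ((u @ [x, a]) @ r) :: (nat \<Rightarrow> nat) \<Rightarrow> 'k"
  let ?B = "q *\<^sub>f ?S (word_vector (u @ a # x # r))"
  let ?C = "if x < a then (q * (q - inverse q)) *\<^sub>f ?S (word_vector (u @ x # a # r)) else 0"
  have xa: "x \<noteq> a" "a \<notin> set u" "x \<notin> set u" "distinct u" using snoc.prems by auto
  have A: "leading_word (u @ [x, a]) r ?A" by (rule leading_word_word_vector)
  have B: "leading_word (ins a u @ [x]) r ?B"
    using snoc.IH[of a "x # r"] xa q_nonzero by (intro leading_word_scale leading_word_snoc) auto
  have C: "?C \<in> ?low" if "x < a \<Longrightarrow> (ins x u @ [a], ?t) \<in> lex_nat"
    using that leading_word_snoc[OF snoc.IH[of x "a # r"]] xa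
    by (auto intro!: funs.span_zero funs.span_scale leading_word_in_span_lower_words)
  have "leading_word ?t r (?A + ?B + ?C)"
  proof (cases "\<forall>y\<in>set (u @ [x]). a < y")
    case True
    then have t: "?t = u @ [x, a]" and "ins a u = u @ [a]" by (simp_all add: ins_snoc ins_smallest)
    then have "(ins a u @ [x], ?t) \<in> lex_nat" using True by (simp add: lex_append_leftI)
    then have "?B \<in> ?low" using B by (intro leading_word_in_span_lower_words) auto
    moreover have "?C \<in> ?low" using True by (intro C) auto
    ultimately show ?thesis using A unfolding t by (intro leading_word_add_lower)
  next
    case False
    then have t: "?t = ins a u @ [x]" by (simp only: ins_snoc if_False)
    have "((u @ [x]) @ [a], ?t) \<in> lex_nat"
      using False snoc.prems(2) by (intro snoc_lex_ins) (auto simp: not_less le_less)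
    then have "?A \<in> ?low" using A by (intro leading_word_in_span_lower_words) auto
    moreover have "?C \<in> ?low" unfolding t using xa by (intro C[unfolded t] ins_snoc_lex_ins_snoc)
    ultimately have "leading_word ?t r (?B + ?A + ?C)"
      using B unfolding t by (intro leading_word_add_lower)
    then show ?thesis by (simp only: add.commute[of ?A ?B])
  qed
  then show ?case by (simp only: shuffle_word_vector_snoc[OF xa(1)])
qed

lemma leading_word_shuffle:
  assumes "leading_word w (a # r) f" "distinct w" "a \<notin> set w"
  shows "leading_word (ins a w) r (shuffle (Suc (length w)) f)"
proof -
  let ?S = "shuffle (Suc (length w))"
  obtain c g where f: "c \<noteq> 0" "g \<in> funs.span (lower_words w (a # r))"
      "f = c *\<^sub>f word_vector (w @ a # r) + g"
    using assms(1) by (auto simp: leading_word_def)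
  have "?S g \<in> funs.span (lower_words (ins a w) r)"
  proof (rule span_linear_image[OF linear_shuffle f(2)])
    fix h :: "(nat \<Rightarrow> nat) \<Rightarrow> 'k" assume "h \<in> lower_words w (a # r)"
    then obtain x where x: "h = word_vector (x @ a # r)" "(x, w) \<in> lex_nat" "mset x = mset w"
      by (auto simp: lower_words_def)
    then have dx: "distinct x" "a \<notin> set x" "length x = length w"
      using assms(2,3) by (metis mset_eq_imp_distinct_iff, metis mset_eq_setD, metis mset_eq_length)
    then have "leading_word (ins a x) r (?S h)"
      using leading_word_shuffle_word_vector[of x a r] by (simp add: x(1))
    then show "?S h \<in> funs.span (lower_words (ins a w) r)"
      using ins_lex_mono[OF x(2) dx(2) assms(3)] x(3) by (intro leading_word_in_span_lower_words) auto
  qed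
  moreover have "leading_word (ins a w) r (c *\<^sub>f ?S (word_vector (w @ a # r)))"
    using assms f(1) by (intro leading_word_scale leading_word_shuffle_word_vector)
  ultimately show ?thesis
    unfolding f(3) shuffle_add shuffle_scale by (rule leading_word_add_lower[rotated])
qed

end

lemma length_fold_ins [simp]: "length (fold ins v u) = length v + length u"
  by (induction v arbitrary: u) auto

lemma set_fold_ins [simp]: "set (fold ins v u) = set v \<union> set u"
  by (induction v arbitrary: u) auto

lemma distinct_fold_ins [simp]: "distinct (fold ins v u) \<longleftrightarrow> distinct (u @ v)"
  by (induction v arbitrary: u) auto

lemma (in word_action) leading_word_multi_shuffle:
  assumes "distinct (u @ v)"
  shows "leading_word (fold ins v u) r
    (multi_shuffle (length u + length v) (length v) (word_vector (u @ v @ r)))"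
  using assms
proof (induction v arbitrary: r rule: rev_induct)
  case Nil
  show ?case using leading_word_word_vector[of u r] by simp
next
  case (snoc a v)
  then show ?case
    using leading_word_shuffle[OF snoc.IH[of "a # r"]] by (simp add: add.commute del: shuffle.simps)
qed

section \<open>Single letters\<close>

primrec singles :: "nat list \<Rightarrow> nat set" where
  "singles [] = {}"
| "singles (x # xs) = {a \<in> singles xs. a < x} \<union> (if xs = [] \<or> hd xs < x then {x} else {})"

definition core :: "nat list \<Rightarrow> nat list" where
  "core w = filter (\<lambda>x. x \<notin> singles w) w"

lemma singles_subset: "singles w \<subseteq> set w"
  by (induction w) auto

lemma finite_singles [simp]: "finite (singles w)"
  using singles_subset finite_subset by blast

lemma set_core: "set (core w) = set w - singles w"
  by (auto simp: core_def)

lemma distinct_core: "distinct w \<Longrightarrow> distinct (core w)"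
  by (simp add: core_def)

lemma singles_le_hd: "a \<in> singles w \<Longrightarrow> a \<le> hd w"
  by (induction w) (auto split: if_splits)

lemma singles_ins: "a \<notin> set u \<Longrightarrow> singles (ins a u) = insert a (singles u)"
proof (induction u)
  case (Cons y u)
  show ?case
  proof (cases "a < y")
    case True
    have "ins a u = [] \<or> hd (ins a u) < y \<longleftrightarrow> u = [] \<or> hd u < y"
      using True by (cases u) auto
    then show ?thesis using True Cons by auto
  next
    case False
    then have "b < a" if "b \<in> singles (y # u)" for b
      using singles_le_hd[OF that] Cons.prems by simp
    then show ?thesis using False Cons.prems by auto
  qed
qed simp

lemma ins_remove1_single: "a \<in> singles w \<Longrightarrow> ins a (remove1 a w) = w"
proof (induction w)
  case (Cons x w)
  then show ?case by (cases w) (auto split: if_splits)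
qed simp

lemma singles_fold_ins: "distinct (u @ v) \<Longrightarrow> singles (fold ins v u) = set v \<union> singles u"
  by (induction v arbitrary: u) (auto simp: singles_ins)

lemma filter_ins: "\<not> P a \<Longrightarrow> filter P (ins a u) = filter P u"
  by (induction u) auto

lemma filter_fold_ins: "(\<And>x. x \<in> set v \<Longrightarrow> \<not> P x) \<Longrightarrow> filter P (fold ins v u) = filter P u"
  by (induction v arbitrary: u) (auto simp: filter_ins)

lemma core_fold_ins:
  assumes "distinct (u @ v)" "singles u = {}"
  shows "core (fold ins v u) = u"
proof -
  have "core (fold ins v u) = filter (\<lambda>x. x \<notin> set v) (fold ins v u)"
    using assms by (simp add: core_def singles_fold_ins)
  also have "\<dots> = u" using assms(1) by (subst filter_fold_ins) (auto simp: filter_id_conv)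
  finally show ?thesis .
qed

lemma fold_ins_core:
  assumes "distinct w" "distinct v" "set v = singles w"
  shows "fold ins v (core w) = w"
  using assms
proof (induction v arbitrary: w rule: rev_induct)
  case Nil
  then show ?case by (simp add: core_def)
next
  case (snoc a v)
  define u where "u = remove1 a w"
  have u: "distinct u" "a \<notin> set u" using snoc.prems(1) by (auto simp: u_def)
  have "a \<in> singles w" using snoc.prems(3) by auto
  then have w: "w = ins a u" unfolding u_def by (rule ins_remove1_single[symmetric])
  have singles: "singles w = insert a (singles u)" unfolding w by (rule singles_ins[OF u(2)])
  have "core w = filter (\<lambda>x. x \<notin> singles w) u" unfolding core_def singles by (simp add: w filter_ins)
  also have "\<dots> = core u" unfolding core_def singles using u(2) by (intro filter_cong) auto
  finally have "core w = core u" .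
  moreover have "set v = singles u"
    using snoc.prems u(2) singles singles_subset[of u] by auto
  ultimately show ?case using snoc.IH[of u] u(1) snoc.prems(2) by (simp add: w)
qed

lemma fold_ins_rev_sorted_singles_core:
  "distinct w \<Longrightarrow> fold ins (rev (sorted_list_of_set (singles w))) (core w) = w"
  by (simp add: fold_ins_core)

lemma singles_core:
  assumes "distinct w"
  shows "singles (core w) = {}"
proof -
  let ?v = "rev (sorted_list_of_set (singles w))"
  have "singles w = singles w \<union> singles (core w)"
    using singles_fold_ins[of "core w" ?v] assms
    by (simp add: fold_ins_core set_core distinct_core Int_Diff_disjoint Diff_disjoint inf_commute)
  then show ?thesis using singles_subset[of "core w"] by (auto simp: set_core)
qed

lemma length_core:
  assumes "distinct w"
  shows "length (core w) + card (singles w) = length w"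
proof -
  have "length (fold ins (rev (sorted_list_of_set (singles w))) (core w)) = length w"
    by (simp only: fold_ins_rev_sorted_singles_core[OF assms])
  then show ?thesis by simp
qed

section \<open>A triangular basis\<close>

lemma decreasing_rearrangement_induct:
  assumes swap: "\<And>as x y bs. x < y \<Longrightarrow> P (as @ y # x # bs) \<Longrightarrow> P (as @ x # y # bs)"
    and decreasing: "P (as @ foldr ins v [])"
  shows "P (as @ v)"
  using decreasing
proof (induction v arbitrary: as)
  case (Cons x v)
  have "P (as @ x # d)" if "P (as @ ins x d)" for as d
    using that
  proof (induction d arbitrary: as)
    case (Cons y d)
    then show ?case using Cons.IH[of "as @ [y]"] swap[of x y as d] by (auto split: if_splits)
  qed simp
  then show ?case using Cons.prems Cons.IH[of "as @ [x]"] by simp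
qed simp

lemma sorted_wrt_greater_ins:
  "sorted_wrt (>) u \<Longrightarrow> a \<notin> set u \<Longrightarrow> sorted_wrt (>) (ins a u)"
  by (induction u) auto

lemma foldr_ins_Nil:
  assumes "distinct v"
  shows "foldr ins v [] = rev (sorted_list_of_set (set v))"
proof -
  have set_foldr: "set (foldr ins v []) = set v" for v by (induction v) auto
  have "sorted_wrt (>) (foldr ins v [])"
    using assms by (induction v) (auto simp: set_foldr intro: sorted_wrt_greater_ins)
  then have "rev (foldr ins v []) = sorted_list_of_set (set v)"
    by (intro strict_sorted_equal) (simp_all add: sorted_wrt_rev set_foldr)
  then show ?thesis by (simp add: rev_swap)
qed

context word_action
begin

lemma multi_shuffle_rearrange:
  fixes u v r :: "nat list"
  assumes "distinct v"
  defines "B \<equiv> \<lambda>x. multi_shuffle (length u + length v) (length v) (word_vector (u @ x @ r))"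
  shows "B v \<in> funs.span {B (rev (sorted_list_of_set (set v)))}"
proof -
  let ?d = "rev (sorted_list_of_set (set v))"
  let ?P = "\<lambda>x. length x = length v \<longrightarrow> B x \<in> funs.span {B ?d}"
  have "?P ([] @ v)"
  proof (rule decreasing_rearrangement_induct[of ?P])
    fix as bs :: "nat list" and x y :: nat
    assume less: "x < y" and IH: "?P (as @ y # x # bs)"
    show "?P (as @ x # y # bs)"
    proof
      assume len: "length (as @ x # y # bs) = length v"
      let ?l = "Suc (length (u @ as))"
      have "word_vector (u @ (as @ x # y # bs) @ r) = hecke_op q ?l (word_vector ((u @ as) @ y # x # bs @ r))"
        using less by (subst hecke_op_word_vector) auto
      then have "B (as @ x # y # bs) = q *\<^sub>f B (as @ y # x # bs)"
        unfolding B_def using len by (subst multi_shuffle_gen[of _ _ ?l, symmetric]) auto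
      then show "B (as @ x # y # bs) \<in> funs.span {B ?d}" using IH len by (simp add: funs.span_scale)
    qed
  next
    show "?P ([] @ foldr ins v [])" by (simp add: foldr_ins_Nil[OF assms(1)] funs.span_base)
  qed
  then show ?thesis by simp
qed

definition shuffle_basis :: "nat list \<Rightarrow> nat list \<Rightarrow> (nat \<Rightarrow> nat) \<Rightarrow> 'k" where
  "shuffle_basis r w = multi_shuffle (length w) (card (singles w))
     (word_vector (core w @ rev (sorted_list_of_set (singles w)) @ r))"

lemma leading_word_shuffle_basis:
  assumes "distinct w"
  shows "leading_word w r (shuffle_basis r w)"
  using leading_word_multi_shuffle[of "core w" "rev (sorted_list_of_set (singles w))" r]
    fold_ins_core[OF assms, of "rev (sorted_list_of_set (singles w))"] length_core[OF assms]
  by (simp add: shuffle_basis_def set_core distinct_core[OF assms] Int_commute)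

lemma multi_shuffle_in_span_fold_ins:
  assumes "distinct (u @ v)" "singles u = {}"
  shows "multi_shuffle (length u + length v) (length v) (word_vector (u @ v @ r))
    \<in> funs.span {shuffle_basis r (fold ins v u)}"
proof -
  have "singles (fold ins v u) = set v" using assms by (simp add: singles_fold_ins)
  then have "shuffle_basis r (fold ins v u) = multi_shuffle (length u + length v) (length v)
      (word_vector (u @ rev (sorted_list_of_set (set v)) @ r))"
    using assms core_fold_ins[OF assms] by (simp add: shuffle_basis_def distinct_card add.commute)
  then show ?thesis using multi_shuffle_rearrange[of v u r] assms(1) by simp
qed

end

lemma lower_words_subset_permutations:
  "w \<in> permutations_of_set A \<Longrightarrow> lower_words w r \<subseteq> (\<lambda>x. word_vector (x @ r)) ` permutations_of_set A"
  unfolding lower_words_def permutations_of_set_def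
  using mset_eq_setD mset_eq_imp_distinct_iff by fast

lemma leading_word_in_span_permutations:
  assumes "leading_word w r f" "w \<in> permutations_of_set A"
  shows "f \<in> funs.span ((\<lambda>x. word_vector (x @ r)) ` permutations_of_set A)"
proof -
  obtain c g where "g \<in> funs.span (lower_words w r)" "f = c *\<^sub>f word_vector (w @ r) + g"
    using assms(1) by (auto simp: leading_word_def)
  then show ?thesis using assms(2) funs.span_mono[OF lower_words_subset_permutations[OF assms(2)]]
    by (auto intro!: funs.span_add funs.span_scale intro: funs.span_base)
qed

lemma word_vector_in_span_leading_words:
  assumes leading: "\<And>w. w \<in> permutations_of_set A \<Longrightarrow> leading_word w r (b w)"
    and "w \<in> permutations_of_set A"
  shows "word_vector (w @ r) \<in> funs.span (b ` permutations_of_set A)"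
  using assms(2)
proof (induction w rule: wf_induct_rule[OF wf_lex[OF wf_less_than]])
  case (1 w)
  let ?span = "funs.span (b ` permutations_of_set A)"
  obtain c g where c: "c \<noteq> 0" and g: "g \<in> funs.span (lower_words w r)"
    and b: "b w = c *\<^sub>f word_vector (w @ r) + g"
    using leading[OF 1(2)] by (auto simp: leading_word_def)
  have "lower_words w r \<subseteq> ?span"
    using 1 unfolding lower_words_def permutations_of_set_def
    by (auto dest: mset_eq_setD mset_eq_imp_distinct_iff)
  then have "g \<in> ?span" using g funs.span_minimal funs.subspace_span by blast
  then have "inverse c *\<^sub>f (b w - g) \<in> ?span"
    using 1(2) by (intro funs.span_scale funs.span_diff) (auto intro: funs.span_base)
  then show ?case using c by (simp add: b)
qed

lemma independent_word_vectors:
  assumes "finite X" "\<And>x. x \<in> X \<Longrightarrow> length x = n"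
  shows "inj_on (word_vector :: nat list \<Rightarrow> (nat \<Rightarrow> nat) \<Rightarrow> 'k::field) X"
    and "funs.independent ((word_vector :: nat list \<Rightarrow> (nat \<Rightarrow> nat) \<Rightarrow> 'k) ` X)"
proof -
  let ?e = "word_vector :: nat list \<Rightarrow> (nat \<Rightarrow> nat) \<Rightarrow> 'k"
  have eval: "?e x (pad y) = (if x = y then 1 else 0)" if "x \<in> X" "y \<in> X" for x y
    using that assms(2) pad_inject[of y x] by (auto simp: word_vector_def)
  show inj: "inj_on ?e X" by (rule inj_onI) (metis eval zero_neq_one)
  show "funs.independent (?e ` X)"
  proof (rule funs.independent_if_scalars_zero)
    fix c f assume zero: "(\<Sum>g\<in>?e ` X. c g *\<^sub>f g) = 0" and "f \<in> ?e ` X"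
    then obtain y where y: "y \<in> X" "f = ?e y" by auto
    have sum_apply: "(\<Sum>x\<in>X. g x) p = (\<Sum>x\<in>X. g x p)" for g :: "_ \<Rightarrow> (nat \<Rightarrow> nat) \<Rightarrow> 'k" and p
      using assms(1) by induction (simp_all add: plus_fun_apply zero_fun_apply)
    have "(\<Sum>x\<in>X. c (?e x) *\<^sub>f ?e x) (pad y) = (\<Sum>x\<in>X. if x = y then c f else 0)"
      unfolding sum_apply using y eval by (intro sum.cong) (auto simp: scale_fun_apply)
    then show "c f = 0"
      using zero y assms(1) by (simp add: sum.reindex[OF inj] zero_fun_apply)
  qed (use assms(1) in simp)
qed

context word_action
begin

lemma word_vector_in_span_shuffle_basis:
  "w \<in> permutations_of_set A \<Longrightarrow> word_vector (w @ r) \<in> funs.span (shuffle_basis r ` permutations_of_set A)"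
  by (rule word_vector_in_span_leading_words)
    (auto simp: permutations_of_set_def intro: leading_word_shuffle_basis)

lemma multi_shuffle_shuffle_basis_in_span:
  assumes "distinct (w @ v)"
  shows "multi_shuffle (length (w @ v)) (length v) (shuffle_basis (v @ r) w)
    \<in> funs.span (shuffle_basis r `
        {x \<in> permutations_of_set (set (w @ v)). length v \<le> card (singles x)})" (is "_ \<in> ?span")
proof -
  let ?s = "rev (sorted_list_of_set (singles w))"
  let ?x = "fold ins (?s @ v) (core w)"
  have w: "distinct w" using assms by simp
  have letters: "distinct (core w @ ?s @ v)" "set (core w) \<union> singles w = set w"
    using assms singles_subset[of w] by (auto simp: set_core distinct_core)
  have len: "length (?s @ v) = card (singles w) + length v" by simp
  have "singles ?x = set (?s @ v)"
    using singles_fold_ins[of "core w" "?s @ v"] letters(1) singles_core[OF w] by simp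
  then have "card (singles ?x) = card (singles w) + length v"
    unfolding len[symmetric] using letters(1) by (simp only: distinct_append distinct_card)
  then have "?x \<in> {x \<in> permutations_of_set (set (w @ v)). length v \<le> card (singles x)}"
    using letters by (auto simp: permutations_of_set_def)
  then have "funs.span {shuffle_basis r ?x} \<subseteq> ?span" by (intro funs.span_mono) auto
  moreover have "multi_shuffle (length (w @ v)) (length v) (shuffle_basis (v @ r) w)
      = multi_shuffle (length (core w) + length (?s @ v)) (length (?s @ v))
          (word_vector (core w @ (?s @ v) @ r))"
    using multi_shuffle_multi_shuffle[of "length (w @ v)" "length v" "card (singles w)"]
    by (simp add: shuffle_basis_def add.commute add.left_commute flip: length_core[OF w])
  ultimately show ?thesis
    using multi_shuffle_in_span_fold_ins[OF letters(1) singles_core[OF w], of r] by auto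
qed

lemma multi_shuffle_in_span_shuffle_basis:
  assumes "x \<in> permutations_of_set A"
  shows "multi_shuffle (length x) j (word_vector (x @ r))
    \<in> funs.span (shuffle_basis r ` {w \<in> permutations_of_set A. j \<le> card (singles w)})" (is "_ \<in> ?span")
proof (cases "j \<le> length x")
  case False
  then show ?thesis by (simp add: multi_shuffle_eq_0 funs.span_zero)
next
  case True
  define u v where "u = take (length x - j) x" and "v = drop (length x - j) x"
  have x: "x = u @ v" "length v = j" using True by (auto simp: u_def v_def)
  have A: "distinct (u @ v)" "A = set (u @ v)" using assms x by (auto simp: permutations_of_set_def)
  have "word_vector (u @ v @ r) \<in> funs.span (shuffle_basis (v @ r) ` permutations_of_set (set u))"
    using A by (intro word_vector_in_span_shuffle_basis) (auto simp: permutations_of_set_def)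
  then have "multi_shuffle (length x) j (word_vector (u @ v @ r)) \<in> ?span"
  proof (rule span_linear_image[OF linear_multi_shuffle])
    fix f assume "f \<in> shuffle_basis (v @ r) ` permutations_of_set (set u)"
    then obtain w where f: "f = shuffle_basis (v @ r) w" and w: "distinct w" "set w = set u"
      by (auto simp: permutations_of_set_def)
    have "length w = length u" using w A(1) by (metis distinct_append distinct_card)
    then show "multi_shuffle (length x) j f \<in> ?span"
      using multi_shuffle_shuffle_basis_in_span[of w v r] w A by (simp add: f x)
  qed
  then show ?thesis using x(1) by simp
qed

lemma shuffle_shuffle_basis:
  assumes "w \<in> permutations_of_set A"
  shows "shuffle (card A) (shuffle_basis r w) - q_bracket q (card (singles w)) *\<^sub>f shuffle_basis r w
    \<in> funs.span (shuffle_basis r ` {w' \<in> permutations_of_set A. card (singles w) < card (singles w')})"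
proof -
  let ?x = "core w @ rev (sorted_list_of_set (singles w))"
  have w: "distinct w" "set w = A" "card A = length w"
    using assms by (auto simp: permutations_of_set_def distinct_card)
  have x: "?x \<in> permutations_of_set A" "length ?x = length w"
    using w singles_subset[of w] length_core[of w]
    by (auto simp: permutations_of_set_def set_core distinct_core)
  have "shuffle (card A) (shuffle_basis r w) - q_bracket q (card (singles w)) *\<^sub>f shuffle_basis r w
      = q ^ (2 * card (singles w)) *\<^sub>f
          multi_shuffle (length w) (Suc (card (singles w))) (word_vector (?x @ r))"
    by (simp only: w(3) shuffle_basis_def shuffle_multi_shuffle add_diff_cancel_left' append_assoc)
  then show ?thesis
    using multi_shuffle_in_span_shuffle_basis[OF x(1), of "Suc (card (singles w))" r]
    by (simp only: x(2) Suc_le_eq funs.span_scale)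
qed

end

section \<open>Counting words by single letters\<close>

lemma sum_Pow_card:
  fixes h :: "nat \<Rightarrow> 'b::semiring_1"
  assumes "finite S"
  shows "(\<Sum>T\<in>Pow S. h (card T)) = (\<Sum>k\<le>card S. of_nat (card S choose k) * h k)"
proof -
  have "(\<Sum>T\<in>Pow S. h (card T)) = (\<Sum>k\<le>card S. \<Sum>T\<in>{T \<in> Pow S. card T = k}. h (card T))"
    by (rule sum.group[symmetric]) (use assms card_mono in auto)
  also have "\<dots> = (\<Sum>k\<le>card S. of_nat (card S choose k) * h k)"
    using n_subsets[OF assms] by (intro sum.cong) (simp_all add: Pow_def)
  finally show ?thesis .
qed

lemma derangement_sum:
  fixes D :: "'a set \<Rightarrow> real"
  assumes total: "\<And>T. finite T \<Longrightarrow> fact (card T) = (\<Sum>U\<in>Pow T. D U)" and "finite S"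
  shows "D S = fact (card S) * (\<Sum>i=0..card S. (- 1) ^ i / fact i)"
proof -
  let ?m = "card S"
  have "(- 1) ^ card S * D S = (\<Sum>T\<in>Pow S. (- 1) ^ card T * fact (card T))"
  proof (rule inclusion_exclusion_symmetric[OF _ \<open>finite S\<close>])
    fix T :: "'a set" assume "finite T"
    show "(fact (card T) :: real) = (\<Sum>U\<in>Pow T. (- 1) ^ card U * ((- 1) ^ card U * D U))"
      unfolding total[OF \<open>finite T\<close>] by (simp flip: mult.assoc power_add)
  qed
  also have "\<dots> = (\<Sum>k\<le>?m. of_nat (?m choose k) * ((- 1) ^ k * fact k))"
    using sum_Pow_card[OF \<open>finite S\<close>, of "\<lambda>k. (- 1) ^ k * fact k"] .
  also have "\<dots> = (\<Sum>k\<le>?m. fact ?m * ((- 1) ^ k / fact (?m - k)))"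
    by (rule sum.cong) (auto simp: binomial_fact field_simps)
  also have "\<dots> = (\<Sum>i\<le>?m. fact ?m * ((- 1) ^ (?m - i) / fact i))"
    by (rule sum.reindex_bij_witness[of _ "\<lambda>k. ?m - k" "\<lambda>k. ?m - k"]) auto
  also have "\<dots> = (- 1) ^ ?m * (fact ?m * (\<Sum>i\<le>?m. (- 1) ^ i / fact i))"
    unfolding sum_distrib_left by (rule sum.cong) (auto simp: minus_one_power_iff)
  finally show ?thesis by (simp add: atMost_atLeast0)
qed

locale fixed_point_statistic =
  fixes \<Omega> :: "'a set \<Rightarrow> 'x set" and fixed :: "'a set \<Rightarrow> 'x \<Rightarrow> 'a set"
  assumes finite_objects: "finite A \<Longrightarrow> finite (\<Omega> A)"
    and card_objects: "finite A \<Longrightarrow> card (\<Omega> A) = fact (card A)"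
    and fixed_subset: "x \<in> \<Omega> A \<Longrightarrow> fixed A x \<subseteq> A"
    and card_fixed_set: "finite A \<Longrightarrow> V \<subseteq> A \<Longrightarrow>
      card {x \<in> \<Omega> A. fixed A x = V} = card {x \<in> \<Omega> (A - V). fixed (A - V) x = {}}"
begin

lemma card_fixed_empty:
  assumes "finite A"
  shows "real (card {x \<in> \<Omega> A. fixed A x = {}}) = fact (card A) * (\<Sum>i=0..card A. (- 1) ^ i / fact i)"
proof (rule derangement_sum[OF _ assms])
  fix S :: "'a set" assume S: "finite S"
  have "card (\<Omega> S) = (\<Sum>V\<in>Pow S. card {x \<in> \<Omega> S. fixed S x = V})"
    using sum.group[of "\<Omega> S" "Pow S" "fixed S" "\<lambda>_. 1::nat"] S finite_objects[OF S] fixed_subset[of _ S]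
    by (simp add: image_subset_iff)
  also have "\<dots> = (\<Sum>V\<in>Pow S. card {x \<in> \<Omega> (S - V). fixed (S - V) x = {}})"
    using card_fixed_set[OF S] by (intro sum.cong) auto
  also have "\<dots> = (\<Sum>T\<in>Pow S. card {x \<in> \<Omega> T. fixed T x = {}})"
    by (rule sum.reindex_bij_witness[of _ "\<lambda>T. S - T" "\<lambda>T. S - T"]) (auto simp: double_diff)
  finally have "card (\<Omega> S) = (\<Sum>T\<in>Pow S. card {x \<in> \<Omega> T. fixed T x = {}})" .
  from arg_cong[OF this, of real]
  show "fact (card S) = (\<Sum>T\<in>Pow S. real (card {x \<in> \<Omega> T. fixed T x = {}}))"
    by (simp add: card_objects[OF S])
qed

lemma card_card_fixed:
  assumes A: "finite A" and "j \<le> card A"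
  shows "real (card {x \<in> \<Omega> A. card (fixed A x) = j})
    = fact (card A) / fact j * (\<Sum>i=0..card A - j. (- 1) ^ i / fact i)"
proof -
  let ?subsets = "{V. V \<subseteq> A \<and> card V = j}" and ?s = "\<Sum>i=0..card A - j. (- 1) ^ i / fact i :: real"
  have "card {x \<in> \<Omega> A. card (fixed A x) = j} = card (\<Union>V\<in>?subsets. {x \<in> \<Omega> A. fixed A x = V})"
    using fixed_subset by (intro arg_cong[of _ _ card]) blast
  also have "\<dots> = (\<Sum>V\<in>?subsets. card {x \<in> \<Omega> A. fixed A x = V})"
    using A finite_objects by (intro card_UN_disjoint) auto
  also have "\<dots> = (\<Sum>V\<in>?subsets. card {x \<in> \<Omega> (A - V). fixed (A - V) x = {}})"
    using card_fixed_set[OF A] by (intro sum.cong) auto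
  finally have "real (card {x \<in> \<Omega> A. card (fixed A x) = j})
      = (\<Sum>V\<in>?subsets. real (card {x \<in> \<Omega> (A - V). fixed (A - V) x = {}}))" by simp
  also have "\<dots> = (\<Sum>V\<in>?subsets. fact (card A - j) * ?s)"
    using A by (intro sum.cong) (auto simp: card_fixed_empty card_Diff_subset finite_subset)
  also have "\<dots> = of_nat (card A choose j) * (fact (card A - j) * ?s)"
    by (simp add: n_subsets[OF A])
  also have "\<dots> = fact (card A) / fact j * ?s"
    using assms(2) by (simp add: binomial_fact field_simps)
  finally show ?thesis .
qed

end

lemma permutes_fixed_points_eq_iff:
  assumes "V \<subseteq> A"
  shows "p permutes A \<and> {i \<in> A. p i = i} = V \<longleftrightarrow> p permutes (A - V) \<and> {i \<in> A - V. p i = i} = {}"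
proof
  assume "p permutes A \<and> {i \<in> A. p i = i} = V"
  then show "p permutes (A - V) \<and> {i \<in> A - V. p i = i} = {}"
    using permutes_superset[of p A "A - V"] by auto
next
  assume p: "p permutes (A - V) \<and> {i \<in> A - V. p i = i} = {}"
  then have "p i = i" if "i \<in> V" for i using that by (auto simp: permutes_not_in)
  then show "p permutes A \<and> {i \<in> A. p i = i} = V"
    using p assms permutes_subset[of p "A - V" A] by auto
qed

interpretation permutations: fixed_point_statistic "\<lambda>A. {p. p permutes A}" "\<lambda>A p. {i \<in> A. p i = i}"
  by unfold_locales
    (auto simp: finite_permutations card_permutations permutes_fixed_points_eq_iff)

lemma bij_betw_core:
  assumes "finite A" "V \<subseteq> A"
  shows "bij_betw core {w \<in> permutations_of_set A. singles w = V}
    {u \<in> permutations_of_set (A - V). singles u = {}}"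
proof (rule bij_betw_byWitness[where f' = "fold ins (sorted_list_of_set V)"])
  have V: "finite V" using assms finite_subset by blast
  show "\<forall>w\<in>{w \<in> permutations_of_set A. singles w = V}. fold ins (sorted_list_of_set V) (core w) = w"
    using V by (auto intro!: fold_ins_core dest: permutations_of_setD)
  show "\<forall>u\<in>{u \<in> permutations_of_set (A - V). singles u = {}}.
      core (fold ins (sorted_list_of_set V) u) = u"
    using V by (auto simp: permutations_of_set_def intro!: core_fold_ins)
  show "core ` {w \<in> permutations_of_set A. singles w = V}
      \<subseteq> {u \<in> permutations_of_set (A - V). singles u = {}}"
    by (auto simp: permutations_of_set_def singles_core set_core distinct_core)
  show "fold ins (sorted_list_of_set V) ` {u \<in> permutations_of_set (A - V). singles u = {}}
      \<subseteq> {w \<in> permutations_of_set A. singles w = V}"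
    using V assms(2) singles_fold_ins[of _ "sorted_list_of_set V"]
    by (fastforce simp: permutations_of_set_def)
qed

interpretation words: fixed_point_statistic permutations_of_set "\<lambda>_. singles"
proof unfold_locales
  show "card {w \<in> permutations_of_set A. singles w = V}
      = card {w \<in> permutations_of_set (A - V). singles w = {}}"
    if "finite A" "V \<subseteq> A" for A V
    using bij_betw_core[OF that] by (rule bij_betw_same_card)
qed (use singles_subset in \<open>auto dest: permutations_of_setD\<close>)

section \<open>Reduced words\<close>

text \<open>The product of generators that turns the decreasing word into \<open>xs\<close>: the first letter \<open>x\<close> is
  brought to the front past the larger ones, then the tail is arranged.\<close>

fun red_word :: "nat list \<Rightarrow> nat list" where
  "red_word [] = []"
| "red_word (x # ys) = map Suc (red_word ys) @ [1..<Suc (length (filter ((<) x) ys))]"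

lemma red_word_bound: "i \<in> set (red_word xs) \<Longrightarrow> 1 \<le> i \<and> i < length xs"
proof (induction xs arbitrary: i)
  case (Cons x ys)
  have "i < length (x # ys)" if "i < Suc (length (filter ((<) x) ys))"
    using that length_filter_le[of "(<) x" ys] unfolding list.size by linarith
  then show ?case using Cons.prems by (auto dest: Cons.IH simp del: upt_Suc)
qed simp

lemma red_word_decreasing: "sorted_wrt (>) xs \<Longrightarrow> red_word xs = []"
proof (induction xs)
  case (Cons x xs)
  then have "filter ((<) x) xs = []" by (auto simp: filter_empty_conv)
  then show ?case using Cons by simp
qed simp

locale braid_action =
  fixes n :: nat and C :: "'v set" and \<tau> :: "nat \<Rightarrow> 'v \<Rightarrow> 'v"
  assumes closed: "1 \<le> i \<Longrightarrow> i < n \<Longrightarrow> z \<in> C \<Longrightarrow> \<tau> i z \<in> C"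
    and braid: "1 \<le> i \<Longrightarrow> Suc i < n \<Longrightarrow> z \<in> C \<Longrightarrow> \<tau> i (\<tau> (Suc i) (\<tau> i z)) = \<tau> (Suc i) (\<tau> i (\<tau> (Suc i) z))"
    and commute: "1 \<le> i \<Longrightarrow> Suc i < j \<Longrightarrow> j < n \<Longrightarrow> z \<in> C \<Longrightarrow> \<tau> i (\<tau> j z) = \<tau> j (\<tau> i z)"
begin

lemma braid_action_shift: "braid_action (n - 1) C (\<lambda>i. \<tau> (Suc i))"
proof
  show "\<tau> (Suc i) (\<tau> (Suc j) z) = \<tau> (Suc j) (\<tau> (Suc i) z)"
    if "1 \<le> i" "Suc i < j" "j < n - 1" "z \<in> C" for i j z
    using that by (intro commute) auto
qed (simp_all add: closed braid)

lemma foldr_closed: "(\<And>i. i \<in> set ws \<Longrightarrow> 1 \<le> i \<and> i < n) \<Longrightarrow> z \<in> C \<Longrightarrow> foldr \<tau> ws z \<in> C"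
  by (induction ws) (simp_all add: closed)

lemma foldr_commute:
  assumes "z \<in> C" "1 \<le> j" "j < n" "\<And>i. i \<in> set ws \<Longrightarrow> 1 \<le> i \<and> i < n \<and> (Suc i < j \<or> Suc j < i)"
  shows "foldr \<tau> ws (\<tau> j z) = \<tau> j (foldr \<tau> ws z)"
  using assms(4)
proof (induction ws)
  case (Cons i ws)
  have z: "foldr \<tau> ws z \<in> C" using Cons.prems assms(1) by (intro foldr_closed) auto
  have "1 \<le> i" "i < n" "Suc i < j \<or> Suc j < i" using Cons.prems[of i] by auto
  then have "\<tau> i (\<tau> j (foldr \<tau> ws z)) = \<tau> j (\<tau> i (foldr \<tau> ws z))"
    using commute[of i j] commute[of j i] assms(2,3) z by metis
  then show ?case using Cons by simp
qed simp

lemma foldr_upt_gen: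
  assumes "z \<in> C" "1 \<le> l" "l \<le> j" "Suc j < m" "m \<le> n"
  shows "foldr \<tau> [l..<m] (\<tau> j z) = \<tau> (Suc j) (foldr \<tau> [l..<m] z)"
proof -
  have upt: "[l..<m] = [l..<j] @ j # Suc j # [Suc (Suc j)..<m]"
    using assms upt_add_eq_append[of l j "m - j"]
    by (simp add: upt_conv_Cons[of j] upt_conv_Cons[of "Suc j"] del: upt_Suc)
  let ?z = "foldr \<tau> [Suc (Suc j)..<m] z"
  have z: "?z \<in> C" using assms by (intro foldr_closed) auto
  have "foldr \<tau> [Suc (Suc j)..<m] (\<tau> j z) = \<tau> j ?z"
    using assms by (intro foldr_commute) auto
  then have "foldr \<tau> [l..<m] (\<tau> j z) = foldr \<tau> [l..<j] (\<tau> j (\<tau> (Suc j) (\<tau> j ?z)))"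
    unfolding upt by simp
  also have "\<dots> = foldr \<tau> [l..<j] (\<tau> (Suc j) (\<tau> j (\<tau> (Suc j) ?z)))"
    using braid[of j ?z] z assms by simp
  also have "\<dots> = \<tau> (Suc j) (foldr \<tau> [l..<j] (\<tau> j (\<tau> (Suc j) ?z)))"
    using assms z closed by (intro foldr_commute) auto
  finally show ?thesis unfolding upt by simp
qed

lemma foldr_upt_foldr_upt:
  assumes "z \<in> C" "a \<le> b" "Suc (Suc b) \<le> n"
  shows "foldr \<tau> [1..<Suc (Suc b)] (foldr \<tau> [1..<Suc a] z)
    = foldr \<tau> [2..<Suc (Suc a)] (foldr \<tau> [1..<Suc (Suc b)] z)"
  using assms(1,2)
proof (induction a arbitrary: z)
  case (Suc a)
  have "foldr \<tau> [1..<Suc (Suc b)] (foldr \<tau> [1..<Suc (Suc a)] z)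
      = foldr \<tau> [1..<Suc (Suc b)] (foldr \<tau> [1..<Suc a] (\<tau> (Suc a) z))" by simp
  also have "\<dots> = foldr \<tau> [2..<Suc (Suc a)] (foldr \<tau> [1..<Suc (Suc b)] (\<tau> (Suc a) z))"
    using Suc assms(3) closed by simp
  also have "foldr \<tau> [1..<Suc (Suc b)] (\<tau> (Suc a) z) = \<tau> (Suc (Suc a)) (foldr \<tau> [1..<Suc (Suc b)] z)"
    using Suc assms(3) by (intro foldr_upt_gen) auto
  finally show ?case by simp
qed simp

lemma foldr_red_word_swap_hd:
  assumes "z \<in> C" "length (x # y # bs) \<le> n" "y < x"
  shows "\<tau> 1 (foldr \<tau> (red_word (x # y # bs)) z) = foldr \<tau> (red_word (y # x # bs)) z"
proof -
  define a b where "a = length (filter ((<) x) bs)" and "b = length (filter ((<) y) bs)"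
  have "filter ((<) x) bs = filter ((<) x) (filter ((<) y) bs)"
    unfolding filter_filter using assms(3) by (intro filter_cong) auto
  then have ab: "a \<le> b" using length_filter_le unfolding a_def b_def by metis
  have bn: "Suc (Suc b) \<le> n" 
    using length_filter_le[of "(<) y" bs] assms(2) unfolding b_def list.size by linarith
  let ?ws = "map Suc (map Suc (red_word bs))"
  have red_word_xy: "red_word (x # y # bs) = ?ws @ [2..<Suc (Suc b)] @ [1..<Suc a]"
    and red_word_yx: "red_word (y # x # bs) = ?ws @ [2..<Suc (Suc a)] @ [1..<Suc (Suc b)]"
    using assms(3) by (simp_all add: a_def b_def map_Suc_upt numeral_2_eq_2 del: upt_Suc)
  let ?z = "foldr \<tau> [2..<Suc (Suc b)] (foldr \<tau> [1..<Suc a] z)"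
  have z: "?z \<in> C" using ab bn assms(1) by (intro foldr_closed) auto
  have "\<tau> 1 (foldr \<tau> (red_word (x # y # bs)) z) = \<tau> 1 (foldr \<tau> ?ws ?z)" unfolding red_word_xy by simp
  also have "\<dots> = foldr \<tau> ?ws (\<tau> 1 ?z)"
  proof (rule foldr_commute[OF z, symmetric])
    fix i assume "i \<in> set ?ws"
    then obtain k where "k \<in> set (red_word bs)" "i = Suc (Suc k)" by auto
    then show "1 \<le> i \<and> i < n \<and> (Suc i < 1 \<or> Suc 1 < i)"
      using red_word_bound[of k bs] assms(2) by auto
  qed (use bn in auto)
  also have "\<tau> 1 ?z = foldr \<tau> [1..<Suc (Suc b)] (foldr \<tau> [1..<Suc a] z)"
    by (subst upt_conv_Cons[of 1 "Suc (Suc b)"]) (simp_all add: numeral_2_eq_2 del: upt_Suc)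
  also have "\<dots> = foldr \<tau> [2..<Suc (Suc a)] (foldr \<tau> [1..<Suc (Suc b)] z)"
    by (rule foldr_upt_foldr_upt[OF assms(1) ab bn])
  also have "foldr \<tau> ?ws \<dots> = foldr \<tau> (red_word (y # x # bs)) z" unfolding red_word_yx by simp
  finally show ?thesis .
qed

end

lemma foldr_red_word_swap:
  assumes "braid_action n C \<tau>" "z \<in> C" "length (as @ x # y # bs) \<le> n" "y < x"
  shows "\<tau> (Suc (length as)) (foldr \<tau> (red_word (as @ x # y # bs)) z)
    = foldr \<tau> (red_word (as @ y # x # bs)) z"
  using assms
proof (induction as arbitrary: n \<tau> z)
  case Nil
  then show ?case using braid_action.foldr_red_word_swap_hd[of n C \<tau> z x y bs] by simp
next
  case (Cons t as)
  interpret braid_action n C \<tau> by (rule Cons.prems(1))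
  let ?m = "length (filter ((<) t) (as @ x # y # bs))"
  let ?z = "foldr \<tau> [1..<Suc ?m] z"
  have red_word_Cons: "foldr \<tau> (red_word (t # xs)) z = foldr (\<lambda>i. \<tau> (Suc i)) (red_word xs) ?z"
    if "mset xs = mset (as @ x # y # bs)" for xs
  proof -
    have "length (filter ((<) t) xs) = ?m" using that by (metis mset_filter size_mset)
    then show ?thesis by (simp add: foldr_map o_def del: upt_Suc)
  qed
  have "?m < n" using length_filter_le[of "(<) t" "as @ x # y # bs"] Cons.prems(3) by simp
  then have "?z \<in> C" using Cons.prems(2) by (intro foldr_closed) (auto simp del: upt_Suc)
  then have "\<tau> (Suc (Suc (length as))) (foldr (\<lambda>i. \<tau> (Suc i)) (red_word (as @ x # y # bs)) ?z)
     = foldr (\<lambda>i. \<tau> (Suc i)) (red_word (as @ y # x # bs)) ?z"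
    using Cons.prems by (intro Cons.IH[OF braid_action_shift]) auto
  then show ?case
    using red_word_Cons[of "as @ x # y # bs"] red_word_Cons[of "as @ y # x # bs"] by simp
qed

section \<open>Hecke algebras and their representations\<close>

text \<open>Keeps \<open>{1..<n}\<close> in the form in which it occurs in the presentation of the braid group.\<close>

declare One_nat_def [simp del]

locale hecke =
  fixes n :: nat and q :: "'k::field"
  assumes q_nonzero: "q \<noteq> 0"
begin

abbreviation "B \<equiv> braid_group n"
abbreviation "BA \<equiv> (braid_algebra n :: ('k, nat gword set \<Rightarrow> 'k) module)"
abbreviation "H \<equiv> hecke_algebra n q"
abbreviation "braid_words \<equiv> gwords {1..<n}"
abbreviation "\<delta> u \<equiv>
  (group_algebra_elem (pres_class {1..<n} (braid_relations n) u) :: nat gword set \<Rightarrow> 'k)"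

sublocale B: monoid B
  unfolding braid_group_def by (rule monoid_presented_group)

sublocale BA: ring BA
  unfolding braid_algebra_def by (rule B.ring_group_algebra)

lemmas BA_smult_closed = group_algebra_smult_closed[of _ B, folded braid_algebra_def]

lemma carrier_B: "carrier B = pres_class {1..<n} (braid_relations n) ` braid_words"
  by (simp add: braid_group_def presented_group_carrier)

lemma delta_closed: "u \<in> braid_words \<Longrightarrow> \<delta> u \<in> carrier BA"
  unfolding braid_algebra_def by (rule group_algebra_elem_closed) (simp add: carrier_B)

lemma delta_mult: "u \<in> braid_words \<Longrightarrow> v \<in> braid_words \<Longrightarrow> \<delta> u \<otimes>\<^bsub>BA\<^esub> \<delta> v = \<delta> (u @ v)"
  by (simp add: braid_algebra_def B.group_algebra_elem_mult carrier_B)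
    (simp add: braid_group_def presented_group_mult)

lemma delta_cong: "(u, v) \<in> pres_cong {1..<n} (braid_relations n) \<Longrightarrow> \<delta> u = \<delta> v"
  by (simp only: pres_class_eqI)

lemma one_BA: "\<one>\<^bsub>BA\<^esub> = \<delta> []"
  by (simp add: braid_algebra_def group_algebra_simps braid_group_def presented_group_one)

abbreviation quadratic_relator :: "nat \<Rightarrow> nat gword set \<Rightarrow> 'k" where
  "quadratic_relator i \<equiv> (\<delta> [(i, True)] \<otimes>\<^bsub>BA\<^esub> \<delta> [(i, True)]) \<ominus>\<^bsub>BA\<^esub>
        (((q - inverse q) \<odot>\<^bsub>BA\<^esub> \<delta> [(i, True)]) \<oplus>\<^bsub>BA\<^esub> \<one>\<^bsub>BA\<^esub>)"

lemma hecke_ideal_eq: "hecke_ideal n q = Idl\<^bsub>BA\<^esub> (quadratic_relator ` {1..<n})"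
  by (simp add: hecke_ideal_def braid_gen_def Let_def)

lemma quadratic_relator_closed: "i \<in> {1..<n} \<Longrightarrow> quadratic_relator i \<in> carrier BA"
  by (simp add: delta_closed BA_smult_closed)

lemma quadratic_relator_add:
  assumes "i \<in> {1..<n}"
  shows "\<delta> [(i, True)] \<otimes>\<^bsub>BA\<^esub> \<delta> [(i, True)]
    = quadratic_relator i \<oplus>\<^bsub>BA\<^esub> (((q - inverse q) \<odot>\<^bsub>BA\<^esub> \<delta> [(i, True)]) \<oplus>\<^bsub>BA\<^esub> \<one>\<^bsub>BA\<^esub>)"
  using assms by (simp add: delta_closed BA_smult_closed BA.minus_eq BA.a_assoc BA.l_neg)

sublocale quotient_algebra BA "hecke_ideal n q"
  rewrites "quot_algebra BA (hecke_ideal n q) = H"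
proof -
  show "quotient_algebra BA (hecke_ideal n q)"
  proof (rule quotient_algebra.intro)
    show "Module.module class_ring BA" unfolding braid_algebra_def by (rule B.module_group_algebra)
    show "ideal (hecke_ideal n q) BA" unfolding hecke_ideal_eq
      using quadratic_relator_closed by (intro BA.genideal_ideal) auto
  qed (simp_all add: braid_algebra_def B.ring_group_algebra B.group_algebra_smult_mult
      B.group_algebra_mult_smult)
qed (simp add: hecke_algebra_def)

sublocale H: ring H by (rule ring_Q)

sublocale H: class_vectorspace H
  unfolding class_vectorspace_def vectorspace_def using module_Q class_field by blast

abbreviation "gen i \<equiv> hecke_gen n q i"

lemma gen_eq: "gen i = proj (\<delta> [(i, True)])"
  by (simp add: hecke_gen_def braid_gen_def)

lemma gen_closed: "i \<in> {1..<n} \<Longrightarrow> gen i \<in> carrier H"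
  unfolding gen_eq by (intro proj_closed delta_closed) simp

lemma proj_delta_mult:
  "u \<in> braid_words \<Longrightarrow> v \<in> braid_words \<Longrightarrow> proj (\<delta> u) \<otimes>\<^bsub>H\<^esub> proj (\<delta> v) = proj (\<delta> (u @ v))"
  by (simp add: proj_mult delta_closed delta_mult)

lemma hecke_gen_quadratic:
  assumes i: "i \<in> {1..<n}"
  shows "gen i \<otimes>\<^bsub>H\<^esub> gen i = ((q - inverse q) \<odot>\<^bsub>H\<^esub> gen i) \<oplus>\<^bsub>H\<^esub> \<one>\<^bsub>H\<^esub>"
proof -
  let ?s = "\<delta> [(i, True)]"
  let ?rhs = "((q - inverse q) \<odot>\<^bsub>BA\<^esub> ?s) \<oplus>\<^bsub>BA\<^esub> \<one>\<^bsub>BA\<^esub>"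
  have s: "?s \<in> carrier BA" and rhs: "?rhs \<in> carrier BA"
    using i by (simp_all add: delta_closed BA_smult_closed)
  have relator: "proj (quadratic_relator i) = \<zero>\<^bsub>H\<^esub>"
  proof (rule proj_ideal)
    show "quadratic_relator i \<in> hecke_ideal n q" unfolding hecke_ideal_eq
      using BA.genideal_self[of "quadratic_relator ` {1..<n}"] quadratic_relator_closed i by blast
  qed
  have "gen i \<otimes>\<^bsub>H\<^esub> gen i = proj (?s \<otimes>\<^bsub>BA\<^esub> ?s)" unfolding gen_eq by (rule proj_mult[OF s s])
  also have "\<dots> = proj (quadratic_relator i) \<oplus>\<^bsub>H\<^esub> proj ?rhs"
    unfolding proj_add[OF quadratic_relator_closed[OF i] rhs]
    using quadratic_relator_add[OF i] by (rule arg_cong)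
  also have "\<dots> = proj ?rhs" unfolding relator by (rule H.l_zero[OF proj_closed[OF rhs]])
  also have "\<dots> = ((q - inverse q) \<odot>\<^bsub>H\<^esub> gen i) \<oplus>\<^bsub>H\<^esub> \<one>\<^bsub>H\<^esub>"
    using s by (simp add: gen_eq proj_one proj_smult BA_smult_closed proj_closed flip: proj_add)
  finally show ?thesis .
qed

lemma hecke_gen_braid:
  assumes "1 \<le> i" "Suc i < n"
  shows "gen i \<otimes>\<^bsub>H\<^esub> (gen (Suc i) \<otimes>\<^bsub>H\<^esub> gen i) = gen (Suc i) \<otimes>\<^bsub>H\<^esub> (gen i \<otimes>\<^bsub>H\<^esub> gen (Suc i))"
proof -
  have "([(i, True), (Suc i, True), (i, True)], [(Suc i, True), (i, True), (Suc i, True)])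
      \<in> braid_relations n"
    unfolding braid_relations_def using assms by auto
  then have "\<delta> [(i, True), (Suc i, True), (i, True)] = \<delta> [(Suc i, True), (i, True), (Suc i, True)]"
    using assms by (intro delta_cong pres_rel) auto
  then show ?thesis using assms by (simp add: gen_eq proj_delta_mult)
qed

lemma hecke_gen_commute:
  assumes "1 \<le> i" "Suc i < j" "j < n"
  shows "gen i \<otimes>\<^bsub>H\<^esub> gen j = gen j \<otimes>\<^bsub>H\<^esub> gen i"
proof -
  have "([(i, True), (j, True)], [(j, True), (i, True)]) \<in> braid_relations n"
    unfolding braid_relations_def using assms by auto
  then have "\<delta> [(i, True), (j, True)] = \<delta> [(j, True), (i, True)]"
    using assms by (intro delta_cong pres_rel) auto
  then show ?thesis using assms by (simp add: gen_eq proj_delta_mult)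
qed

lemma hecke_gen_inverse:
  assumes i: "i \<in> {1..<n}"
  shows "proj (\<delta> [(i, False)]) = gen i \<ominus>\<^bsub>H\<^esub> (q - inverse q) \<odot>\<^bsub>H\<^esub> \<one>\<^bsub>H\<^esub>"
proof -
  let ?t = "proj (\<delta> [(i, False)])" and ?c = "(q - inverse q) \<odot>\<^bsub>H\<^esub> \<one>\<^bsub>H\<^esub>"
  have t: "?t \<in> carrier H" and s: "gen i \<in> carrier H" and c: "?c \<in> carrier H"
    using i proj_closed delta_closed gen_closed H.smult_closed by simp_all
  have "\<delta> [(i, False), (i, True)] = \<delta> []"
    using pres_cancel[of i "{1..<n}" False "braid_relations n"] i by (intro delta_cong) simp
  then have ts: "?t \<otimes>\<^bsub>H\<^esub> gen i = \<one>\<^bsub>H\<^esub>"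
    using i by (simp add: gen_eq proj_delta_mult proj_one one_BA)
  have "gen i = ?t \<otimes>\<^bsub>H\<^esub> (gen i \<otimes>\<^bsub>H\<^esub> gen i)" using ts t s by (simp flip: H.m_assoc)
  also have "\<dots> = ?c \<oplus>\<^bsub>H\<^esub> ?t"
    unfolding hecke_gen_quadratic[OF i] using t s by (simp add: H.r_distr H.smult_closed Q_mult_smult ts)
  finally have "gen i \<ominus>\<^bsub>H\<^esub> ?c = (?c \<oplus>\<^bsub>H\<^esub> ?t) \<ominus>\<^bsub>H\<^esub> ?c" by simp
  also have "\<dots> = ?t"
    using t c by (simp add: a_minus_def H.a_comm[of ?c ?t] H.a_assoc H.r_neg)
  finally show ?thesis by simp
qed

lemma proj_delta_Cons:
  assumes i: "i \<in> {1..<n}" and u: "u \<in> braid_words"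
  shows "proj (\<delta> ((i, s) # u)) = (if s then gen i \<otimes>\<^bsub>H\<^esub> proj (\<delta> u)
    else gen i \<otimes>\<^bsub>H\<^esub> proj (\<delta> u) \<oplus>\<^bsub>H\<^esub> (- (q - inverse q)) \<odot>\<^bsub>H\<^esub> proj (\<delta> u))"
proof -
  have "proj (\<delta> ((i, s) # u)) = proj (\<delta> [(i, s)]) \<otimes>\<^bsub>H\<^esub> proj (\<delta> u)"
    using proj_delta_mult[of "[(i, s)]" u] i u by simp
  moreover have "proj (\<delta> u) \<in> carrier H" using u by (intro proj_closed delta_closed)
  ultimately show ?thesis
    using gen_closed[OF i] by (simp add: gen_eq[symmetric] hecke_gen_inverse[OF i] H.smult_closed
        a_minus_def H.l_distr H.l_minus Q_smult_mult H.uminus_smult)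
qed

lemma hecke_induct [consumes 1, case_names one add smult gen]:
  assumes x: "x \<in> carrier H"
    and one: "P \<one>\<^bsub>H\<^esub>"
    and add: "\<And>x y. x \<in> carrier H \<Longrightarrow> y \<in> carrier H \<Longrightarrow> P x \<Longrightarrow> P y \<Longrightarrow> P (x \<oplus>\<^bsub>H\<^esub> y)"
    and smult: "\<And>c x. x \<in> carrier H \<Longrightarrow> P x \<Longrightarrow> P (c \<odot>\<^bsub>H\<^esub> x)"
    and gen: "\<And>i x. i \<in> {1..<n} \<Longrightarrow> x \<in> carrier H \<Longrightarrow> P x \<Longrightarrow> P (gen i \<otimes>\<^bsub>H\<^esub> x)"
  shows "P x"
proof -
  have word: "P (proj (\<delta> u))" if "u \<in> braid_words" for u
    using that
  proof (induction u)
    case Nil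
    then show ?case using one by (simp add: proj_one one_BA)
  next
    case (Cons l u)
    obtain i s where l: "l = (i, s)" by fastforce
    have i: "i \<in> {1..<n}" and u: "u \<in> braid_words" using Cons.prems l by auto
    have x: "proj (\<delta> u) \<in> carrier H" "P (proj (\<delta> u))" using Cons.IH u proj_closed delta_closed by auto
    show ?case
      using gen[OF i x] smult[OF x] gen_closed[OF i] x(1) H.smult_closed
      unfolding l proj_delta_Cons[OF i u] by (simp add: add)
  qed
  obtain f where f: "f \<in> carrier BA" "x = proj f" using x by (auto simp: carrier_Q)
  have "f \<in> carrier (group_algebra B)" using f by (simp add: braid_algebra_def)
  then have "P (proj f)"
  proof (induction rule: B.group_algebra_induct)
    case (add f f')
    then have "f \<in> carrier BA" "f' \<in> carrier BA" by (simp_all add: braid_algebra_def)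
    then show ?case using assms(3)[OF proj_closed proj_closed add(3,4)] proj_add[of f f']
      by (simp add: braid_algebra_def)
  next
    case (elem c g)
    then obtain u where u: "u \<in> braid_words" "g = pres_class {1..<n} (braid_relations n) u"
      by (auto simp: carrier_B)
    then show ?case using smult[OF proj_closed[OF delta_closed[OF u(1)]] word[OF u(1)], of c]
      by (simp add: proj_smult delta_closed flip: braid_algebra_def)
  qed
  then show ?thesis using f by simp
qed

sublocale left_mult_gen: braid_action n "carrier H" "\<lambda>i x. gen i \<otimes>\<^bsub>H\<^esub> x"
proof
  show "gen i \<otimes>\<^bsub>H\<^esub> x \<in> carrier H" if "1 \<le> i" "i < n" "x \<in> carrier H" for i x
    using that gen_closed[of i] by simp
  show "gen i \<otimes>\<^bsub>H\<^esub> (gen (Suc i) \<otimes>\<^bsub>H\<^esub> (gen i \<otimes>\<^bsub>H\<^esub> x))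
      = gen (Suc i) \<otimes>\<^bsub>H\<^esub> (gen i \<otimes>\<^bsub>H\<^esub> (gen (Suc i) \<otimes>\<^bsub>H\<^esub> x))"
    if "1 \<le> i" "Suc i < n" "x \<in> carrier H" for i x
  proof -
    have "gen i \<in> carrier H" "gen (Suc i) \<in> carrier H" using that gen_closed by auto
    then show ?thesis using hecke_gen_braid[OF that(1,2)] that(3) by (metis H.m_assoc H.m_closed)
  qed
  show "gen i \<otimes>\<^bsub>H\<^esub> (gen j \<otimes>\<^bsub>H\<^esub> x) = gen j \<otimes>\<^bsub>H\<^esub> (gen i \<otimes>\<^bsub>H\<^esub> x)"
    if "1 \<le> i" "Suc i < j" "j < n" "x \<in> carrier H" for i j x
  proof -
    have "gen i \<in> carrier H" "gen j \<in> carrier H" using that gen_closed by auto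
    then show ?thesis using hecke_gen_commute[OF that(1-3)] that(4) by (metis H.m_assoc)
  qed
qed

abbreviation "gen_prod ws \<equiv> foldr (\<lambda>i x. gen i \<otimes>\<^bsub>H\<^esub> x) ws \<one>\<^bsub>H\<^esub>"

lemma gen_prod_closed: "(\<And>i. i \<in> set ws \<Longrightarrow> 1 \<le> i \<and> i < n) \<Longrightarrow> gen_prod ws \<in> carrier H"
  by (rule left_mult_gen.foldr_closed) simp_all

lemma additive_shuffle_closed: "additive_shuffle n q \<in> carrier H"
  unfolding additive_shuffle_def
  by (intro H.finsum_closed) (auto intro!: H.smult_closed gen_prod_closed)

lemma shuffle_operator_module_hom: "shuffle_operator n q \<in> H.endomorphisms"
  unfolding shuffle_operator_def by (rule left_mult_module_hom[OF additive_shuffle_closed])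

subsection \<open>The standard basis\<close>

abbreviation "perms \<equiv> permutations_of_set {1..n}"

definition T :: "nat list \<Rightarrow> (nat gword set \<Rightarrow> 'k) set" where
  "T xs = gen_prod (red_word xs)"

lemma length_perms: "xs \<in> perms \<Longrightarrow> length xs = n"
  using length_finite_permutations_of_set[of xs "{1..n}"] by simp

lemma T_closed: "xs \<in> perms \<Longrightarrow> T xs \<in> carrier H"
  unfolding T_def by (intro gen_prod_closed) (use red_word_bound length_perms in metis)

lemma T_decreasing: "T (rev (sorted_list_of_set {1..n})) = \<one>\<^bsub>H\<^esub>"
  using red_word_decreasing[of "rev (sorted_list_of_set {1..n})"] by (simp add: T_def sorted_wrt_rev)

lemma T_swap:
  assumes "as @ x # y # bs \<in> perms" "y < x"
  shows "gen (Suc (length as)) \<otimes>\<^bsub>H\<^esub> T (as @ x # y # bs) = T (as @ y # x # bs)"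
  unfolding T_def using length_perms[OF assms(1)] assms(2)
  by (intro foldr_red_word_swap[OF left_mult_gen.braid_action_axioms]) auto

lemma gen_T_in_span:
  assumes i: "i \<in> {1..<n}" and xs: "xs \<in> perms"
  shows "gen i \<otimes>\<^bsub>H\<^esub> T xs \<in> H.span (T ` perms)"
proof -
  have closed: "T ` perms \<subseteq> carrier H" using T_closed by blast
  obtain as x y bs where xs_eq: "xs = as @ x # y # bs" and i_eq: "i = Suc (length as)"
  proof
    have "Suc (i - 1) = i" "i < length xs" using i length_perms[OF xs] by auto
    then show "xs = take (i - 1) xs @ xs ! (i - 1) # xs ! i # drop (Suc i) xs"
      using id_take_nth_drop[of "i - 1" xs] Cons_nth_drop_Suc[of i xs] by simp
    show "i = Suc (length (take (i - 1) xs))" using i length_perms[OF xs] by (auto simp: min_def)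
  qed
  let ?ys = "as @ y # x # bs"
  have ys: "?ys \<in> perms" and "x \<noteq> y" using xs by (auto simp: xs_eq permutations_of_set_def)
  have span: "T xs \<in> H.span (T ` perms)" "T ?ys \<in> H.span (T ` perms)"
    using xs ys H.in_own_span[OF closed] by auto
  from \<open>x \<noteq> y\<close> consider "y < x" | "x < y" by linarith
  then show ?thesis
  proof cases
    case 1
    then show ?thesis using T_swap[of as x y bs] xs span(2) by (simp add: xs_eq i_eq)
  next
    case 2
    have T_xs: "T xs = gen i \<otimes>\<^bsub>H\<^esub> T ?ys" using T_swap[of as y x bs] ys 2 by (simp add: xs_eq i_eq)
    have "gen i \<otimes>\<^bsub>H\<^esub> T xs = (gen i \<otimes>\<^bsub>H\<^esub> gen i) \<otimes>\<^bsub>H\<^esub> T ?ys"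
      using gen_closed[OF i] T_closed[OF ys] by (simp add: T_xs H.m_assoc)
    also have "\<dots> = ((q - inverse q) \<odot>\<^bsub>H\<^esub> T xs) \<oplus>\<^bsub>H\<^esub> T ?ys"
      unfolding hecke_gen_quadratic[OF i] using gen_closed[OF i] T_closed[OF ys]
      by (simp add: T_xs H.l_distr Q_smult_mult H.smult_closed)
    also have "\<dots> \<in> H.span (T ` perms)"
      using span H.span_add1[OF closed]
        submodule.smult_closed[OF H.span_is_submodule[OF closed], of "q - inverse q"] by simp
    finally show ?thesis .
  qed
qed

lemma span_T: "H.span (T ` perms) = carrier H"
proof
  have closed: "T ` perms \<subseteq> carrier H" using T_closed by blast
  then show "H.span (T ` perms) \<subseteq> carrier H" by (rule H.span_is_subset2)
  show "carrier H \<subseteq> H.span (T ` perms)"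
  proof
    fix x assume "x \<in> carrier H"
    then show "x \<in> H.span (T ` perms)"
    proof (induction rule: hecke_induct)
      case one
      have "rev (sorted_list_of_set {1..n}) \<in> perms" by (simp add: permutations_of_set_def)
      then have "\<one>\<^bsub>H\<^esub> \<in> T ` perms" by (metis T_decreasing imageI)
      then show ?case using H.in_own_span[OF closed] by blast
    next
      case (add x y)
      then show ?case by (intro H.span_add1[OF closed])
    next
      case (smult c x)
      then show ?case using submodule.smult_closed[OF H.span_is_submodule[OF closed], of c x] by simp
    next
      case (gen i x)
      then show ?case
        using H.endomorphism_in_span[OF
            left_mult_module_hom[OF gen_closed[OF gen(1)]] closed _ closed gen(3)]
          gen_T_in_span[OF gen(1)] by auto
    qed
  qed
qed

end

locale hecke_representation = hecke n q + hecke_action scale q \<sigma> + linear_extensions scale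
  for n :: nat and q :: "'k::field" and scale :: "'k \<Rightarrow> 'b::ab_group_add \<Rightarrow> 'b" (infixr \<open>*s\<close> 75)
    and \<sigma> :: "nat \<Rightarrow> 'b \<Rightarrow> 'b"
begin

definition letter_act :: "nat \<times> bool \<Rightarrow> 'b \<Rightarrow> 'b" where
  "letter_act l v = (if snd l then \<sigma> (fst l) v else \<sigma> (fst l) v - (q - inverse q) *s v)"

lemma letter_act_add: "letter_act l (v + w) = letter_act l v + letter_act l w"
  and letter_act_scale: "letter_act l (c *s v) = c *s letter_act l v"
  by (simp_all add: letter_act_def gen_add gen_scale scale_right_distrib scale_right_diff_distrib
      mult.commute add_diff_eq diff_add_eq)

sublocale presented_group_action "{1..<n}" "braid_relations n" letter_act
proof
  show "letter_act (i, s) (letter_act (i, \<not> s) v) = v" if "i \<in> {1..<n}" for i s v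
  proof -
    have "\<sigma> i (\<sigma> i v - (q - inverse q) *s v) = \<sigma> i (\<sigma> i v) - (q - inverse q) *s \<sigma> i v"
      using gen_add[of i "\<sigma> i v - (q - inverse q) *s v" "(q - inverse q) *s v"] by (simp add: gen_scale)
    then show ?thesis using that by (cases s) (simp_all add: letter_act_def gen_quadratic)
  qed
  fix r r' :: "nat gword" and v
  assume "(r, r') \<in> braid_relations n" "r \<in> gwords {1..<n}" "r' \<in> gwords {1..<n}"
  then consider i j where "r = [(i, True), (j, True), (i, True)]" "r' = [(j, True), (i, True), (j, True)]"
      "1 \<le> i" "1 \<le> j" "j = Suc i \<or> i = Suc j"
    | i j where "r = [(i, True), (j, True)]" "r' = [(j, True), (i, True)]"
      "1 \<le> i" "1 \<le> j" "Suc i < j \<or> Suc j < i"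
    unfolding braid_relations_def by fastforce
  then show "foldr letter_act r v = foldr letter_act r' v"
    by cases (auto simp: letter_act_def gen_braid intro: gen_commute gen_commute[symmetric])
qed

lemma linear_group_act: "Vector_Spaces.linear scale scale (group_act g)"
proof -
  have "Vector_Spaces.linear scale scale (foldr letter_act u)" for u
    by (induction u)
      (simp_all add: Vector_Spaces.linear_iff vector_space_axioms letter_act_add letter_act_scale)
  then show ?thesis by (simp only: group_act_def[abs_def])
qed

definition algebra_act :: "(nat gword set \<Rightarrow> 'k) \<Rightarrow> 'b \<Rightarrow> 'b" where
  "algebra_act f v = linear_extension (\<lambda>g. group_act g v) f"

lemma algebra_act_zero: "algebra_act \<zero>\<^bsub>BA\<^esub> v = 0"
  by (simp add: algebra_act_def braid_algebra_def linear_extension_zero)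

lemma algebra_act_add:
  "f \<in> carrier BA \<Longrightarrow> f' \<in> carrier BA \<Longrightarrow> algebra_act (f \<oplus>\<^bsub>BA\<^esub> f') v = algebra_act f v + algebra_act f' v"
  by (simp add: algebra_act_def braid_algebra_def linear_extension_add)

lemma algebra_act_smult: "algebra_act (c \<odot>\<^bsub>BA\<^esub> f) v = c *s algebra_act f v"
  by (simp add: algebra_act_def braid_algebra_def linear_extension_smult)

lemma algebra_act_mult:
  assumes "f \<in> carrier BA" "f' \<in> carrier BA"
  shows "algebra_act (f \<otimes>\<^bsub>BA\<^esub> f') v = algebra_act f (algebra_act f' v)"
proof -
  have carriers: "f \<in> carrier (group_algebra B)" "f' \<in> carrier (group_algebra B)"
    using assms by (simp_all add: braid_algebra_def)
  have "algebra_act (f \<otimes>\<^bsub>BA\<^esub> f') v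
      = linear_extension (\<lambda>g. linear_extension (\<lambda>h. group_act (g \<otimes>\<^bsub>B\<^esub> h) v) f') f"
    unfolding algebra_act_def braid_algebra_def by (rule linear_extension_mult[OF carriers])
  also have "\<dots> = linear_extension (\<lambda>g. linear_extension (\<lambda>h. group_act g (group_act h v)) f') f"
    by (intro linear_extension_cong[OF carriers(1)] linear_extension_cong[OF carriers(2)])
      (simp add: braid_group_def group_act_mult)
  also have "\<dots> = algebra_act f (algebra_act f' v)"
    by (simp only: algebra_act_def linear_linear_extension[OF linear_group_act])
  finally show ?thesis .
qed

lemma algebra_act_zero_right: "algebra_act f 0 = 0"
proof -
  have "group_act g 0 = 0" for g
    using linear_group_act[of g] by (metis Vector_Spaces.linear_iff scale_zero_left)
  then show ?thesis by (simp add: algebra_act_def linear_extension_def)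
qed

lemma algebra_act_delta: "u \<in> braid_words \<Longrightarrow> algebra_act (\<delta> u) v = foldr letter_act u v"
  by (simp add: algebra_act_def linear_extension_elem group_act_pres_class)

definition annihilator :: "(nat gword set \<Rightarrow> 'k) set" where
  "annihilator = {f \<in> carrier BA. \<forall>v. algebra_act f v = 0}"

lemma ideal_annihilator: "ideal annihilator BA"
proof (rule idealI)
  show "ring BA" by (rule BA.ring_axioms)
  show "subgroup annihilator (add_monoid BA)"
  proof (rule BA.add.subgroupI)
    show "annihilator \<noteq> {}" using BA.zero_closed algebra_act_zero by (auto simp: annihilator_def)
    show "\<ominus>\<^bsub>BA\<^esub> f \<in> annihilator" if "f \<in> annihilator" for f
    proof -
      have f: "f \<in> carrier BA" "\<And>v. algebra_act f v = 0" using that by (auto simp: annihilator_def)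
      have "algebra_act (f \<oplus>\<^bsub>BA\<^esub> \<ominus>\<^bsub>BA\<^esub> f) v = algebra_act f v + algebra_act (\<ominus>\<^bsub>BA\<^esub> f) v" for v
        using f(1) by (intro algebra_act_add) auto
      then show ?thesis using f by (simp add: BA.r_neg algebra_act_zero annihilator_def)
    qed
  qed (auto simp: annihilator_def algebra_act_add)
qed (auto simp: annihilator_def algebra_act_mult algebra_act_zero_right)

lemma quadratic_relator_in_annihilator:
  assumes i: "i \<in> {1..<n}"
  shows "quadratic_relator i \<in> annihilator"
proof -
  let ?s = "\<delta> [(i, True)]"
  let ?rhs = "((q - inverse q) \<odot>\<^bsub>BA\<^esub> ?s) \<oplus>\<^bsub>BA\<^esub> \<one>\<^bsub>BA\<^esub>"
  have s: "?s \<in> carrier BA" and rhs: "?rhs \<in> carrier BA"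
    using i by (simp_all add: delta_closed BA_smult_closed)
  have act_s: "algebra_act ?s v = \<sigma> i v" for v using i by (simp add: algebra_act_delta letter_act_def)
  have act_rhs: "algebra_act ?rhs v = (q - inverse q) *s \<sigma> i v + v" for v
    using s by (simp add: algebra_act_add BA_smult_closed algebra_act_smult act_s)
      (simp add: one_BA algebra_act_delta)
  have "\<sigma> i (\<sigma> i v) = algebra_act (quadratic_relator i) v + algebra_act ?rhs v" for v
    using algebra_act_mult[OF s s, of v] algebra_act_add[OF quadratic_relator_closed[OF i] rhs, of v]
    by (simp only: act_s flip: quadratic_relator_add[OF i])
  then have "algebra_act (quadratic_relator i) v = 0" for v
    using i by (simp add: act_rhs gen_quadratic)
  then show ?thesis using quadratic_relator_closed[OF i] by (simp add: annihilator_def)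
qed

lemma hecke_ideal_subset_annihilator: "hecke_ideal n q \<subseteq> annihilator"
  unfolding hecke_ideal_eq
  using quadratic_relator_in_annihilator by (intro BA.genideal_minimal[OF ideal_annihilator]) auto

definition hecke_act :: "(nat gword set \<Rightarrow> 'k) set \<Rightarrow> 'b \<Rightarrow> 'b" where
  "hecke_act x v = algebra_act (SOME f. f \<in> x) v"

lemma hecke_act_proj:
  assumes "f \<in> carrier BA"
  shows "hecke_act (proj f) v = algebra_act f v"
proof -
  have "(SOME f'. f' \<in> proj f) \<in> proj f" 
    using proj_self[OF assms] by (rule someI[of "\<lambda>f'. f' \<in> proj f"])
  then obtain g where g: "g \<in> hecke_ideal n q" "(SOME f'. f' \<in> proj f) = g \<oplus>\<^bsub>BA\<^esub> f"
    by (rule mem_projE)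
  then have "g \<in> carrier BA" "algebra_act g v = 0"
    using hecke_ideal_subset_annihilator by (auto simp: annihilator_def)
  then show ?thesis using assms by (simp add: hecke_act_def g(2) algebra_act_add)
qed

lemma hecke_act_add:
  "x \<in> carrier H \<Longrightarrow> y \<in> carrier H \<Longrightarrow> hecke_act (x \<oplus>\<^bsub>H\<^esub> y) v = hecke_act x v + hecke_act y v"
  by (auto simp: carrier_Q proj_add hecke_act_proj algebra_act_add)

lemma hecke_act_smult: "x \<in> carrier H \<Longrightarrow> hecke_act (c \<odot>\<^bsub>H\<^esub> x) v = c *s hecke_act x v"
  by (auto simp: carrier_Q proj_smult hecke_act_proj BA_smult_closed algebra_act_smult)

lemma hecke_act_mult:
  "x \<in> carrier H \<Longrightarrow> y \<in> carrier H \<Longrightarrow> hecke_act (x \<otimes>\<^bsub>H\<^esub> y) v = hecke_act x (hecke_act y v)"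
  by (auto simp: carrier_Q proj_mult hecke_act_proj algebra_act_mult)

lemma hecke_act_one: "hecke_act \<one>\<^bsub>H\<^esub> v = v"
  using delta_closed[of "[]"] by (simp add: proj_one one_BA hecke_act_proj algebra_act_delta)

lemma hecke_act_gen: "i \<in> {1..<n} \<Longrightarrow> hecke_act (gen i) v = \<sigma> i v"
  by (simp add: gen_eq hecke_act_proj delta_closed algebra_act_delta letter_act_def)

lemma hecke_act_gen_prod:
  "(\<And>i. i \<in> set ws \<Longrightarrow> 1 \<le> i \<and> i < n) \<Longrightarrow> hecke_act (gen_prod ws) v = foldr \<sigma> ws v"
proof (induction ws)
  case (Cons i ws)
  then have "i \<in> {1..<n}" "gen_prod ws \<in> carrier H" by (auto intro!: gen_prod_closed)
  then show ?case using Cons gen_closed[of i] by (simp add: hecke_act_mult hecke_act_gen)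
qed (simp add: hecke_act_one)

sublocale orbit: linear_map_to_type H scale "\<lambda>x. hecke_act x v" for v
  by unfold_locales (simp_all add: hecke_act_add hecke_act_smult)

lemma hecke_act_additive_shuffle: "hecke_act (additive_shuffle n q) v = shuffle n v"
proof -
  have closed: "gen_prod [n - k..<n] \<in> carrier H" if "k < n" for k
    using that by (intro gen_prod_closed) auto
  have "hecke_act (additive_shuffle n q) v = (\<Sum>k<n. hecke_act (q ^ k \<odot>\<^bsub>H\<^esub> gen_prod [n - k..<n]) v)"
    unfolding additive_shuffle_def using closed by (intro orbit.map_finsum) (auto intro: H.smult_closed)
  also have "\<dots> = (\<Sum>k<n. q ^ k *s foldr \<sigma> [n - k..<n] v)"
    using closed
    by (intro sum.cong) (auto simp: hecke_act_smult intro!: arg_cong2[of _ _ _ _ scale] hecke_act_gen_prod)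
  finally show ?thesis by (simp only: shuffle_eq_sum)
qed

lemma hecke_act_shuffle_operator:
  "x \<in> carrier H \<Longrightarrow> hecke_act (shuffle_operator n q x) v = shuffle n (hecke_act x v)"
  by (simp add: shuffle_operator_def hecke_act_mult additive_shuffle_closed hecke_act_additive_shuffle)

end

section \<open>The regular representation on words\<close>

locale hecke_words = hecke n q
  for n :: nat and q :: "'k::field"
begin

sublocale word_action q
  by unfold_locales (rule q_nonzero)

sublocale hecke_representation n q "scale_fun :: 'k \<Rightarrow> ((nat \<Rightarrow> nat) \<Rightarrow> 'k) \<Rightarrow> (nat \<Rightarrow> nat) \<Rightarrow> 'k" "hecke_op q"
  ..

abbreviation vacuum :: "(nat \<Rightarrow> nat) \<Rightarrow> 'k" where
  "vacuum \<equiv> word_vector (rev (sorted_list_of_set {1..n}))"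

abbreviation act_vacuum :: "(nat gword set \<Rightarrow> 'k) set \<Rightarrow> (nat \<Rightarrow> nat) \<Rightarrow> 'k" where
  "act_vacuum x \<equiv> hecke_act x vacuum"

lemma act_vacuum_T:
  assumes "xs \<in> perms"
  shows "act_vacuum (T xs) = word_vector xs"
proof -
  let ?P = "\<lambda>xs. xs \<in> perms \<longrightarrow> act_vacuum (T xs) = word_vector xs"
  have "?P ([] @ xs)"
  proof (rule decreasing_rearrangement_induct[of ?P])
    fix as bs :: "nat list" and x y :: nat
    assume less: "x < y" and IH: "?P (as @ y # x # bs)"
    show "?P (as @ x # y # bs)"
    proof
      assume perm: "as @ x # y # bs \<in> perms"
      then have swapped: "as @ y # x # bs \<in> perms" by (auto simp: permutations_of_set_def)
      have i: "Suc (length as) \<in> {1..<n}" using length_perms[OF perm] by auto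
      have "T (as @ x # y # bs) = gen (Suc (length as)) \<otimes>\<^bsub>H\<^esub> T (as @ y # x # bs)"
        using T_swap[OF swapped less] by simp
      then have "act_vacuum (T (as @ x # y # bs))
          = hecke_op q (Suc (length as)) (word_vector (as @ y # x # bs))"
        using IH swapped i gen_closed[OF i] T_closed[OF swapped]
        by (simp add: hecke_act_mult hecke_act_gen)
      then show "act_vacuum (T (as @ x # y # bs)) = word_vector (as @ x # y # bs)"
        using less by (simp add: hecke_op_word_vector)
    qed
  next
    have "foldr ins xs [] = rev (sorted_list_of_set {1..n})"
      using assms foldr_ins_Nil[of xs] by (simp add: permutations_of_set_def)
    then show "?P ([] @ foldr ins xs [])" by (simp add: T_decreasing hecke_act_one)
  qed
  then show ?thesis using assms by simp
qed

lemma independent_perms: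
  "inj_on (word_vector :: _ \<Rightarrow> (nat \<Rightarrow> nat) \<Rightarrow> 'k) perms"
  "funs.independent ((word_vector :: _ \<Rightarrow> (nat \<Rightarrow> nat) \<Rightarrow> 'k) ` perms)"
  using independent_word_vectors[of perms n] length_perms by auto

lemma T_image: "finite (T ` perms)" "T ` perms \<subseteq> carrier H"
  using T_closed by auto

lemma act_vacuum_image_T: "act_vacuum ` T ` perms = word_vector ` perms"
  using act_vacuum_T by (auto simp: image_image)

lemma inj_on_act_vacuum: "inj_on act_vacuum (carrier H)"
proof -
  have "inj_on act_vacuum (T ` perms)"
    using act_vacuum_T independent_perms(1) by (auto simp: inj_on_def)
  then have "inj_on act_vacuum (H.span (T ` perms))"
    using independent_perms(2) by (intro orbit.inj_on_span T_image) (simp_all add: act_vacuum_image_T)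
  then show ?thesis by (simp only: span_T)
qed

lemma act_vacuum_carrier: "act_vacuum ` carrier H = funs.span (word_vector ` perms)"
  using orbit.map_span[OF T_image, of vacuum] by (simp only: span_T act_vacuum_image_T)

definition shuffle_element :: "nat list \<Rightarrow> (nat gword set \<Rightarrow> 'k) set" where
  "shuffle_element w = the_inv_into (carrier H) act_vacuum (shuffle_basis [] w)"

lemma
  assumes "w \<in> perms"
  shows shuffle_element_closed: "shuffle_element w \<in> carrier H"
    and act_vacuum_shuffle_element: "act_vacuum (shuffle_element w) = shuffle_basis [] w"
proof -
  have "leading_word w [] (shuffle_basis [] w)"
    using assms by (intro leading_word_shuffle_basis) (simp add: permutations_of_set_def)
  from leading_word_in_span_permutations[OF this assms]
  have "shuffle_basis [] w \<in> act_vacuum ` carrier H" by (simp add: act_vacuum_carrier)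
  then show "shuffle_element w \<in> carrier H" "act_vacuum (shuffle_element w) = shuffle_basis [] w"
    unfolding shuffle_element_def
    by (auto intro: the_inv_into_into[OF inj_on_act_vacuum] f_the_inv_into_f[OF inj_on_act_vacuum])
qed

lemma act_vacuum_image_shuffle_element:
  "W \<subseteq> perms \<Longrightarrow> act_vacuum ` shuffle_element ` W = shuffle_basis [] ` W"
  using act_vacuum_shuffle_element by (force simp: image_image)

lemma independent_shuffle_basis:
  "inj_on (shuffle_basis []) perms" "funs.independent (shuffle_basis [] ` perms)"
proof -
  have "word_vector ` perms \<subseteq> funs.span (shuffle_basis [] ` perms)"
    using word_vector_in_span_shuffle_basis[of _ "{1..n}" "[]"] by auto
  then show "inj_on (shuffle_basis []) perms" "funs.independent (shuffle_basis [] ` perms)"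
    using funs.independent_family_if_spans[OF _ independent_perms] by simp_all
qed

lemma inj_on_shuffle_element: "inj_on shuffle_element perms"
  using independent_shuffle_basis(1) act_vacuum_shuffle_element by (metis inj_on_def)

lemma basis_shuffle_element: "H.basis (shuffle_element ` perms)"
proof (rule orbit.basisI[OF inj_on_act_vacuum])
  have "funs.span (word_vector ` perms) \<subseteq> funs.span (shuffle_basis [] ` perms)"
    using word_vector_in_span_shuffle_basis[of _ "{1..n}" "[]"] by (intro funs.span_minimal) auto
  then show "act_vacuum ` carrier H \<subseteq> funs.span (act_vacuum ` shuffle_element ` perms)"
    by (simp add: act_vacuum_carrier act_vacuum_image_shuffle_element)
qed (use shuffle_element_closed independent_shuffle_basis(2) in
    \<open>auto simp: act_vacuum_image_shuffle_element\<close>)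

lemma shuffle_operator_shuffle_element:
  assumes w: "w \<in> perms"
  shows "shuffle_operator n q (shuffle_element w) \<ominus>\<^bsub>H\<^esub>
      q_bracket q (card (singles w)) \<odot>\<^bsub>H\<^esub> shuffle_element w
    \<in> H.span (shuffle_element ` {w' \<in> perms. card (singles w) < card (singles w')})"
    (is "?x \<in> H.span ?higher")
proof -
  let ?b = "shuffle_element w"
  have b: "?b \<in> carrier H" "shuffle_operator n q ?b \<in> carrier H"
      "q_bracket q (card (singles w)) \<odot>\<^bsub>H\<^esub> ?b \<in> carrier H"
    using shuffle_element_closed[OF w] H.endomorphism_simps(3)[OF shuffle_operator_module_hom] H.smult_closed
    by simp_all
  have "act_vacuum ?x
      = shuffle n (shuffle_basis [] w) - q_bracket q (card (singles w)) *\<^sub>f shuffle_basis [] w"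
    using b
    by (simp only: orbit.map_minus hecke_act_smult hecke_act_shuffle_operator act_vacuum_shuffle_element[OF w])
  also have "\<dots> \<in> funs.span (shuffle_basis [] ` {w' \<in> perms. card (singles w) < card (singles w')})"
    using shuffle_shuffle_basis[OF w, of "[]"] by simp
  also have "\<dots> = funs.span (act_vacuum ` ?higher)" by (subst act_vacuum_image_shuffle_element) auto
  finally have "act_vacuum ?x \<in> funs.span (act_vacuum ` ?higher)" .
  moreover have "?higher \<subseteq> carrier H" using shuffle_element_closed by auto
  ultimately show ?thesis using b orbit.in_span_iff[OF inj_on_act_vacuum, of ?higher ?x] by simp
qed

lemmas shuffle_operator_triangular = shuffle_operator_module_hom finite_permutations_of_set
  inj_on_shuffle_element basis_shuffle_element shuffle_operator_shuffle_element

lemma shuffle_operator_char_poly: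
  "operator_char_poly H (shuffle_operator n q) = (\<Prod>w\<in>perms. [:- q_bracket q (card (singles w)), 1:])"
  by (rule H.triangular_operator_char_poly[OF shuffle_operator_triangular])

lemma shuffle_operator_eigenvalue:
  "operator_eigenvalue H (shuffle_operator n q) c \<Longrightarrow> \<exists>w\<in>perms. c = q_bracket q (card (singles w))"
  by (rule H.triangular_operator_eigenvalue[OF shuffle_operator_triangular])

end

section \<open>Eigenvalues and multiplicities\<close>

lemma q_bracket_geometric: "(q ^ 2 - 1) * q_bracket q j = q ^ (2 * j) - 1"
  using power_diff_1_eq[of "q ^ 2" j] by (simp add: q_bracket_def power_mult)

lemma shuffle_eigenvalue_eq:
  fixes q :: "'k::field"
  assumes "q \<noteq> 0" "q ^ 2 \<noteq> 1"
  shows "shuffle_eigenvalue q j = q_bracket q j"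
proof -
  have denominator: "q - inverse q = (q ^ 2 - 1) / q"
    using assms by (simp add: field_simps power2_eq_square)
  have "q powi (int j - 1) * (q powi int j - q powi (- int j)) = (q ^ (2 * j) - 1) / q"
    using assms(1) by (simp add: power_int_diff power_int_minus field_simps power_mult power2_eq_square
        power_mult_distrib)
  then have "shuffle_eigenvalue q j = ((q ^ (2 * j) - 1) / q) / ((q ^ 2 - 1) / q)"
    unfolding shuffle_eigenvalue_def q_int_def denominator times_divide_eq_right by (simp only:)
  also have "\<dots> = q_bracket q j"
    unfolding q_bracket_geometric[symmetric] using assms by simp
  finally show ?thesis .
qed

lemma q_bracket_inject:
  fixes q :: "'k::field"
  assumes "q \<noteq> 0" "\<And>m. m \<ge> 1 \<Longrightarrow> q ^ m \<noteq> 1"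
  shows "q_bracket q i = q_bracket q j \<longleftrightarrow> i = j"
proof -
  have "i = j" if "i \<le> j" "q_bracket q i = q_bracket q j" for i j
  proof -
    have "q ^ (2 * i) = q ^ (2 * j)"
      using that(2) q_bracket_geometric[of q i] q_bracket_geometric[of q j] by simp
    also have "\<dots> = q ^ (2 * i) * q ^ (2 * (j - i))"
      using that(1) by (simp flip: power_add add_mult_distrib2)
    finally have "q ^ (2 * (j - i)) = 1" using assms(1) by simp
    then show "i = j" using assms(2)[of "2 * (j - i)"] that(1) by (cases "j - i") auto
  qed
  from this[of i j] this[of j i] show ?thesis by (metis linear)
qed

context hecke_words
begin

lemma eigenvalue_multiplicity_shuffle:
  assumes "\<And>m. m \<ge> 1 \<Longrightarrow> q ^ m \<noteq> 1"
  shows "eigenvalue_multiplicity H (shuffle_operator n q) (shuffle_eigenvalue q j)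
    = card {w \<in> perms. card (singles w) = j}"
  using assms[of 2] by (simp add: eigenvalue_multiplicity_def shuffle_operator_char_poly
      shuffle_eigenvalue_eq[OF q_nonzero] order_prod_linear_factors q_bracket_inject[OF q_nonzero assms])

lemma card_singles_le: "w \<in> perms \<Longrightarrow> card (singles w) \<le> n"
  using card_mono[OF _ singles_subset, of w] by (simp add: permutations_of_set_def)

lemma card_singles_neq_pred:
  assumes "1 \<le> n" "w \<in> perms"
  shows "card (singles w) \<noteq> n - 1"
proof -
  have "n - (n - 1) = 1" using assms(1) by simp
  then have "card {w \<in> perms. card (singles w) = n - 1} = 0"
    using words.card_card_fixed[of "{1..n}" "n - 1"] by (simp add: One_nat_def)
  then show ?thesis using assms(2) by auto
qed

lemma shuffle_operator_eigenvalue_among: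
  assumes "q ^ 2 \<noteq> 1" "operator_eigenvalue H (shuffle_operator n q) c"
  shows "\<exists>j\<in>{0..n}. c = shuffle_eigenvalue q j"
proof -
  obtain w where "w \<in> perms" "c = q_bracket q (card (singles w))"
    using shuffle_operator_eigenvalue[OF assms(2)] by blast
  then show ?thesis
    using card_singles_le[of w] shuffle_eigenvalue_eq[OF q_nonzero assms(1)]
    by (intro bexI[of _ "card (singles w)"]) auto
qed

lemma not_eigenvalue_pred:
  assumes "1 \<le> n" "\<And>m. m \<ge> 1 \<Longrightarrow> q ^ m \<noteq> 1"
  shows "\<not> operator_eigenvalue H (shuffle_operator n q) (shuffle_eigenvalue q (n - 1))"
proof
  assume "operator_eigenvalue H (shuffle_operator n q) (shuffle_eigenvalue q (n - 1))"
  then obtain w where "w \<in> perms" "shuffle_eigenvalue q (n - 1) = q_bracket q (card (singles w))"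
    using shuffle_operator_eigenvalue by blast
  moreover have "q ^ 2 \<noteq> 1" using assms(2)[of 2] by simp
  ultimately show False
    using card_singles_neq_pred[OF assms(1), of w] q_bracket_inject[OF q_nonzero assms(2)]
    by (simp add: shuffle_eigenvalue_eq[OF q_nonzero])
qed

end

theorem mainTheorem8:
  fixes q :: "'k::field" and n :: nat
  assumes "n \<ge> 1"
    and "q \<noteq> 0"
    and "\<forall>m::nat. m \<ge> 1 \<longrightarrow> q ^ m \<noteq> 1"
  shows "(\<forall>c. operator_eigenvalue (hecke_algebra n q) (shuffle_operator n q) c
            \<longrightarrow> (\<exists>j\<in>{0..n}. c = shuffle_eigenvalue q j))
       \<and> (\<forall>j\<in>{0..n}. shuffle_eigenvalue q j = (\<Sum>i<j. q ^ (2 * i)))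
       \<and> (\<forall>j\<in>{0..n}.
            real (eigenvalue_multiplicity (hecke_algebra n q) (shuffle_operator n q)
                    (shuffle_eigenvalue q j))
              = fact n / fact j * (\<Sum>i=0..n - j. (- 1) ^ i / fact i)
          \<and> eigenvalue_multiplicity (hecke_algebra n q) (shuffle_operator n q)
                (shuffle_eigenvalue q j)
              = card {p. p permutes {1..n} \<and> card {i \<in> {1..n}. p i = i} = j})
       \<and> \<not> operator_eigenvalue (hecke_algebra n q) (shuffle_operator n q)
              (shuffle_eigenvalue q (n - 1))"
proof -
  interpret hecke_words n q by unfold_locales fact
  have generic: "q ^ m \<noteq> 1" if "m \<ge> 1" for m using assms(3) that by blast
  then have q2: "q ^ 2 \<noteq> 1" by simp
  have "real (eigenvalue_multiplicity H (shuffle_operator n q) (shuffle_eigenvalue q j))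
      = fact n / fact j * (\<Sum>i=0..n - j. (- 1) ^ i / fact i)"
    and "eigenvalue_multiplicity H (shuffle_operator n q) (shuffle_eigenvalue q j)
      = card {p. p permutes {1..n} \<and> card {i \<in> {1..n}. p i = i} = j}" if "j \<in> {0..n}" for j
    using words.card_card_fixed[of "{1..n}" j] permutations.card_card_fixed[of "{1..n}" j] that
    by (simp_all add: eigenvalue_multiplicity_shuffle[OF generic])
  then show ?thesis
    using shuffle_operator_eigenvalue_among[OF q2]
      shuffle_eigenvalue_eq[OF q_nonzero q2, unfolded q_bracket_def] not_eigenvalue_pred[OF \<open>n \<ge> 1\<close> generic] by blast
qed

end
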